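(* Consider the drifted Brownian motion inventory model with reflection at $\{0\}$ described in the context. For $0<y<z$, the long-term average cost of the delayed $(y,z)$ ordering policy with trigger $0$ is $$\widetilde F(y,z)=\frac{c_1(y,z)+Bg_0(y,z)+\Big(\frac{\sigma^4c_h}{4\mu^3}+\frac{\sigma^2k_5}{2\mu}\Big)\big(e^{2\mu y/\sigma^2}-1\big)}{B\zeta(y,z)+\frac{\sigma^2}{2\mu^2}\big(e^{2\mu y/\sigma^2}-1\big)}.$$ (i) For $0<y<z$, the cost of the delayed $(y,z)$ policy with trigger $0$ is smaller than the cost $F(y,z)$ of the standard $(y,z)$ ordering policy if and only if $\frac{\sigma^2c_h}{2\mu}+k_5\mu<F(y,z)$. A sufficient condition for this to hold for every $0<y<z$ is $$k_5<k_2+\sqrt{\frac{2k_1c_h}{\mu}}.$$ (ii) If $k_5<k_2$, then $\frac{\partial\widetilde F}{\partial y}(0,z)<0$ for $z>0$; in particular, with $z_*=\sqrt{2k_1\mu/c_h}$, for some $y>0$ the delayed $(y,z_* )$ ordering policy with trigger $0$ has lower cost than the $(0,z_* )$ ordering policy, which is optimal among the standard $(y,z)$ ordering policies.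
   Context: Model. Let $\mu,\sigma,c_h,k_1,k_2>0$ and let $k_5$ be a constant. In the absence of orders the inventory is a Brownian motion with drift $-\mu$ and diffusion coefficient $\sigma$ reflected at $\{0\}$, with state space $[0,\infty)$ and initial value $x_0>0$. An ordering policy $(\tau,Y)$ is an increasing sequence of stopping times $\tau_k$ (of the augmented filtration of the uncontrolled process) with nonnegative $\mathcal F_{\tau_k}$-measurable order sizes $Y_k$; the resulting inventory $X$ jumps up by $Y_k$ at $\tau_k$ and $L_0$ denotes its local time at $\{0\}$ (so $dX=-\mu\,dt+\sigma\,dW+dL_0+$ jumps). With $c_0(x)=c_hx$ and $c_1(y,z)=k_1+k_2(z-y)$, the long-term average cost is $$J(\tau,Y)=\limsup_{t\to\infty}\frac1t\,\mathbb E_{x_0}\Big[\int_0^tc_0(X(s))\,ds+\sum_{k=1}^\infty I_{\{\tau_k\le t\}}c_1(X(\tau_k-),X(\tau_k))+k_5L_0(t)\Big].$$ Standard $(y,z)$ ordering policy ($0\le y<z$): $\tau_0=0$, $\tau_k=\inf\{t>\tau_{k-1}:X(t-)\le y\}$, $Y_k=z-X(\tau_k-)$ (when $y=0$ the order occurs before any reflection). With $g_0(x)=\frac{c_h}{2\mu}x^2+\frac{\sigma^2c_h}{2\mu^2}x$, $\zeta(x)=x/\mu$, $Bf(y,z)=f(z)-f(y)$, its cost is $F(y,z)=\frac{c_1(y,z)+Bg_0(y,z)}{B\zeta(y,z)}$. Delayed $(y,z)$ ordering policy with trigger $0$ ($0<y<z$): each order raises the inventory to the level $z$; after an order, the next order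 is placed only after $X$ has first hit $0$ (where it reflects), namely at the first subsequent time $X$ hits $y$. The expression $\widetilde F(0,z)$ is defined by the displayed formula with $y=0$; it equals $F(0,z)$. *)

theory Defs
  imports "HOL-Probability.Probability"
begin

section \<open>Cost functions\<close>

definition c0 :: "real \<Rightarrow> real \<Rightarrow> real" where
  "c0 c\<^sub>h x = c\<^sub>h * x"

definition c1 :: "real \<Rightarrow> real \<Rightarrow> real \<Rightarrow> real \<Rightarrow> real" where
  "c1 k\<^sub>1 k\<^sub>2 y z = k\<^sub>1 + k\<^sub>2 * (z - y)"

definition g0 :: "real \<Rightarrow> real \<Rightarrow> real \<Rightarrow> real \<Rightarrow> real" where
  "g0 \<mu> \<sigma> c\<^sub>h x = c\<^sub>h / (2 * \<mu>) * x\<^sup>2 + \<sigma>\<^sup>2 * c\<^sub>h / (2 * \<mu>\<^sup>2) * x"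

definition zeta :: "real \<Rightarrow> real \<Rightarrow> real" where
  "zeta \<mu> x = x / \<mu>"

definition Bdiff :: "(real \<Rightarrow> real) \<Rightarrow> real \<Rightarrow> real \<Rightarrow> real" where
  "Bdiff f y z = f z - f y"

definition F_std :: "real \<Rightarrow> real \<Rightarrow> real \<Rightarrow> real \<Rightarrow> real \<Rightarrow> real \<Rightarrow> real \<Rightarrow> real" where
  "F_std \<mu> \<sigma> c\<^sub>h k\<^sub>1 k\<^sub>2 y z =
     (c1 k\<^sub>1 k\<^sub>2 y z + Bdiff (g0 \<mu> \<sigma> c\<^sub>h) y z) / Bdiff (zeta \<mu>) y z"

definition F_delayed ::
  "real \<Rightarrow> real \<Rightarrow> real \<Rightarrow> real \<Rightarrow> real \<Rightarrow> real \<Rightarrow> real \<Rightarrow> real \<Rightarrow> real" where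
  "F_delayed \<mu> \<sigma> c\<^sub>h k\<^sub>1 k\<^sub>2 k\<^sub>5 y z =
     (c1 k\<^sub>1 k\<^sub>2 y z + Bdiff (g0 \<mu> \<sigma> c\<^sub>h) y z
        + (\<sigma>^4 * c\<^sub>h / (4 * \<mu>^3) + \<sigma>\<^sup>2 * k\<^sub>5 / (2 * \<mu>)) * (exp (2 * \<mu> * y / \<sigma>\<^sup>2) - 1))
     / (Bdiff (zeta \<mu>) y z + \<sigma>\<^sup>2 / (2 * \<mu>\<^sup>2) * (exp (2 * \<mu> * y / \<sigma>\<^sup>2) - 1))"

section \<open>Brownian motion and reflected inventory processes\<close>

definition brownian_motion :: "'a measure \<Rightarrow> (real \<Rightarrow> 'a \<Rightarrow> real) \<Rightarrow> bool" where
  "brownian_motion M W \<longleftrightarrow>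
     prob_space M \<and>
     (\<forall>t\<ge>0. W t \<in> borel_measurable M) \<and>
     (AE \<omega> in M. W 0 \<omega> = 0 \<and> continuous_on {0..} (\<lambda>t. W t \<omega>)) \<and>
     (\<forall>s t. 0 \<le> s \<and> s < t \<longrightarrow>
        distributed M lborel (\<lambda>\<omega>. W t \<omega> - W s \<omega>) (normal_density 0 (sqrt (t - s)))) \<and>
     (\<forall>(t :: nat \<Rightarrow> real) n. 0 \<le> t 0 \<and> strict_mono t \<longrightarrow>
        prob_space.indep_vars M (\<lambda>_. borel) (\<lambda>i \<omega>. W (t (Suc i)) \<omega> - W (t i) \<omega>) {..<n})"

text \<open>
  Orders are numbered from 1: the k-th order, placed at time \<open>\<tau> k\<close>, has size \<open>Y k\<close>;
  \<open>\<tau> 0\<close> is the initial time and \<open>Y 0\<close> is not used. The time \<open>\<infinity>\<close> means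
  that the order is never placed.

  \<open>X\<close> is the inventory and \<open>L\<close> its local time at 0, i.e. the regulator in
  \<open>dX = - \<mu> dt + \<sigma> dW + dL + jumps\<close> (Skorokhod reflection problem): \<open>L\<close> starts at 0,
  is continuous and nondecreasing, and does not grow on time intervals on which \<open>X\<close> is
  strictly positive. An order placed when the left limit of \<open>X\<close> reaches 0 therefore
  precludes any reflection.
\<close>

definition reflected_inventory ::
  "'a measure \<Rightarrow> real \<Rightarrow> real \<Rightarrow> real \<Rightarrow> (real \<Rightarrow> 'a \<Rightarrow> real) \<Rightarrow>
   (nat \<Rightarrow> 'a \<Rightarrow> ereal) \<Rightarrow> (nat \<Rightarrow> 'a \<Rightarrow> real) \<Rightarrow>
   (real \<Rightarrow> 'a \<Rightarrow> real) \<Rightarrow> (real \<Rightarrow> 'a \<Rightarrow> real) \<Rightarrow> bool" where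
  "reflected_inventory M \<mu> \<sigma> x\<^sub>0 W \<tau> Y X L \<longleftrightarrow>
     (\<forall>t\<ge>0. X t \<in> borel_measurable M \<and> L t \<in> borel_measurable M) \<and>
     (AE \<omega> in M.
        (\<forall>t\<ge>0. (\<lambda>k. if \<tau> (Suc k) \<omega> \<le> ereal t then Y (Suc k) \<omega> else 0)
                  sums (X t \<omega> - (x\<^sub>0 - \<mu> * t + \<sigma> * W t \<omega> + L t \<omega>))) \<and>
        (\<forall>t\<ge>0. 0 \<le> X t \<omega>) \<and>
        L 0 \<omega> = 0 \<and> continuous_on {0..} (\<lambda>t. L t \<omega>) \<and> mono_on {0..} (\<lambda>t. L t \<omega>) \<and>
        (\<forall>s t. 0 \<le> s \<and> s \<le> t \<and> (\<forall>u\<in>{s..t}. 0 < X u \<omega>) \<longrightarrow> L t \<omega> = L s \<omega>))"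

definition uncontrolled_inventory ::
  "'a measure \<Rightarrow> real \<Rightarrow> real \<Rightarrow> real \<Rightarrow> (real \<Rightarrow> 'a \<Rightarrow> real) \<Rightarrow>
   (real \<Rightarrow> 'a \<Rightarrow> real) \<Rightarrow> (real \<Rightarrow> 'a \<Rightarrow> real) \<Rightarrow> bool" where
  "uncontrolled_inventory M \<mu> \<sigma> x\<^sub>0 W U LU \<longleftrightarrow>
     reflected_inventory M \<mu> \<sigma> x\<^sub>0 W (\<lambda>_ _. \<infinity>) (\<lambda>_ _. 0) U LU"

text \<open>The inventory just before time \<open>t\<close>; just before time 0 it is the initial value.\<close>

definition pre_level :: "real \<Rightarrow> (real \<Rightarrow> 'a \<Rightarrow> real) \<Rightarrow> real \<Rightarrow> 'a \<Rightarrow> real" where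
  "pre_level x\<^sub>0 X t \<omega> = (if t \<le> 0 then x\<^sub>0 else Lim (at_left t) (\<lambda>s. X s \<omega>))"

section \<open>Ordering policies\<close>

text \<open>
  The natural filtration of the process, augmented by the null sets. It is indexed by
  extended reals since stopping times may be infinite.
\<close>

definition augmented_filtration ::
  "'a measure \<Rightarrow> (real \<Rightarrow> 'a \<Rightarrow> real) \<Rightarrow> ereal \<Rightarrow> 'a measure" where
  "augmented_filtration M U t =
     sigma (space M)
       ({U s -` A \<inter> space M | s A. 0 \<le> s \<and> ereal s \<le> t \<and> A \<in> sets borel} \<union> null_sets M)"

lemma filtration_augmented: "filtration (space M) (augmented_filtration M U)"
proof -
  have sub: "{U s -` A \<inter> space M | s A. 0 \<le> s \<and> ereal s \<le> t \<and> A \<in> sets borel} \<union> null_sets M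
      \<subseteq> Pow (space M)" for t
    by (auto dest: null_setsD2 sets.sets_into_space)
  show ?thesis
  proof
    show "space (augmented_filtration M U t) = space M" for t
      unfolding augmented_filtration_def by (rule space_measure_of[OF sub])
    show "sets (augmented_filtration M U s) \<subseteq> sets (augmented_filtration M U t)"
      if "s \<le> t" for s t
      unfolding augmented_filtration_def sets_measure_of[OF sub]
      using that by (intro sigma_sets_mono') (blast intro: order_trans)
  qed
qed

definition ordering_policy ::
  "'a measure \<Rightarrow> (real \<Rightarrow> 'a \<Rightarrow> real) \<Rightarrow>
   (nat \<Rightarrow> 'a \<Rightarrow> ereal) \<Rightarrow> (nat \<Rightarrow> 'a \<Rightarrow> real) \<Rightarrow> bool" where
  "ordering_policy M U \<tau> Y \<longleftrightarrow>
     (\<forall>\<omega>\<in>space M. \<tau> 0 \<omega> = 0) \<and>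
     (\<forall>k. \<forall>\<omega>\<in>space M. \<tau> k \<omega> \<le> \<tau> (Suc k) \<omega>) \<and>
     (\<forall>k\<ge>1. stopping_time (augmented_filtration M U) (\<tau> k)) \<and>
     (\<forall>k\<ge>1. Y k \<in> borel_measurable
                    (filtration.pre_sigma (space M) (augmented_filtration M U) (\<tau> k))) \<and>
     (\<forall>k\<ge>1. \<forall>\<omega>\<in>space M. 0 \<le> Y k \<omega>)"

definition orders_up_to ::
  "real \<Rightarrow> real \<Rightarrow> (nat \<Rightarrow> 'a \<Rightarrow> ereal) \<Rightarrow> (nat \<Rightarrow> 'a \<Rightarrow> real) \<Rightarrow>
   (real \<Rightarrow> 'a \<Rightarrow> real) \<Rightarrow> 'a \<Rightarrow> bool" where
  "orders_up_to z x\<^sub>0 \<tau> Y X \<omega> \<longleftrightarrow>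
     (\<forall>k\<ge>1. \<tau> k \<omega> < \<infinity> \<longrightarrow>
        Y k \<omega> = z - pre_level x\<^sub>0 X (real_of_ereal (\<tau> k \<omega>)) \<omega>)"

text \<open>
  The first order may be placed at time 0: if the initial inventory is at or below \<open>y\<close>,
  then \<open>\<tau> 1 = 0\<close>. The infimum of the empty set is \<open>\<infinity>\<close>.
\<close>

definition standard_policy ::
  "'a measure \<Rightarrow> real \<Rightarrow> real \<Rightarrow> real \<Rightarrow> (real \<Rightarrow> 'a \<Rightarrow> real) \<Rightarrow> (real \<Rightarrow> 'a \<Rightarrow> real) \<Rightarrow>
   real \<Rightarrow> real \<Rightarrow> (nat \<Rightarrow> 'a \<Rightarrow> ereal) \<Rightarrow> (nat \<Rightarrow> 'a \<Rightarrow> real) \<Rightarrow>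
   (real \<Rightarrow> 'a \<Rightarrow> real) \<Rightarrow> (real \<Rightarrow> 'a \<Rightarrow> real) \<Rightarrow> bool" where
  "standard_policy M \<mu> \<sigma> x\<^sub>0 W U y z \<tau> Y X L \<longleftrightarrow>
     ordering_policy M U \<tau> Y \<and>
     reflected_inventory M \<mu> \<sigma> x\<^sub>0 W \<tau> Y X L \<and>
     (AE \<omega> in M.
        \<tau> 1 \<omega> = Inf {ereal t | t. 0 \<le> t \<and> pre_level x\<^sub>0 X t \<omega> \<le> y} \<and>
        (\<forall>k\<ge>1. \<tau> (Suc k) \<omega> = Inf {ereal t | t. \<tau> k \<omega> < ereal t \<and> pre_level x\<^sub>0 X t \<omega> \<le> y}) \<and>
        orders_up_to z x\<^sub>0 \<tau> Y X \<omega>)"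

text \<open>
  The cycle that starts at time 0, before any order, follows the same rule as the later ones:
  its order, too, is placed at the first hit of \<open>y\<close> after the first hit of 0.
\<close>

definition trigger_time ::
  "(nat \<Rightarrow> 'a \<Rightarrow> ereal) \<Rightarrow> (real \<Rightarrow> 'a \<Rightarrow> real) \<Rightarrow> nat \<Rightarrow> 'a \<Rightarrow> ereal" where
  "trigger_time \<tau> X k \<omega> = Inf {ereal t | t. 0 \<le> t \<and> \<tau> k \<omega> \<le> ereal t \<and> X t \<omega> = 0}"

definition delayed_policy ::
  "'a measure \<Rightarrow> real \<Rightarrow> real \<Rightarrow> real \<Rightarrow> (real \<Rightarrow> 'a \<Rightarrow> real) \<Rightarrow> (real \<Rightarrow> 'a \<Rightarrow> real) \<Rightarrow>
   real \<Rightarrow> real \<Rightarrow> (nat \<Rightarrow> 'a \<Rightarrow> ereal) \<Rightarrow> (nat \<Rightarrow> 'a \<Rightarrow> real) \<Rightarrow>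
   (real \<Rightarrow> 'a \<Rightarrow> real) \<Rightarrow> (real \<Rightarrow> 'a \<Rightarrow> real) \<Rightarrow> bool" where
  "delayed_policy M \<mu> \<sigma> x\<^sub>0 W U y z \<tau> Y X L \<longleftrightarrow>
     ordering_policy M U \<tau> Y \<and>
     reflected_inventory M \<mu> \<sigma> x\<^sub>0 W \<tau> Y X L \<and>
     (AE \<omega> in M.
        (\<forall>k. \<tau> (Suc k) \<omega> =
           Inf {ereal t | t. 0 \<le> t \<and> trigger_time \<tau> X k \<omega> \<le> ereal t \<and> pre_level x\<^sub>0 X t \<omega> = y}) \<and>
        orders_up_to z x\<^sub>0 \<tau> Y X \<omega>)"

section \<open>Long-term average cost\<close>

definition path_cost ::
  "real \<Rightarrow> real \<Rightarrow> real \<Rightarrow> real \<Rightarrow> real \<Rightarrow> (nat \<Rightarrow> 'a \<Rightarrow> ereal) \<Rightarrow>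
   (real \<Rightarrow> 'a \<Rightarrow> real) \<Rightarrow> (real \<Rightarrow> 'a \<Rightarrow> real) \<Rightarrow> real \<Rightarrow> 'a \<Rightarrow> ereal" where
  "path_cost c\<^sub>h k\<^sub>1 k\<^sub>2 k\<^sub>5 x\<^sub>0 \<tau> X L t \<omega> =
     ereal (LBINT s:{0..t}. c0 c\<^sub>h (X s \<omega>))
     + (\<Sum>k. if \<tau> (Suc k) \<omega> \<le> ereal t
             then ereal (c1 k\<^sub>1 k\<^sub>2 (pre_level x\<^sub>0 X (real_of_ereal (\<tau> (Suc k) \<omega>)) \<omega>)
                                 (X (real_of_ereal (\<tau> (Suc k) \<omega>)) \<omega>))
             else 0)
     + ereal (k\<^sub>5 * L t \<omega>)"

text \<open>
  Extended expectation, the difference of the integrals of the positive and the negative part.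
  In contrast to the Bochner integral it is not 0 when a policy has infinite expected cost.
\<close>

definition ext_expectation :: "'a measure \<Rightarrow> ('a \<Rightarrow> ereal) \<Rightarrow> ereal" where
  "ext_expectation M f =
     enn2ereal (\<integral>\<^sup>+ \<omega>. e2ennreal (f \<omega>) \<partial>M) - enn2ereal (\<integral>\<^sup>+ \<omega>. e2ennreal (- f \<omega>) \<partial>M)"

definition average_cost ::
  "'a measure \<Rightarrow> real \<Rightarrow> real \<Rightarrow> real \<Rightarrow> real \<Rightarrow> real \<Rightarrow> (nat \<Rightarrow> 'a \<Rightarrow> ereal) \<Rightarrow>
   (real \<Rightarrow> 'a \<Rightarrow> real) \<Rightarrow> (real \<Rightarrow> 'a \<Rightarrow> real) \<Rightarrow> ereal" where
  "average_cost M c\<^sub>h k\<^sub>1 k\<^sub>2 k\<^sub>5 x\<^sub>0 \<tau> X L =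
     Limsup at_top (\<lambda>t::real.
       ereal (1 / t) * ext_expectation M (path_cost c\<^sub>h k\<^sub>1 k\<^sub>2 k\<^sub>5 x\<^sub>0 \<tau> X L t))"

end

theory Submission
  imports Defs
begin

text \<open>
  Put \<open>m = 2 \<mu> / \<sigma>\<^sup>2\<close>, let \<open>n\<close> count the orders and \<open>L\<close> be the local time. Three balance equations
  determine the cost rates. Taking expectations of \<open>X\<close> and of \<open>X\<^sup>2\<close>,
  \<open>E X = x - \<mu> t + E L + (z - y) E n\<close> and
  \<open>E X\<^sup>2 = x\<^sup>2 + \<sigma>\<^sup>2 t - 2 \<mu> E \<integral> X + (z\<^sup>2 - y\<^sup>2) E n\<close>; and since \<open>exp (m (\<sigma> W - \<mu> t))\<close> is a
  martingale, the function \<open>exp (m X) - 1\<close>, switched on from the hit of 0 until the next order, gives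
  \<open>m E L = (exp (m y) - 1) E n + O(1)\<close>. As \<open>E X\<^sup>2\<close> stays bounded, dividing by \<open>t\<close> leaves linear
  equations for the rates of \<open>n\<close>, \<open>L\<close> and \<open>\<integral> X\<close>.

  Stochastic integration is avoided: each equation is integration by parts of an adapted process of
  finite variation against \<open>W\<close> or the exponential martingale. The sums over a grid have mean zero, are
  bounded in mean square, and converge pathwise. The bound on \<open>E X\<^sup>2\<close> comes from comparing \<open>X\<close> with
  the reflected random walk, whose tail \<open>exp (- m r)\<close> is preserved by the Lindley recursion.
\<close>


section \<open>The cost functions of the two policies\<close>

text \<open>The policies are not constructed: \<open>\<tau>\<close>, \<open>Y\<close>,
  \<open>X\<close>, \<open>L\<close> are arbitrary data obeying the definitions almost surely, with
  \<open>X\<close> and \<open>L\<close> merely measurable. Two things must be recovered before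
  martingale arguments apply. Order times might coincide or accumulate; the ordering rule together
  with the convergent series of order sizes excludes this. And \<open>X\<close> must be adapted to
  \<open>W\<close>: the local time is a countable supremum, and the order counts are adapted because
  \<open>U\<close>, whose filtration carries the stopping times, is itself a functional of
  \<open>W\<close>. The switch on \<open>exp (m * X) - 1\<close> has three effects. While it is on,
  \<open>X\<close> stays at most \<open>y\<close>, so the integrand is bounded; it turns on where
  the function vanishes, hence without a jump; it turns off with an order, at the price
  \<open>exp (m * y) - 1\<close>. Reflection contributes \<open>m\<close> per unit of local time,
  the derivative at 0. In the quadratic equation the integrand is \<open>X - \<sigma> * W\<close>,
  of finite variation, so no Ito correction occurs along the path; the term
  \<open>\<sigma>\<^sup>2 * t\<close> comes solely from the variance of
  \<open>\<sigma> * W t\<close>.\<close>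

lemma F_std_eq:
  assumes "\<mu> > 0" "y < z"
  shows "F_std \<mu> \<sigma> c\<^sub>h k\<^sub>1 k\<^sub>2 y z =
    k\<^sub>1 * \<mu> / (z - y) + k\<^sub>2 * \<mu> + c\<^sub>h * (z + y) / 2 + \<sigma>\<^sup>2 * c\<^sub>h / (2 * \<mu>)"
proof -
  have "z - y \<noteq> 0" using assms by auto
  have 1: "Bdiff (zeta \<mu>) y z = (z - y) / \<mu>"
    by (simp add: Bdiff_def zeta_def diff_divide_distrib)
  have "c1 k\<^sub>1 k\<^sub>2 y z + Bdiff (g0 \<mu> \<sigma> c\<^sub>h) y z =
    (k\<^sub>1 * \<mu> / (z - y) + k\<^sub>2 * \<mu> + c\<^sub>h * (z + y) / 2 + \<sigma>\<^sup>2 * c\<^sub>h / (2 * \<mu>)) * ((z - y) / \<mu>)"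
  proof -
    have "(k\<^sub>1 * \<mu> / (z - y) + k\<^sub>2 * \<mu> + c\<^sub>h * (z + y) / 2 + \<sigma>\<^sup>2 * c\<^sub>h / (2 * \<mu>)) * ((z - y) / \<mu>)
      = k\<^sub>1 * \<mu> / (z - y) * ((z - y) / \<mu>) + k\<^sub>2 * \<mu> * ((z - y) / \<mu>)
        + c\<^sub>h * (z + y) / 2 * ((z - y) / \<mu>) + \<sigma>\<^sup>2 * c\<^sub>h / (2 * \<mu>) * ((z - y) / \<mu>)"
      by (simp only: distrib_right)
    also have "k\<^sub>1 * \<mu> / (z - y) * ((z - y) / \<mu>) = k\<^sub>1" using assms \<open>z - y \<noteq> 0\<close> by simp
    also have "k\<^sub>2 * \<mu> * ((z - y) / \<mu>) = k\<^sub>2 * (z - y)" using assms by simp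
    also have "c\<^sub>h * (z + y) / 2 * ((z - y) / \<mu>) = c\<^sub>h / (2 * \<mu>) * z\<^sup>2 - c\<^sub>h / (2 * \<mu>) * y\<^sup>2"
      using assms by (simp add: field_simps power2_eq_square)
    also have "\<sigma>\<^sup>2 * c\<^sub>h / (2 * \<mu>) * ((z - y) / \<mu>) = \<sigma>\<^sup>2 * c\<^sub>h / (2 * \<mu>\<^sup>2) * z - \<sigma>\<^sup>2 * c\<^sub>h / (2 * \<mu>\<^sup>2) * y"
      using assms by (simp add: field_simps power2_eq_square)
    finally show ?thesis by (simp add: c1_def Bdiff_def g0_def)
  qed
  then show ?thesis
    unfolding F_std_def 1 using assms \<open>z - y \<noteq> 0\<close> by simp
qed

text \<open>The delayed quotient is the mediant of \<open>a / d\<close> and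
  \<open>r * q / q\<close>. Here \<open>q\<close> is the mean time of the round trip from
  \<open>y\<close> down to 0 and back up to \<open>y\<close>, and \<open>r\<close> is the cost rate
  of the reflected process without orders: mean level \<sigma>^2/(2\<mu>) at holding price, local
  time growing at rate \<mu>. Delay pays exactly when this idling is cheaper than the standard
  policy.\<close>

lemma F_delayed_less_F_std_iff:
  assumes "\<mu> > 0" "\<sigma> > 0" "0 < y" "y < z"
  shows "F_delayed \<mu> \<sigma> c\<^sub>h k\<^sub>1 k\<^sub>2 k\<^sub>5 y z < F_std \<mu> \<sigma> c\<^sub>h k\<^sub>1 k\<^sub>2 y z
    \<longleftrightarrow> \<sigma>\<^sup>2 * c\<^sub>h / (2 * \<mu>) + k\<^sub>5 * \<mu> < F_std \<mu> \<sigma> c\<^sub>h k\<^sub>1 k\<^sub>2 y z"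
proof -
  define E where "E = exp (2 * \<mu> * y / \<sigma>\<^sup>2) - 1"
  define a where "a = c1 k\<^sub>1 k\<^sub>2 y z + Bdiff (g0 \<mu> \<sigma> c\<^sub>h) y z"
  define d where "d = Bdiff (zeta \<mu>) y z"
  define q where "q = \<sigma>\<^sup>2 / (2 * \<mu>\<^sup>2) * E"
  define r where "r = \<sigma>\<^sup>2 * c\<^sub>h / (2 * \<mu>) + k\<^sub>5 * \<mu>"
  have "E > 0" unfolding E_def using assms by simp
  then have q: "q > 0" unfolding q_def using assms by simp
  have d: "d > 0" unfolding d_def Bdiff_def zeta_def using assms by (simp add: divide_strict_right_mono)
  \<comment> \<open>Both corrections of the numerator are multiples of \<open>E\<close>; taking out
    the factor of \<open>q\<close> leaves the idling rate \<open>r\<close>.\<close>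
  have "(\<sigma>^4 * c\<^sub>h / (4 * \<mu>^3) + \<sigma>\<^sup>2 * k\<^sub>5 / (2 * \<mu>)) * E = r * q"
    unfolding r_def q_def using assms by (simp add: field_simps power2_eq_square eval_nat_numeral)
  then have Ft: "F_delayed \<mu> \<sigma> c\<^sub>h k\<^sub>1 k\<^sub>2 k\<^sub>5 y z = (a + r * q) / (d + q)"
    unfolding F_delayed_def a_def d_def q_def E_def by simp
  have F: "F_std \<mu> \<sigma> c\<^sub>h k\<^sub>1 k\<^sub>2 y z = a / d"
    unfolding F_std_def a_def d_def by simp
  have "(a + r * q) / (d + q) < a / d \<longleftrightarrow> (a + r * q) * d < a * (d + q)"
    using d q by (simp add: divide_less_eq pos_less_divide_eq field_simps)
  also have "\<dots> \<longleftrightarrow> q * (r * d) < q * a" by (simp add: algebra_simps)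
  also have "\<dots> \<longleftrightarrow> r < a / d" using d q by (simp add: pos_less_divide_eq)
  finally show ?thesis unfolding Ft F r_def .
qed

text \<open>The cost depends on the gap d = z - y and on the sum z + y, which is at least d. So y =
  0 is best, and the inequality of the arithmetic and geometric mean for
  \<open>k\<^sub>1 * \<mu> / d\<close> and \<open>c\<^sub>h * d / 2\<close> gives the minimum,
  attained where both terms agree.\<close>

lemma
  assumes "\<mu> > 0" "c\<^sub>h > 0" "k\<^sub>1 > 0"
  shows F_std_at_optimum: "F_std \<mu> \<sigma> c\<^sub>h k\<^sub>1 k\<^sub>2 0 (sqrt (2 * k\<^sub>1 * \<mu> / c\<^sub>h)) =
      sqrt (2 * k\<^sub>1 * c\<^sub>h * \<mu>) + k\<^sub>2 * \<mu> + \<sigma>\<^sup>2 * c\<^sub>h / (2 * \<mu>)"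
    and F_std_minimal: "0 \<le> y \<Longrightarrow> y < z \<Longrightarrow>
      F_std \<mu> \<sigma> c\<^sub>h k\<^sub>1 k\<^sub>2 0 (sqrt (2 * k\<^sub>1 * \<mu> / c\<^sub>h)) \<le> F_std \<mu> \<sigma> c\<^sub>h k\<^sub>1 k\<^sub>2 y z"
proof -
  define s where "s = sqrt (2 * k\<^sub>1 * \<mu> / c\<^sub>h)"
  define r where "r = sqrt (2 * k\<^sub>1 * c\<^sub>h * \<mu>)"
  have s: "s > 0" and r: "r > 0" unfolding s_def r_def using assms by simp_all
  have r2: "r\<^sup>2 = 2 * k\<^sub>1 * c\<^sub>h * \<mu>" unfolding r_def using assms by simp
  have "s\<^sup>2 = 2 * k\<^sub>1 * \<mu> / c\<^sub>h" unfolding s_def using assms by simp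
  then have "r\<^sup>2 = (c\<^sub>h * s)\<^sup>2"
    unfolding r2 power_mult_distrib using assms by (simp add: power2_eq_square)
  then have rs: "r = c\<^sub>h * s" by (rule power2_eq_imp_eq) (use r s assms in simp_all)
  have half: "k\<^sub>1 * \<mu> / s = r / 2"
    using r2 rs s assms by (simp add: field_simps power2_eq_square)
  then show 1: "F_std \<mu> \<sigma> c\<^sub>h k\<^sub>1 k\<^sub>2 0 (sqrt (2 * k\<^sub>1 * \<mu> / c\<^sub>h)) =
      sqrt (2 * k\<^sub>1 * c\<^sub>h * \<mu>) + k\<^sub>2 * \<mu> + \<sigma>\<^sup>2 * c\<^sub>h / (2 * \<mu>)"
    unfolding s_def[symmetric] r_def[symmetric] F_std_eq[OF assms(1) s] diff_zero add_0_right half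
    using rs by linarith
  show "F_std \<mu> \<sigma> c\<^sub>h k\<^sub>1 k\<^sub>2 0 (sqrt (2 * k\<^sub>1 * \<mu> / c\<^sub>h)) \<le> F_std \<mu> \<sigma> c\<^sub>h k\<^sub>1 k\<^sub>2 y z"
    if y: "0 \<le> y" "y < z"
  proof -
    define d where "d = z - y"
    have d: "d > 0" unfolding d_def using y by simp
    have "0 \<le> (c\<^sub>h * d - r)\<^sup>2" by simp
    then have "2 * c\<^sub>h * d * r \<le> (c\<^sub>h * d)\<^sup>2 + r\<^sup>2" by (simp add: power2_eq_square algebra_simps)
    then have "c\<^sub>h * (2 * d * r) \<le> c\<^sub>h * (c\<^sub>h * d\<^sup>2 + 2 * k\<^sub>1 * \<mu>)"
      unfolding r2 by (simp add: power2_eq_square algebra_simps)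
    then have "2 * d * r \<le> c\<^sub>h * d\<^sup>2 + 2 * k\<^sub>1 * \<mu>" using assms(2) by simp
    then have "r \<le> k\<^sub>1 * \<mu> / d + c\<^sub>h * d / 2"
      using d by (simp add: field_simps power2_eq_square)
    also have "c\<^sub>h * d / 2 \<le> c\<^sub>h * (z + y) / 2" unfolding d_def using y assms by simp
    finally show ?thesis
      unfolding 1 F_std_eq[OF assms(1) y(2)] r_def[symmetric] d_def by simp
  qed
qed

lemma F_delayed_zero: "F_delayed \<mu> \<sigma> c\<^sub>h k\<^sub>1 k\<^sub>2 k\<^sub>5 0 z = F_std \<mu> \<sigma> c\<^sub>h k\<^sub>1 k\<^sub>2 0 z"
  by (simp add: F_delayed_def F_std_def)

text \<open>At y = 0 the derivative of the denominator is -1/\<mu> + 1/\<mu> = 0, so only the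
  numerator counts. Its holding terms cancel as well, which leaves
  \<open>k\<^sub>5 - k\<^sub>2\<close> over \<open>z / \<mu>\<close>.\<close>

lemma F_delayed_deriv_zero:
  assumes "\<mu> > 0" "\<sigma> > 0" "z > 0"
  shows "((\<lambda>y. F_delayed \<mu> \<sigma> c\<^sub>h k\<^sub>1 k\<^sub>2 k\<^sub>5 y z) has_real_derivative (k\<^sub>5 - k\<^sub>2) * \<mu> / z) (at 0)"
  unfolding F_delayed_def c1_def Bdiff_def g0_def zeta_def
  apply (rule derivative_eq_intros refl | (use assms in simp; fail))+
  using assms by (simp add: field_simps eval_nat_numeral)


section \<open>The augmented Brownian filtration\<close>

lemma augmented_filtration_gen_subset:
  "{U s -` A \<inter> space M | s A. 0 \<le> s \<and> ereal s \<le> t \<and> A \<in> sets borel} \<union> null_sets M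
     \<subseteq> Pow (space M)"
  by (auto dest: null_setsD2 sets.sets_into_space)

lemma space_augmented_filtration [simp]: "space (augmented_filtration M U t) = space M"
  unfolding augmented_filtration_def by (rule space_measure_of[OF augmented_filtration_gen_subset])

lemma sets_augmented_filtration:
  "sets (augmented_filtration M U t) = sigma_sets (space M)
     ({U s -` A \<inter> space M | s A. 0 \<le> s \<and> ereal s \<le> t \<and> A \<in> sets borel} \<union> null_sets M)"
  unfolding augmented_filtration_def by (rule sets_measure_of[OF augmented_filtration_gen_subset])

lemma null_sets_augmented_filtration: "N \<in> null_sets M \<Longrightarrow> N \<in> sets (augmented_filtration M U t)"
  unfolding sets_augmented_filtration by (rule sigma_sets.Basic) auto

lemma adapted_augmented_filtration:
  assumes "0 \<le> s" "ereal s \<le> t"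
  shows "U s \<in> borel_measurable (augmented_filtration M U t)"
proof (rule measurableI)
  fix A :: "real set" assume "A \<in> sets borel"
  then show "U s -` A \<inter> space (augmented_filtration M U t) \<in> sets (augmented_filtration M U t)"
    unfolding sets_augmented_filtration space_augmented_filtration
    using assms by (intro sigma_sets.Basic) blast
qed auto

lemma sets_augmented_filtration_mono:
  "s \<le> t \<Longrightarrow> sets (augmented_filtration M U s) \<subseteq> sets (augmented_filtration M U t)"
  using filtration.sets_F_mono[OF filtration_augmented] by blast

lemma measurable_augmented_filtration_mono:
  "f \<in> measurable (augmented_filtration M U s) N \<Longrightarrow> s \<le> t \<Longrightarrow>
    f \<in> measurable (augmented_filtration M U t) N"
  using sets_augmented_filtration_mono[of s t M U] by (auto simp: measurable_def)

text \<open>Serves two comparisons: the filtration of \<open>W\<close> with \<open>M\<close>, and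
  the filtration of the uncontrolled inventory with that of \<open>W\<close>.\<close>

lemma sets_augmented_filtration_least:
  assumes "\<And>s. 0 \<le> s \<Longrightarrow> ereal s \<le> t \<Longrightarrow> U s \<in> borel_measurable F"
    and "space F = space M" "null_sets M \<subseteq> sets F"
  shows "sets (augmented_filtration M U t) \<subseteq> sets F"
proof -
  have "{U s -` A \<inter> space M | s A. 0 \<le> s \<and> ereal s \<le> t \<and> A \<in> sets borel} \<subseteq> sets F"
    using measurable_sets[OF assms(1)] assms(2) by auto
  then show ?thesis
    unfolding sets_augmented_filtration assms(2)[symmetric]
    using assms(3) by (intro sets.sigma_sets_subset) simp
qed

text \<open>The null sets lie in the filtration at every time, so an exceptional set may be
  repaired. This makes processes adapted whose formulas hold only almost surely.\<close>

lemma measurable_augmented_filtration_AE_cong: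
  assumes f: "f \<in> measurable M N" and g: "g \<in> measurable (augmented_filtration M U t) N"
    and sub: "sets (augmented_filtration M U t) \<subseteq> sets M"
    and eq: "AE x in M. f x = g x"
  shows "f \<in> measurable (augmented_filtration M U t) N"
proof (rule measurableI)
  let ?F = "augmented_filtration M U t"
  obtain Z where Z: "Z \<in> null_sets M" "{x \<in> space M. f x \<noteq> g x} \<subseteq> Z"
    using eq by (auto simp: eventually_ae_filter)
  fix A assume A: "A \<in> sets N"
  have "f -` A \<inter> space M \<inter> Z \<in> null_sets M"
    using Z(1) measurable_sets[OF f A] by (intro null_set_Int1)
  moreover have "f -` A \<inter> space M = (g -` A \<inter> space M - Z) \<union> (f -` A \<inter> space M \<inter> Z)"
    using Z(2) by auto
  moreover have "g -` A \<inter> space M - Z \<in> sets ?F"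
    using measurable_sets[OF g A] null_sets_augmented_filtration[OF Z(1)] by auto
  ultimately show "f -` A \<inter> space ?F \<in> sets ?F"
    by (metis null_sets_augmented_filtration sets.Un space_augmented_filtration)
qed (use f in \<open>auto dest: measurable_space\<close>)

section \<open>Brownian motion: independence of increments from the past, Gaussian and exponential
  moments\<close>

locale brownian =
  fixes M :: "'a measure" and W :: "real \<Rightarrow> 'a \<Rightarrow> real"
  assumes brownian: "brownian_motion M W"
begin

sublocale prob_space M
  using brownian unfolding brownian_motion_def by simp

lemma W_measurable [measurable]: "0 \<le> t \<Longrightarrow> W t \<in> borel_measurable M"
  using brownian unfolding brownian_motion_def by simp

lemma AE_W: "AE \<omega> in M. W 0 \<omega> = 0 \<and> continuous_on {0..} (\<lambda>t. W t \<omega>)"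
  using brownian unfolding brownian_motion_def by simp

lemma distributed_increment:
  "0 \<le> s \<Longrightarrow> s < t \<Longrightarrow>
    distributed M lborel (\<lambda>\<omega>. W t \<omega> - W s \<omega>) (normal_density 0 (sqrt (t - s)))"
  using brownian unfolding brownian_motion_def by simp

lemma indep_increments:
  fixes t :: "nat \<Rightarrow> real"
  shows "0 \<le> t 0 \<Longrightarrow> strict_mono t \<Longrightarrow>
    indep_vars (\<lambda>_. borel) (\<lambda>i \<omega>. W (t (Suc i)) \<omega> - W (t i) \<omega>) {..<n}"
  using brownian unfolding brownian_motion_def by simp

abbreviation Fil :: "real \<Rightarrow> 'a measure" where
  "Fil u \<equiv> augmented_filtration M W (ereal u)"

lemma sets_Fil: "sets (augmented_filtration M W t) \<subseteq> sets M"
proof (rule sets_augmented_filtration_least)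
  show "null_sets M \<subseteq> sets M" by auto
qed auto

lemma Fil_measurable: "f \<in> measurable (augmented_filtration M W t) N \<Longrightarrow> f \<in> measurable M N"
  using sets_Fil[of t] by (auto simp: measurable_def)

lemma Fil_mono: "f \<in> measurable (Fil s) N \<Longrightarrow> s \<le> t \<Longrightarrow> f \<in> measurable (Fil t) N"
  by (rule measurable_augmented_filtration_mono) auto

lemma W_Fil: "0 \<le> s \<Longrightarrow> s \<le> t \<Longrightarrow> W s \<in> borel_measurable (Fil t)"
  by (rule adapted_augmented_filtration) auto

lemma Fil_AE_cong:
  "f \<in> measurable M N \<Longrightarrow> g \<in> measurable (Fil t) N \<Longrightarrow> AE x in M. f x = g x \<Longrightarrow>
    f \<in> measurable (Fil t) N"
  using measurable_augmented_filtration_AE_cong sets_Fil by blast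

text \<open>Values of \<open>W\<close> at finitely many times up to \<open>u\<close> are partial
  sums of increments along the sorted times, hence independent of the next increment. The event
  \<open>C\<close> is given only up to a null set because \<open>W 0 = 0\<close> holds only almost
  surely, and so that null sets themselves are covered.\<close>

lemma prob_cylinder_increment:
  assumes J: "finite J" "J \<subseteq> {0..u}" "\<And>j. j \<in> J \<Longrightarrow> B j \<in> sets borel" and uv: "0 \<le> u" "u < v"
    and C: "C \<in> sets M" "AE \<omega> in M. \<omega> \<in> C \<longleftrightarrow> (\<forall>j\<in>J. W j \<omega> \<in> B j)" and E: "E \<in> sets borel"
  defines "S \<equiv> (\<lambda>\<omega>. W v \<omega> - W u \<omega>) -` E \<inter> space M"
  shows "prob (C \<inter> S) = prob C * prob S"
proof -
  define K where "K = insert 0 (insert u J)"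
  define xs where "xs = sorted_list_of_set K"
  define n where "n = length xs"
  \<comment> \<open>Independence of increments is available for strictly increasing sequences on all
    naturals, so the sorted list is continued by v, v + 1, and so on. Increment number
    \<open>n - 1\<close> is then \<open>W v - W u\<close>.\<close>
  define t where "t i = (if i < n then xs ! i else v + real (i - n))" for i
  have fin: "finite K" and K0: "K \<subseteq> {0..u}" "0 \<in> K" "u \<in> K"
    using J uv by (auto simp: K_def)
  have set_xs: "set xs = K" and sorted: "sorted_wrt (<) xs"
    unfolding xs_def using fin by (auto simp: strict_sorted_iff)
  have n: "n \<ge> 1" unfolding n_def using K0 set_xs by (cases xs) auto
  have xs_mono: "xs ! i < xs ! j" if "i < j" "j < n" for i j
    using sorted_wrt_nth_less[OF sorted] that n_def by auto
  have xs_K: "xs ! i \<in> K" if "i < n" for i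
    using that set_xs n_def nth_mem by blast
  have ex: "\<exists>i<n. xs ! i = j" if "j \<in> K" for j
    using that set_xs n_def by (metis in_set_conv_nth)
  have "t 0 = 0"
  proof -
    obtain i where i: "i < n" "xs ! i = 0" using ex K0 by blast
    have "i = 0"
    proof (rule ccontr)
      assume "i \<noteq> 0"
      then have "xs ! 0 < 0" using xs_mono[of 0 i] i by simp
      moreover have "xs ! 0 \<in> K" using xs_K n by auto
      ultimately show False using K0 by auto
    qed
    then show ?thesis using i n by (simp add: t_def)
  qed
  have tlast: "t (n - 1) = u"
  proof -
    obtain i where i: "i < n" "xs ! i = u" using ex K0 by blast
    have "i = n - 1"
    proof (rule ccontr)
      assume "i \<noteq> n - 1"
      then have "u < xs ! (n - 1)" using xs_mono[of i "n - 1"] i by simp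
      moreover have "xs ! (n - 1) \<in> K" using xs_K n by auto
      ultimately show False using K0 by auto
    qed
    then show ?thesis using i by (simp add: t_def)
  qed
  have "t i < t (Suc i)" for i
  proof -
    consider "Suc i < n" | "Suc i = n" | "n \<le> i" by linarith
    then show ?thesis
    proof cases
      case 2
      then have "t i = u" using tlast by auto
      then show ?thesis using 2 uv by (simp add: t_def)
    qed (auto simp: t_def xs_mono)
  qed
  then have mono: "strict_mono t" by (rule strict_mono_Suc_iff[THEN iffD2, rule_format])
  define X where "X i \<omega> = W (t (Suc i)) \<omega> - W (t i) \<omega>" for i \<omega>
  have ind: "indep_vars (\<lambda>_. borel) X {..<n}"
    unfolding X_def using indep_increments[OF _ mono] \<open>t 0 = 0\<close> by simp
  define idx where "idx j = (SOME i. i < n \<and> xs ! i = j)" for j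
  have idx: "idx j < n" "xs ! (idx j) = j" if "j \<in> J" for j
    using someI_ex[of "\<lambda>i. i < n \<and> xs ! i = j"] ex[of j] that unfolding idx_def K_def by auto
  have WX: "AE \<omega> in M. \<forall>j\<in>J. W j \<omega> = (\<Sum>i<idx j. X i \<omega>)"
    using AE_W
  proof eventually_elim
    case (elim \<omega>)
    show ?case
    proof
      fix j assume j: "j \<in> J"
      have "(\<Sum>i<idx j. X i \<omega>) = W (t (idx j)) \<omega> - W (t 0) \<omega>"
        unfolding X_def by (rule sum_lessThan_telescope)
      then show "W j \<omega> = (\<Sum>i<idx j. X i \<omega>)"
        using idx[OF j] elim \<open>t 0 = 0\<close> by (simp add: t_def)
    qed
  qed
  let ?A = "{..<n - 1}" and ?B = "{n - 1}"
  let ?PA = "PiM ?A (\<lambda>_. borel :: real measure)" and ?PB = "PiM ?B (\<lambda>_. borel :: real measure)"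
  let ?RA = "\<lambda>\<omega>. restrict (\<lambda>i. X i \<omega>) ?A" and ?RB = "\<lambda>\<omega>. restrict (\<lambda>i. X i \<omega>) ?B"
  have iv: "indep_var ?PA ?RA ?PB ?RB"
    using ind by (rule indep_var_restrict) (use n in auto)
  define CA where "CA = {g \<in> space ?PA. \<forall>j\<in>J. (\<Sum>i<idx j. g i) \<in> B j}"
  define CB where "CB = {g \<in> space ?PB. g (n - 1) \<in> E}"
  have sumA: "(\<lambda>g. \<Sum>i<idx j. g i) \<in> borel_measurable ?PA" if "j \<in> J" for j
    using idx[OF that] by (intro borel_measurable_sum measurable_component_singleton) auto
  have "{g \<in> space ?PA. (\<Sum>i<idx j. g i) \<in> B j} \<in> sets ?PA" if "j \<in> J" for j
    using measurable_sets[OF sumA[OF that] J(3)[OF that]] by (simp add: vimage_def Int_def conj_commute)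
  then have CA: "CA \<in> sets ?PA"
    unfolding CA_def using J(1) by (intro sets.sets_Collect_finite_All) auto
  have "(\<lambda>g. g (n - 1)) \<in> borel_measurable ?PB" by (rule measurable_component_singleton) simp
  from measurable_sets[OF this E] have CB: "CB \<in> sets ?PB"
    unfolding CB_def by (simp add: vimage_def Int_def conj_commute)
  have X_last: "X (n - 1) \<omega> = W v \<omega> - W u \<omega>" for \<omega>
    unfolding X_def using n tlast by (simp add: t_def)
  have SB: "?RB -` CB \<inter> space M = S"
    unfolding CB_def S_def using X_last by (auto simp: space_PiM)
  have eqA: "\<omega> \<in> ?RA -` CA \<inter> space M \<longleftrightarrow> \<omega> \<in> space M \<and> (\<forall>j\<in>J. (\<Sum>i<idx j. X i \<omega>) \<in> B j)" for \<omega>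
  proof -
    have "(\<Sum>i<idx j. restrict (\<lambda>i. X i \<omega>) ?A i) = (\<Sum>i<idx j. X i \<omega>)" if "j \<in> J" for j
      using idx(1)[OF that] by (intro sum.cong) auto
    then show ?thesis unfolding CA_def by (auto simp: space_PiM)
  qed
  have ae: "AE \<omega> in M. \<omega> \<in> C \<longleftrightarrow> \<omega> \<in> ?RA -` CA \<inter> space M"
    using WX C(2) AE_space by eventually_elim (unfold eqA, auto)
  have RA: "?RA \<in> measurable M ?PA" and RB: "?RB \<in> measurable M ?PB"
    using indep_var_rv1[OF iv] indep_var_rv2[OF iv] by auto
  have SM: "S \<in> sets M" using measurable_sets[OF RB CB] SB by simp
  have "prob (C \<inter> S) = prob ((?RA -` CA \<inter> space M) \<inter> S)"
    using ae measurable_sets[OF RA CA] SM C(1) by (intro finite_measure_eq_AE) (auto elim!: eventually_mono)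
  also have "(?RA -` CA \<inter> space M) \<inter> S = (\<lambda>x. (?RA x, ?RB x)) -` (CA \<times> CB) \<inter> space M"
    unfolding SB[symmetric] by auto
  also have "prob \<dots> = prob (?RA -` CA \<inter> space M) * prob (?RB -` CB \<inter> space M)"
    by (rule indep_varD[OF iv CA CB])
  also have "prob (?RA -` CA \<inter> space M) = prob C"
    using ae measurable_sets[OF RA CA] C(1) by (intro finite_measure_eq_AE) (auto elim!: eventually_mono)
  finally show ?thesis unfolding SB .
qed

text \<open>Two intersection-stable systems: events almost surely equal to a cylinder over [0,u],
  and events of the increment. The first generates at least \<open>Fil u\<close>, null sets
  included.\<close>

lemma indep_var_increment:
  assumes \<xi>: "\<xi> \<in> measurable (Fil u) N" and uv: "0 \<le> u" "u < v"
  shows "indep_var N \<xi> borel (\<lambda>\<omega>. W v \<omega> - W u \<omega>)"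
proof -
  let ?D = "\<lambda>\<omega>. W v \<omega> - W u \<omega>"
  define A where "A = {C \<in> sets M. \<exists>J B. finite J \<and> J \<subseteq> {0..u} \<and> (\<forall>j\<in>J. B j \<in> sets borel) \<and>
     (AE \<omega> in M. \<omega> \<in> C \<longleftrightarrow> (\<forall>j\<in>J. W j \<omega> \<in> B j))}"
  define G where "G = {?D -` E \<inter> space M | E. E \<in> sets borel}"
  have Dm: "?D \<in> borel_measurable M" using uv by simp
  have G: "G \<subseteq> events" unfolding G_def using measurable_sets[OF Dm] by auto
  have "indep_set A G"
  proof (rule indep_setI)
    show "A \<subseteq> events" unfolding A_def by auto
    show "G \<subseteq> events" by (rule G)
    fix a b assume "a \<in> A" "b \<in> G"
    then show "prob (a \<inter> b) = prob a * prob b"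
      unfolding A_def G_def using prob_cylinder_increment[OF _ _ _ uv] by blast
  qed
  moreover have "Int_stable A"
  proof (rule Int_stableI)
    fix a b assume "a \<in> A" "b \<in> A"
    then obtain J B J' B' where *: "finite J" "J \<subseteq> {0..u}" "\<forall>j\<in>J. B j \<in> sets borel"
        "AE \<omega> in M. \<omega> \<in> a \<longleftrightarrow> (\<forall>j\<in>J. W j \<omega> \<in> B j)"
      "finite J'" "J' \<subseteq> {0..u}" "\<forall>j\<in>J'. B' j \<in> sets borel"
        "AE \<omega> in M. \<omega> \<in> b \<longleftrightarrow> (\<forall>j\<in>J'. W j \<omega> \<in> B' j)" and ab: "a \<in> sets M" "b \<in> sets M"
      unfolding A_def by blast
    define B'' where "B'' j = (if j \<in> J then B j else UNIV) \<inter> (if j \<in> J' then B' j else UNIV)" for j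
    have "AE \<omega> in M. \<omega> \<in> a \<inter> b \<longleftrightarrow> (\<forall>j\<in>J\<union>J'. W j \<omega> \<in> B'' j)"
      using *(4,8) by eventually_elim (auto simp: B''_def split: if_splits)
    moreover have "\<forall>j\<in>J\<union>J'. B'' j \<in> sets borel" using *(3,7) by (auto simp: B''_def)
    moreover have "finite (J \<union> J')" "J \<union> J' \<subseteq> {0..u}" using * by auto
    ultimately show "a \<inter> b \<in> A" unfolding A_def using ab by blast
  qed
  moreover have "Int_stable G"
  proof (rule Int_stableI)
    fix a b assume "a \<in> G" "b \<in> G"
    then obtain E E' where "a = ?D -` E \<inter> space M" "b = ?D -` E' \<inter> space M" "E \<in> sets borel" "E' \<in> sets borel"
      unfolding G_def by auto
    then show "a \<inter> b \<in> G" unfolding G_def by (intro CollectI exI[of _ "E \<inter> E'"]) auto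
  qed
  ultimately have ind: "indep_set (sigma_sets (space M) A) (sigma_sets (space M) G)"
    by (rule indep_set_sigma_sets)
  have "{W s -` B \<inter> space M | s B. 0 \<le> s \<and> ereal s \<le> ereal u \<and> B \<in> sets borel} \<subseteq> A"
  proof safe
    fix s and B :: "real set" assume s: "0 \<le> s" "ereal s \<le> ereal u" and B: "B \<in> sets borel"
    have "AE \<omega> in M. \<omega> \<in> W s -` B \<inter> space M \<longleftrightarrow> (\<forall>j\<in>{s}. W j \<omega> \<in> B)"
      using AE_space by eventually_elim auto
    moreover have "W s -` B \<inter> space M \<in> sets M" using measurable_sets[OF W_measurable[OF s(1)] B] .
    ultimately show "W s -` B \<inter> space M \<in> A"
      unfolding A_def using s B by (intro CollectI conjI exI[of _ "{s}"] exI[of _ "\<lambda>_. B"]) auto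
  qed
  moreover have "null_sets M \<subseteq> A"
  proof
    fix Z assume Z: "Z \<in> null_sets M"
    \<comment> \<open>A null set is almost surely the cylinder that asks the impossible at time
      0.\<close>
    have "AE \<omega> in M. \<omega> \<in> Z \<longleftrightarrow> (\<forall>j\<in>{0}. W j \<omega> \<in> {})"
      using AE_not_in[OF Z] by eventually_elim auto
    then show "Z \<in> A"
      unfolding A_def using Z uv by (intro CollectI conjI exI[of _ "{0}"] exI[of _ "\<lambda>_. {}"]) auto
  qed
  ultimately have Fil_A: "sets (Fil u) \<subseteq> sigma_sets (space M) A"
    unfolding sets_augmented_filtration by (intro sigma_sets_mono') auto
  show ?thesis
    unfolding indep_var_eq
  proof (intro conjI indep_setI)
    show "random_variable N \<xi>" using Fil_measurable[OF \<xi>] .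
    show "random_variable borel ?D" by (rule Dm)
    have sub: "sigma_sets (space M) {\<xi> -` B \<inter> space M | B. B \<in> sets N} \<subseteq> sets (Fil u)"
    proof -
      have "{\<xi> -` B \<inter> space M | B. B \<in> sets N} \<subseteq> sets (Fil u)"
        using measurable_sets[OF \<xi>] by auto
      then have "sigma_sets (space (Fil u)) {\<xi> -` B \<inter> space M | B. B \<in> sets N} \<subseteq> sets (Fil u)"
        by (rule sets.sigma_sets_subset)
      then show ?thesis by simp
    qed
    show "sigma_sets (space M) {\<xi> -` B \<inter> space M | B. B \<in> sets N} \<subseteq> events"
      using sub sets_Fil by blast
    show "sigma_sets (space M) {?D -` B \<inter> space M | B. B \<in> sets borel} \<subseteq> events"
      using G unfolding G_def by (rule sets.sigma_sets_subset)
    fix a b assume "a \<in> sigma_sets (space M) {\<xi> -` B \<inter> space M | B. B \<in> sets N}"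
      and b: "b \<in> sigma_sets (space M) {?D -` B \<inter> space M | B. B \<in> sets borel}"
    then have "a \<in> sigma_sets (space M) A" using sub Fil_A by blast
    then show "prob (a \<inter> b) = prob a * prob b"
      using indep_setD[OF ind] b unfolding G_def by blast
  qed
qed

lemma
  assumes "0 \<le> s" "s < t"
  shows integrable_increment_sq: "integrable M (\<lambda>\<omega>. (W t \<omega> - W s \<omega>)\<^sup>2)"
    and expectation_increment: "expectation (\<lambda>\<omega>. W t \<omega> - W s \<omega>) = 0"
    and expectation_increment_sq: "expectation (\<lambda>\<omega>. (W t \<omega> - W s \<omega>)\<^sup>2) = t - s"
    and integrable_exp_increment: "integrable M (\<lambda>\<omega>. exp (a * (W t \<omega> - W s \<omega>)))"
    and expectation_exp_increment: "expectation (\<lambda>\<omega>. exp (a * (W t \<omega> - W s \<omega>))) = exp (a\<^sup>2 * (t - s) / 2)"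
proof -
  let ?X = "\<lambda>\<omega>. W t \<omega> - W s \<omega>"
  define r where "r = sqrt (t - s)"
  have r: "r > 0" "r\<^sup>2 = t - s" using assms by (auto simp: r_def)
  note D = distributed_increment[OF assms, folded r_def]
  have nn: "0 \<le> normal_density 0 r x" for x by simp
  show "integrable M (\<lambda>\<omega>. (?X \<omega>)\<^sup>2)"
    using integrable_normal_moment[OF r(1), of 0 2] distributed_integrable[OF D, of "\<lambda>x. x\<^sup>2"] nn by simp
  show "expectation ?X = 0"
    using integral_normal_moment_nz_1[OF r(1), of 0] distributed_integral[OF D, of "\<lambda>x. x"] nn by simp
  show "expectation (\<lambda>\<omega>. (?X \<omega>)\<^sup>2) = t - s"
    using integral_normal_moment_even[OF r(1), of 0 1] distributed_integral[OF D, of "\<lambda>x. x\<^sup>2"] nn r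
    by (simp add: eval_nat_numeral)
  \<comment> \<open>Completing the square: the exponential weight only moves the mean of the
    Gaussian density to \<open>a * r\<^sup>2\<close>.\<close>
  have eq: "normal_density 0 r x * exp (a * x) = exp (a\<^sup>2 * (t - s) / 2) * normal_density (a * r\<^sup>2) r x" for x
  proof -
    have "- x\<^sup>2 / (2 * r\<^sup>2) + a * x = a\<^sup>2 * r\<^sup>2 / 2 + - (x - a * r\<^sup>2)\<^sup>2 / (2 * r\<^sup>2)"
      using r(1) by (simp add: field_simps power2_eq_square)
    then have "exp (- x\<^sup>2 / (2 * r\<^sup>2)) * exp (a * x) = exp (a\<^sup>2 * r\<^sup>2 / 2) * exp (- (x - a * r\<^sup>2)\<^sup>2 / (2 * r\<^sup>2))"
      by (simp only: exp_add[symmetric])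
    then show ?thesis unfolding normal_density_def r(2)[symmetric] by simp
  qed
  have "integrable lborel (\<lambda>x. normal_density 0 r x * exp (a * x))"
    unfolding eq using r(1) by simp
  then show "integrable M (\<lambda>\<omega>. exp (a * ?X \<omega>))"
    using distributed_integrable[OF D, of "\<lambda>x. exp (a * x)"] nn by simp
  have "(\<integral>x. normal_density 0 r x * exp (a * x) \<partial>lborel) = exp (a\<^sup>2 * (t - s) / 2)"
    unfolding eq using r(1) by simp
  then show "expectation (\<lambda>\<omega>. exp (a * ?X \<omega>)) = exp (a\<^sup>2 * (t - s) / 2)"
    using distributed_integral[OF D, of "\<lambda>x. exp (a * x)"] nn by simp
qed

end


section \<open>Martingale transforms along a grid\<close>

context prob_space
begin

lemma integrable_mult_square_integrable:
  fixes f g :: "'a \<Rightarrow> real"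
  assumes [measurable]: "f \<in> borel_measurable M" "g \<in> borel_measurable M"
    and "integrable M (\<lambda>x. (f x)\<^sup>2)" "integrable M (\<lambda>x. (g x)\<^sup>2)"
  shows "integrable M (\<lambda>x. f x * g x)"
proof (rule Bochner_Integration.integrable_bound)
  show "integrable M (\<lambda>x. (f x)\<^sup>2 + (g x)\<^sup>2)" using assms by simp
  have "\<bar>a * b\<bar> \<le> \<bar>a\<^sup>2 + b\<^sup>2\<bar>" for a b :: real
  proof -
    have "0 \<le> (\<bar>a\<bar> - \<bar>b\<bar>)\<^sup>2" by simp
    then have "2 * (\<bar>a\<bar> * \<bar>b\<bar>) \<le> a\<^sup>2 + b\<^sup>2" by (simp add: power2_eq_square algebra_simps)
    then show ?thesis by (simp add: abs_mult) (smt (verit) abs_ge_zero mult_nonneg_nonneg)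
  qed
  then show "AE x in M. norm (f x * g x) \<le> norm ((f x)\<^sup>2 + (g x)\<^sup>2)" by simp
qed simp

lemma integrable_of_square:
  fixes f :: "'a \<Rightarrow> real"
  assumes "f \<in> borel_measurable M" "integrable M (\<lambda>x. (f x)\<^sup>2)"
  shows "integrable M f"
  using integrable_mult_square_integrable[of f "\<lambda>_. 1"] assms by simp

text \<open>Boundedness in mean square gives uniform integrability, so that the zero mean survives the limit.\<close>

lemma limit_of_centered:
  fixes S :: "nat \<Rightarrow> 'a \<Rightarrow> real"
  assumes [measurable]: "\<And>n. S n \<in> borel_measurable M" "Z \<in> borel_measurable M"
    and S2: "\<And>n. integrable M (\<lambda>\<omega>. (S n \<omega>)\<^sup>2)" "\<And>n. expectation (\<lambda>\<omega>. (S n \<omega>)\<^sup>2) \<le> K"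
    and S0: "\<And>n. expectation (S n) = 0"
    and lim: "AE \<omega> in M. (\<lambda>n. S n \<omega>) \<longlonglongrightarrow> Z \<omega>"
  shows "integrable M Z" "expectation Z = 0"
proof -
  have K: "0 \<le> K"
    using S2(2)[of 0] by (rule order_trans[rotated]) (simp add: Bochner_Integration.integral_nonneg)
  \<comment> \<open>Fatou: the limit inherits the bound \<open>K\<close> on the second
    moment.\<close>
  have "(\<integral>\<^sup>+\<omega>. ennreal ((Z \<omega>)\<^sup>2) \<partial>M) = (\<integral>\<^sup>+\<omega>. liminf (\<lambda>n. ennreal ((S n \<omega>)\<^sup>2)) \<partial>M)"
  proof (rule nn_integral_cong_AE)
    show "AE \<omega> in M. ennreal ((Z \<omega>)\<^sup>2) = liminf (\<lambda>n. ennreal ((S n \<omega>)\<^sup>2))"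
      using lim
    proof eventually_elim
      case (elim \<omega>)
      then have "(\<lambda>n. ennreal ((S n \<omega>)\<^sup>2)) \<longlonglongrightarrow> ennreal ((Z \<omega>)\<^sup>2)"
        by (intro tendsto_intros)
      then show ?case using lim_imp_Liminf[OF sequentially_bot] by metis
    qed
  qed
  also have "\<dots> \<le> liminf (\<lambda>n. \<integral>\<^sup>+\<omega>. ennreal ((S n \<omega>)\<^sup>2) \<partial>M)"
    by (rule nn_integral_liminf) simp
  also have "\<dots> \<le> ennreal K"
  proof -
    have "(\<integral>\<^sup>+\<omega>. ennreal ((S n \<omega>)\<^sup>2) \<partial>M) \<le> ennreal K" for n
      using S2[of n] by (subst nn_integral_eq_integral) (auto intro: ennreal_leI)
    then show ?thesis by (intro Liminf_le) auto
  qed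
  finally have Z2: "(\<integral>\<^sup>+\<omega>. ennreal ((Z \<omega>)\<^sup>2) \<partial>M) \<le> ennreal K" .
  then have iZ2: "integrable M (\<lambda>\<omega>. (Z \<omega>)\<^sup>2)"
    by (intro integrableI_bounded) (auto simp: ennreal_less_top intro: le_less_trans)
  have EZ2: "expectation (\<lambda>\<omega>. (Z \<omega>)\<^sup>2) \<le> K"
    using Z2 iZ2 K by (subst (asm) nn_integral_eq_integral) auto
  show iZ: "integrable M Z" by (rule integrable_of_square[OF _ iZ2]) simp
  have iS: "integrable M (S n)" for n by (rule integrable_of_square[OF _ S2(1)]) simp
  \<comment> \<open>Clipping at level \<open>R\<close> alters a value \<open>a\<close> by at most
    \<open>a\<^sup>2 / R\<close>, so all means move by at most \<open>K / R\<close>. For the clipped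
    variables dominated convergence applies.\<close>
  have trunc: "\<bar>expectation Y - expectation (\<lambda>\<omega>. max (- R) (min R (Y \<omega>)))\<bar> \<le> K / R"
    if "R > 0" and [measurable]: "Y \<in> borel_measurable M"
      and Y: "integrable M (\<lambda>\<omega>. (Y \<omega>)\<^sup>2)" "expectation (\<lambda>\<omega>. (Y \<omega>)\<^sup>2) \<le> K"
    for Y :: "'a \<Rightarrow> real" and R
  proof -
    have iY: "integrable M Y" by (rule integrable_of_square[OF _ Y(1)]) simp
    have iT: "integrable M (\<lambda>\<omega>. max (- R) (min R (Y \<omega>)))"
      using \<open>R > 0\<close> by (intro integrable_const_bound[of _ R]) auto
    have "\<bar>expectation Y - expectation (\<lambda>\<omega>. max (- R) (min R (Y \<omega>)))\<bar>
      = \<bar>expectation (\<lambda>\<omega>. Y \<omega> - max (- R) (min R (Y \<omega>)))\<bar>" using iY iT by simp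
    also have "\<dots> \<le> expectation (\<lambda>\<omega>. \<bar>Y \<omega> - max (- R) (min R (Y \<omega>))\<bar>)"
      by (rule integral_abs_bound)
    also have "\<dots> \<le> expectation (\<lambda>\<omega>. (Y \<omega>)\<^sup>2 / R)"
    proof (rule integral_mono)
      fix \<omega>
      have "\<bar>a - max (- R) (min R a)\<bar> * R \<le> a\<^sup>2" for a
      proof (cases "\<bar>a\<bar> \<le> R")
        case False
        then have "\<bar>a - max (- R) (min R a)\<bar> \<le> \<bar>a\<bar>" "R \<le> \<bar>a\<bar>" using \<open>R > 0\<close> by auto
        then have "\<bar>a - max (- R) (min R a)\<bar> * R \<le> \<bar>a\<bar> * \<bar>a\<bar>" using \<open>R > 0\<close> by (intro mult_mono) auto
        then show ?thesis by (simp add: power2_eq_square)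
      qed auto
      then show "\<bar>Y \<omega> - max (- R) (min R (Y \<omega>))\<bar> \<le> (Y \<omega>)\<^sup>2 / R"
        using \<open>R > 0\<close> by (simp add: pos_le_divide_eq)
    qed (use iY iT Y in auto)
    also have "\<dots> \<le> K / R" using Y(2) \<open>R > 0\<close> by (simp add: divide_right_mono)
    finally show ?thesis .
  qed
  have "\<bar>expectation Z\<bar> \<le> 2 * K / R" if R: "R > 0" for R
  proof -
    let ?T = "\<lambda>Y \<omega>. max (- R) (min R (Y \<omega>))"
    have "(\<lambda>n. expectation (?T (S n))) \<longlonglongrightarrow> expectation (?T Z)"
    proof (rule integral_dominated_convergence[where w = "\<lambda>_. R"])
      show "AE \<omega> in M. (\<lambda>n. ?T (S n) \<omega>) \<longlonglongrightarrow> ?T Z \<omega>"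
        using lim by eventually_elim (intro tendsto_intros)
      show "AE \<omega> in M. norm (?T (S n) \<omega>) \<le> R" for n using R by auto
    qed auto
    moreover have "\<bar>expectation (?T (S n))\<bar> \<le> K / R" for n
      using trunc[OF R _ S2(1,2)[of n]] S0[of n] by simp
    ultimately have "\<bar>expectation (?T Z)\<bar> \<le> K / R"
      by (intro LIMSEQ_le_const2[OF tendsto_rabs]) auto
    then show ?thesis using trunc[OF R _ iZ2 EZ2] by simp
  qed
  then have *: "\<bar>expectation Z\<bar> * R \<le> 2 * K" if "R > 0" for R
    using that by (simp add: pos_le_divide_eq)
  show "expectation Z = 0"
  proof (rule ccontr)
    assume "expectation Z \<noteq> 0"
    then have p: "\<bar>expectation Z\<bar> > 0" by simp
    \<comment> \<open>This choice of \<open>R\<close> turns the inequality into 2K + 1 \<le>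
      2K.\<close>
    have "\<bar>expectation Z\<bar> * ((2 * K + 1) / \<bar>expectation Z\<bar>) \<le> 2 * K"
      using p K by (intro *) simp
    then show False using p by simp
  qed
qed

end

context brownian
begin

text \<open>Induction on the number of cells. The partial sum and the next coefficient belong to the
  past and are independent of the next increment, which has mean zero; so the cross term vanishes
  and the variances add up.\<close>

lemma martingale_transform:
  fixes t :: "nat \<Rightarrow> real" and \<xi> :: "nat \<Rightarrow> 'a \<Rightarrow> real" and g :: "nat \<Rightarrow> real \<Rightarrow> real"
  defines "D \<equiv> \<lambda>i \<omega>. g i (W (t (Suc i)) \<omega> - W (t i) \<omega>)"
  assumes t: "0 \<le> t 0" "\<And>i. i < n \<Longrightarrow> t i < t (Suc i)"
    and \<xi>: "\<And>i. i < n \<Longrightarrow> \<xi> i \<in> borel_measurable (Fil (t i))"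
      "\<And>i. i < n \<Longrightarrow> integrable M (\<lambda>\<omega>. (\<xi> i \<omega>)\<^sup>2)"
    and g: "\<And>i. g i \<in> borel_measurable borel"
      "\<And>i. i < n \<Longrightarrow> integrable M (\<lambda>\<omega>. (D i \<omega>)\<^sup>2)" "\<And>i. i < n \<Longrightarrow> expectation (D i) = 0"
  shows "(\<lambda>\<omega>. \<Sum>i<n. \<xi> i \<omega> * D i \<omega>) \<in> borel_measurable (Fil (t n))"
    "integrable M (\<lambda>\<omega>. (\<Sum>i<n. \<xi> i \<omega> * D i \<omega>)\<^sup>2)"
    "expectation (\<lambda>\<omega>. \<Sum>i<n. \<xi> i \<omega> * D i \<omega>) = 0"
    "expectation (\<lambda>\<omega>. (\<Sum>i<n. \<xi> i \<omega> * D i \<omega>)\<^sup>2) =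
       (\<Sum>i<n. expectation (\<lambda>\<omega>. (\<xi> i \<omega>)\<^sup>2) * expectation (\<lambda>\<omega>. (D i \<omega>)\<^sup>2))"
proof -
  let ?C = "\<lambda>n. (\<lambda>\<omega>. \<Sum>i<n. \<xi> i \<omega> * D i \<omega>) \<in> borel_measurable (Fil (t n)) \<and>
    integrable M (\<lambda>\<omega>. (\<Sum>i<n. \<xi> i \<omega> * D i \<omega>)\<^sup>2) \<and>
    expectation (\<lambda>\<omega>. \<Sum>i<n. \<xi> i \<omega> * D i \<omega>) = 0 \<and>
    expectation (\<lambda>\<omega>. (\<Sum>i<n. \<xi> i \<omega> * D i \<omega>)\<^sup>2) =
       (\<Sum>i<n. expectation (\<lambda>\<omega>. (\<xi> i \<omega>)\<^sup>2) * expectation (\<lambda>\<omega>. (D i \<omega>)\<^sup>2))"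
  have "?C m" if "m \<le> n" for m
    using that
  proof (induction m)
    case (Suc m)
    let ?S = "\<lambda>\<omega>. \<Sum>i<m. \<xi> i \<omega> * D i \<omega>"
    have mn: "m < n" using Suc.prems by simp
    have IH: "?S \<in> borel_measurable (Fil (t m))" "integrable M (\<lambda>\<omega>. (?S \<omega>)\<^sup>2)" "expectation ?S = 0"
      "expectation (\<lambda>\<omega>. (?S \<omega>)\<^sup>2) = (\<Sum>i<m. expectation (\<lambda>\<omega>. (\<xi> i \<omega>)\<^sup>2) * expectation (\<lambda>\<omega>. (D i \<omega>)\<^sup>2))"
      using Suc by simp_all
    have tpos: "0 \<le> t i" if "i \<le> Suc m" for i
      using that
    proof (induction i)
      case (Suc i)
      then show ?case using t(2)[of i] mn by simp
    qed (use t(1) in simp)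
    have tn: "0 \<le> t m" "t m < t (Suc m)" using tpos t(2)[OF mn] by auto
    have g1[measurable]: "g m \<in> borel_measurable borel" using g(1) .
    have DF: "D m \<in> borel_measurable (Fil (t (Suc m)))"
      unfolding D_def using tn
      by (intro measurable_compose[OF _ g1] borel_measurable_diff W_Fil) auto
    have xiF: "\<xi> m \<in> borel_measurable (Fil (t m))" using \<xi>(1)[OF mn] by simp
    have Dm[measurable]: "D m \<in> borel_measurable M" using Fil_measurable[OF DF] .
    have Sm[measurable]: "?S \<in> borel_measurable M" using Fil_measurable[OF IH(1)] .
    have xim[measurable]: "\<xi> m \<in> borel_measurable M" using Fil_measurable[OF xiF] .
    have ind: "indep_var borel Y borel (D m)" if Y: "Y \<in> borel_measurable (Fil (t m))" for Y :: "'a \<Rightarrow> real"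
    proof -
      have "indep_var borel (id \<circ> Y) borel (g m \<circ> (\<lambda>\<omega>. W (t (Suc m)) \<omega> - W (t m) \<omega>))"
        by (rule indep_var_compose[OF indep_var_increment[OF Y tn]]) auto
      then show ?thesis by (simp add: D_def comp_def)
    qed
    have ind2: "indep_var borel (\<lambda>\<omega>. (\<xi> m \<omega>)\<^sup>2) borel (\<lambda>\<omega>. (D m \<omega>)\<^sup>2)"
      using indep_var_compose[OF ind[OF xiF], of "\<lambda>x. x\<^sup>2" borel "\<lambda>x. x\<^sup>2" borel] by (simp add: comp_def)
    have iD: "integrable M (D m)" by (rule integrable_of_square) (use \<xi>(2) g(2) mn in auto)
    have ixi: "integrable M (\<xi> m)" by (rule integrable_of_square) (use \<xi>(2) g(2) mn in auto)
    have iS: "integrable M ?S" by (rule integrable_of_square) (use IH in auto)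
    have iSxi: "integrable M (\<lambda>\<omega>. ?S \<omega> * \<xi> m \<omega>)"
      by (rule integrable_mult_square_integrable) (use \<xi>(2) mn IH in auto)
    have SxiF: "(\<lambda>\<omega>. ?S \<omega> * \<xi> m \<omega>) \<in> borel_measurable (Fil (t m))" using IH(1) xiF by simp
    have cross: "integrable M (\<lambda>\<omega>. ?S \<omega> * \<xi> m \<omega> * D m \<omega>)" "expectation (\<lambda>\<omega>. ?S \<omega> * \<xi> m \<omega> * D m \<omega>) = 0"
      using indep_var_integrable[OF ind[OF SxiF] iSxi iD]
        indep_var_lebesgue_integral[OF ind[OF SxiF] iSxi iD] g(3)[OF mn] by simp_all
    have sq: "integrable M (\<lambda>\<omega>. (\<xi> m \<omega>)\<^sup>2 * (D m \<omega>)\<^sup>2)"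
      "expectation (\<lambda>\<omega>. (\<xi> m \<omega>)\<^sup>2 * (D m \<omega>)\<^sup>2) = expectation (\<lambda>\<omega>. (\<xi> m \<omega>)\<^sup>2) * expectation (\<lambda>\<omega>. (D m \<omega>)\<^sup>2)"
      using indep_var_integrable[OF ind2] indep_var_lebesgue_integral[OF ind2] \<xi>(2)[OF mn] g(2)[OF mn] by simp_all
    have lin: "integrable M (\<lambda>\<omega>. \<xi> m \<omega> * D m \<omega>)" "expectation (\<lambda>\<omega>. \<xi> m \<omega> * D m \<omega>) = 0"
      using indep_var_integrable[OF ind[OF xiF] ixi iD]
        indep_var_lebesgue_integral[OF ind[OF xiF] ixi iD] g(3)[OF mn] by simp_all
    have expand: "(\<lambda>\<omega>. (\<Sum>i<Suc m. \<xi> i \<omega> * D i \<omega>)\<^sup>2) =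
        (\<lambda>\<omega>. (?S \<omega>)\<^sup>2 + 2 * (?S \<omega> * \<xi> m \<omega> * D m \<omega>) + (\<xi> m \<omega>)\<^sup>2 * (D m \<omega>)\<^sup>2)"
      by (auto simp: power2_eq_square algebra_simps)
    have "(\<lambda>\<omega>. \<Sum>i<Suc m. \<xi> i \<omega> * D i \<omega>) \<in> borel_measurable (Fil (t (Suc m)))"
      using Fil_mono[OF IH(1), of "t (Suc m)"] Fil_mono[OF xiF, of "t (Suc m)"] DF tn by simp
    moreover have "integrable M (\<lambda>\<omega>. (\<Sum>i<Suc m. \<xi> i \<omega> * D i \<omega>)\<^sup>2)"
      unfolding expand using IH(2) cross(1) sq(1) by simp
    moreover have "expectation (\<lambda>\<omega>. (\<Sum>i<Suc m. \<xi> i \<omega> * D i \<omega>)\<^sup>2) =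
         (\<Sum>i<Suc m. expectation (\<lambda>\<omega>. (\<xi> i \<omega>)\<^sup>2) * expectation (\<lambda>\<omega>. (D i \<omega>)\<^sup>2))"
      unfolding expand using IH(2,4) cross sq by simp
    moreover have "expectation (\<lambda>\<omega>. \<Sum>i<Suc m. \<xi> i \<omega> * D i \<omega>) = 0"
    proof -
      have "expectation (\<lambda>\<omega>. \<Sum>i<Suc m. \<xi> i \<omega> * D i \<omega>) = expectation ?S + expectation (\<lambda>\<omega>. \<xi> m \<omega> * D m \<omega>)"
        using iS lin(1) by (simp add: Bochner_Integration.integral_add)
      then show ?thesis using IH(3) lin(2) by simp
    qed
    ultimately show ?case by blast
  qed simp
  from this[of n] show
    "(\<lambda>\<omega>. \<Sum>i<n. \<xi> i \<omega> * D i \<omega>) \<in> borel_measurable (Fil (t n))"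
    "integrable M (\<lambda>\<omega>. (\<Sum>i<n. \<xi> i \<omega> * D i \<omega>)\<^sup>2)"
    "expectation (\<lambda>\<omega>. \<Sum>i<n. \<xi> i \<omega> * D i \<omega>) = 0"
    "expectation (\<lambda>\<omega>. (\<Sum>i<n. \<xi> i \<omega> * D i \<omega>)\<^sup>2) =
       (\<Sum>i<n. expectation (\<lambda>\<omega>. (\<xi> i \<omega>)\<^sup>2) * expectation (\<lambda>\<omega>. (D i \<omega>)\<^sup>2))"
    by auto
qed

text \<open>The increments \<open>g (v - u) (W v - W u)\<close> cover both Brownian and exponential martingale increments.\<close>

lemma grid_transform_limit:
  fixes \<xi> :: "real \<Rightarrow> 'a \<Rightarrow> real" and g :: "real \<Rightarrow> real \<Rightarrow> real"
  assumes t: "0 < t"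
    and \<xi>: "\<And>u. 0 \<le> u \<Longrightarrow> u \<le> t \<Longrightarrow> \<xi> u \<in> borel_measurable (Fil u)"
      "\<And>u. 0 \<le> u \<Longrightarrow> u \<le> t \<Longrightarrow> integrable M (\<lambda>\<omega>. (\<xi> u \<omega>)\<^sup>2)"
      "\<And>u. 0 \<le> u \<Longrightarrow> u \<le> t \<Longrightarrow> expectation (\<lambda>\<omega>. (\<xi> u \<omega>)\<^sup>2) \<le> K"
    and g: "\<And>d. g d \<in> borel_measurable borel"
      "\<And>u v. 0 \<le> u \<Longrightarrow> u < v \<Longrightarrow> v \<le> t \<Longrightarrow> integrable M (\<lambda>\<omega>. (g (v - u) (W v \<omega> - W u \<omega>))\<^sup>2)"
      "\<And>u v. 0 \<le> u \<Longrightarrow> u < v \<Longrightarrow> v \<le> t \<Longrightarrow> expectation (\<lambda>\<omega>. g (v - u) (W v \<omega> - W u \<omega>)) = 0"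
      "\<And>u v. 0 \<le> u \<Longrightarrow> u < v \<Longrightarrow> v \<le> t \<Longrightarrow>
         expectation (\<lambda>\<omega>. (g (v - u) (W v \<omega> - W u \<omega>))\<^sup>2) \<le> c * (v - u)"
    and Z[measurable]: "Z \<in> borel_measurable M"
    and lim: "AE \<omega> in M. (\<lambda>n. \<Sum>i<Suc n. \<xi> (t * real i / real (Suc n)) \<omega> *
      g (t * real (Suc i) / real (Suc n) - t * real i / real (Suc n))
        (W (t * real (Suc i) / real (Suc n)) \<omega> - W (t * real i / real (Suc n)) \<omega>)) \<longlonglongrightarrow> Z \<omega>"
  shows "integrable M Z" "expectation Z = 0"
proof -
  define T where "T n i = t * real i / real (Suc n)" for n i
  define S where "S n \<omega> = (\<Sum>i<Suc n. \<xi> (T n i) \<omega> * g (T n (Suc i) - T n i) (W (T n (Suc i)) \<omega> - W (T n i) \<omega>))" for n \<omega>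
  have T: "0 \<le> T n i" "T n i < T n (Suc i)" for n i
    unfolding T_def using t by (simp_all add: divide_strict_right_mono)
  have T_le: "T n i \<le> t" if "i \<le> Suc n" for n i
  proof -
    have "t * real i \<le> t * real (Suc n)" using that t by (intro mult_left_mono) auto
    then show ?thesis unfolding T_def by (simp add: pos_divide_le_eq)
  qed
  note mt = martingale_transform[of "T n" "Suc n" "\<lambda>i. \<xi> (T n i)" "\<lambda>i. g (T n (Suc i) - T n i)" for n]
  have S: "S n \<in> borel_measurable (Fil (T n (Suc n)))" "integrable M (\<lambda>\<omega>. (S n \<omega>)\<^sup>2)" "expectation (S n) = 0"
    "expectation (\<lambda>\<omega>. (S n \<omega>)\<^sup>2) = (\<Sum>i<Suc n. expectation (\<lambda>\<omega>. (\<xi> (T n i) \<omega>)\<^sup>2) *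
       expectation (\<lambda>\<omega>. (g (T n (Suc i) - T n i) (W (T n (Suc i)) \<omega> - W (T n i) \<omega>))\<^sup>2))" for n
    unfolding S_def
    by (rule mt; use T T_le \<xi> g in \<open>simp add: Suc_le_eq\<close>)+
  have K: "0 \<le> K"
    using \<xi>(3)[of 0] t by (intro order_trans[OF _ \<xi>(3)[of 0]]) (simp_all add: Bochner_Integration.integral_nonneg)
  \<comment> \<open>By orthogonality each cell contributes at most \<open>K * c\<close> times its
    length, and the lengths add up to \<open>t\<close>: a bound free of the mesh.\<close>
  have "expectation (\<lambda>\<omega>. (S n \<omega>)\<^sup>2) \<le> K * c * t" for n
  proof -
    have "expectation (\<lambda>\<omega>. (S n \<omega>)\<^sup>2) \<le> (\<Sum>i<Suc n. K * (c * (T n (Suc i) - T n i)))"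
      unfolding S(4) using T T_le \<xi>(3) g(4) K
      by (intro sum_mono mult_mono Bochner_Integration.integral_nonneg) auto
    also have "\<dots> = K * c * (\<Sum>i<Suc n. T n (Suc i) - T n i)"
      by (simp add: sum_distrib_left mult.assoc del: sum.lessThan_Suc)
    also have "(\<Sum>i<Suc n. T n (Suc i) - T n i) = T n (Suc n) - T n 0"
      by (rule sum_lessThan_telescope)
    also have "\<dots> = t" by (simp add: T_def)
    finally show ?thesis .
  qed
  moreover have "AE \<omega> in M. (\<lambda>n. S n \<omega>) \<longlonglongrightarrow> Z \<omega>" using lim unfolding S_def T_def .
  ultimately show "integrable M Z" "expectation Z = 0"
    using limit_of_centered[where K = "K * c * t", OF Fil_measurable[OF S(1)] Z S(2) _ S(3)] by auto
qed

end


section \<open>A uniform bound for reflected random walks\<close>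

primrec lindley :: "(nat \<Rightarrow> real) \<Rightarrow> nat \<Rightarrow> real" where
  "lindley d 0 = 0"
| "lindley d (Suc i) = max 0 (lindley d i + d i)"

lemma lindley_nonneg: "0 \<le> lindley d n"
  by (cases n) auto

text \<open>The reflected walk is the largest rise of \<open>b\<close> over all starting indices.
  This direction of the identity lets it dominate the rise of the inventory since the start of a
  cycle.\<close>

lemma lindley_ge_diff: "j \<le> n \<Longrightarrow> (\<And>i. i < n \<Longrightarrow> d i = b (Suc i) - b i) \<Longrightarrow> b n - b j \<le> lindley d n"
proof (induction n)
  case (Suc n)
  show ?case
  proof (cases "j = Suc n")
    case False
    then have "b n - b j \<le> lindley d n" using Suc by auto
    then show ?thesis using Suc(3)[of n] by simp
  qed (simp add: lindley_nonneg)
qed simp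

context brownian
begin

text \<open>The recursion preserves the tail bound because \<open>exp (2 \<mu> (\<sigma> W t - \<mu> t) / \<sigma>\<^sup>2)\<close> has mean 1.\<close>

lemma lindley_tail:
  fixes t :: "nat \<Rightarrow> real"
  assumes pos: "\<mu> > 0" "\<sigma> > 0" and t: "0 \<le> t 0" "\<And>i. t i < t (Suc i)"
  defines "d \<equiv> \<lambda>\<omega> i. \<sigma> * (W (t (Suc i)) \<omega> - W (t i) \<omega>) - \<mu> * (t (Suc i) - t i)"
    and "m \<equiv> 2 * \<mu> / \<sigma>\<^sup>2"
  shows "(\<lambda>\<omega>. lindley (d \<omega>) n) \<in> borel_measurable (Fil (t n))"
    and "emeasure M {\<omega> \<in> space M. r \<le> lindley (d \<omega>) n} \<le> ennreal (exp (- m * r))"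
proof -
  have tpos: "0 \<le> t i" for i
  proof (induction i)
    case (Suc i)
    then show ?case using t(2)[of i] by simp
  qed (use t in simp)
  have dF: "(\<lambda>\<omega>. d \<omega> i) \<in> borel_measurable (Fil (t (Suc i)))" for i
    unfolding d_def using tpos t(2)[of i]
    by (intro borel_measurable_diff borel_measurable_times borel_measurable_const W_Fil) auto
  show F: "(\<lambda>\<omega>. lindley (d \<omega>) n) \<in> borel_measurable (Fil (t n))" for n
  proof (induction n)
    case (Suc n)
    show ?case
      using Fil_mono[OF Suc, of "t (Suc n)"] dF[of n] t(2)[of n] by simp
  qed simp
  have dm[measurable]: "(\<lambda>\<omega>. d \<omega> i) \<in> borel_measurable M" for i using Fil_measurable[OF dF] .
  have qm[measurable]: "(\<lambda>\<omega>. lindley (d \<omega>) i) \<in> borel_measurable M" for i using Fil_measurable[OF F] .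
  have m: "m > 0" unfolding m_def using pos by simp
  have exp_d: "(\<integral>\<^sup>+\<omega>. ennreal (exp (m * d \<omega> i)) \<partial>M) = 1" for i
  proof -
    have eq: "exp (m * d \<omega> i) = exp (m * \<sigma> * (W (t (Suc i)) \<omega> - W (t i) \<omega>)) * exp (- (m * \<mu> * (t (Suc i) - t i)))" for \<omega>
      unfolding d_def by (simp add: exp_add[symmetric] algebra_simps)
    \<comment> \<open>Here \<open>m\<close> is fixed: half the variance of the exponent compensates
      its drift, so the exponential has mean 1.\<close>
    have "(m * \<sigma>)\<^sup>2 * (t (Suc i) - t i) / 2 = m * \<mu> * (t (Suc i) - t i)"
      unfolding m_def using pos by (simp add: power2_eq_square)
    note key = this
    have "expectation (\<lambda>\<omega>. exp (m * d \<omega> i)) =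
        exp ((m * \<sigma>)\<^sup>2 * (t (Suc i) - t i) / 2) * exp (- (m * \<mu> * (t (Suc i) - t i)))"
      unfolding eq using expectation_exp_increment[OF tpos t(2), where a = "m * \<sigma>"] by simp
    then have "expectation (\<lambda>\<omega>. exp (m * d \<omega> i)) = 1" unfolding key by (simp add: exp_minus)
    moreover have "integrable M (\<lambda>\<omega>. exp (m * d \<omega> i))"
      unfolding eq using integrable_exp_increment[OF tpos t(2)] by simp
    ultimately show ?thesis by (subst nn_integral_eq_integral) auto
  qed
  show "emeasure M {\<omega> \<in> space M. r \<le> lindley (d \<omega>) n} \<le> ennreal (exp (- m * r))" for n
  \<comment> \<open>The level must vary: the step applies the hypothesis at \<open>r - y\<close> for
    every value \<open>y\<close> of the increment, negative levels included.\<close>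
  proof (induction n arbitrary: r)
    case 0
    show ?case
    proof (cases "r \<le> 0")
      case True
      then have "1 \<le> exp (- m * r)" using m by (simp add: mult_nonneg_nonpos)
      then have "ennreal 1 \<le> ennreal (exp (- m * r))" by (rule ennreal_leI)
      then show ?thesis using True emeasure_space_1 by simp
    qed simp
  next
    case (Suc n)
    show ?case
    proof (cases "r \<le> 0")
      case True
      then have "1 \<le> exp (- m * r)" using m by (simp add: mult_nonneg_nonpos)
      then have "ennreal 1 \<le> ennreal (exp (- m * r))" by (rule ennreal_leI)
      then show ?thesis unfolding ennreal_1 by (rule order_trans[OF emeasure_le_1])
    next
      case False
      let ?q = "\<lambda>\<omega>. lindley (d \<omega>) n" and ?x = "\<lambda>\<omega>. d \<omega> n"
      let ?A = "{p :: real \<times> real. r \<le> fst p + snd p}"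
      have A: "?A \<in> sets (borel \<Otimes>\<^sub>M borel)"
      proof -
        have "{p \<in> space (borel \<Otimes>\<^sub>M borel). r \<le> fst p + snd p} \<in> sets (borel \<Otimes>\<^sub>M borel :: (real \<times> real) measure)"
          by measurable
        then show ?thesis by (simp add: space_pair_measure)
      qed
      have "indep_var borel (id \<circ> ?q) borel ((\<lambda>w. \<sigma> * w - \<mu> * (t (Suc n) - t n)) \<circ> (\<lambda>\<omega>. W (t (Suc n)) \<omega> - W (t n) \<omega>))"
        by (rule indep_var_compose[OF indep_var_increment[OF F tpos t(2)]]) auto
      then have ind: "indep_var borel ?q borel ?x" by (simp add: comp_def d_def)
      interpret Q: prob_space "distr M borel ?q" by (rule prob_space_distr) simp
      interpret X: prob_space "distr M borel ?x" by (rule prob_space_distr) simp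
      interpret P: pair_sigma_finite "distr M borel ?q" "distr M borel ?x" ..
      have "{\<omega> \<in> space M. r \<le> lindley (d \<omega>) (Suc n)} = (\<lambda>\<omega>. (?q \<omega>, ?x \<omega>)) -` ?A \<inter> space M"
        using False by auto
      then have "emeasure M {\<omega> \<in> space M. r \<le> lindley (d \<omega>) (Suc n)}
        = emeasure (distr M (borel \<Otimes>\<^sub>M borel) (\<lambda>\<omega>. (?q \<omega>, ?x \<omega>))) ?A"
        using A by (subst emeasure_distr) auto
      also have "distr M (borel \<Otimes>\<^sub>M borel) (\<lambda>\<omega>. (?q \<omega>, ?x \<omega>)) = distr M borel ?q \<Otimes>\<^sub>M distr M borel ?x"
        using ind unfolding indep_var_distribution_eq by simp
      \<comment> \<open>Conditioning on the last increment \<open>y\<close>: the walk has to reach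
        \<open>r - y\<close> beforehand. Integrating \<open>exp (- m * (r - y))\<close> gives the
        old bound times a mean equal to 1.\<close>
      also have "emeasure \<dots> ?A = (\<integral>\<^sup>+y. emeasure (distr M borel ?q) ((\<lambda>x. (x, y)) -` ?A) \<partial>distr M borel ?x)"
        using A by (intro P.emeasure_pair_measure_alt2) simp
      also have "\<dots> \<le> (\<integral>\<^sup>+y. ennreal (exp (- m * (r - y))) \<partial>distr M borel ?x)"
      proof (rule nn_integral_mono)
        fix y
        have "(\<lambda>x. (x, y)) -` ?A = {r - y..}" by auto
        then have "emeasure (distr M borel ?q) ((\<lambda>x. (x, y)) -` ?A) = emeasure M {\<omega> \<in> space M. r - y \<le> ?q \<omega>}"
          by (subst emeasure_distr) (auto intro!: arg_cong[where f = "emeasure M"])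
        then show "emeasure (distr M borel ?q) ((\<lambda>x. (x, y)) -` ?A) \<le> ennreal (exp (- m * (r - y)))"
          using Suc.IH[of "r - y"] by simp
      qed
      also have "\<dots> = (\<integral>\<^sup>+\<omega>. ennreal (exp (- m * (r - ?x \<omega>))) \<partial>M)"
        by (subst nn_integral_distr) auto
      also have "\<dots> = (\<integral>\<^sup>+\<omega>. ennreal (exp (- m * r)) * ennreal (exp (m * ?x \<omega>)) \<partial>M)"
        by (simp add: ennreal_mult[symmetric] exp_add[symmetric] algebra_simps)
      also have "\<dots> = ennreal (exp (- m * r))"
        using exp_d by (subst nn_integral_cmult) auto
      finally show ?thesis .
    qed
  qed
qed

text \<open>With x = mq/2 the inequality x^2 \<le> 2 exp x gives q^2 \<le> (8/m^2) exp (mq/2).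
  Slicing by the integer part of \<open>q\<close>, this growth against the tail
  \<open>exp (- m * k)\<close> leaves a geometric series with ratio
  \<open>exp (- m / 2)\<close>.\<close>

lemma nn_integral_square_of_exp_tail:
  assumes m: "m > 0" and q[measurable]: "q \<in> borel_measurable M" and q0: "\<And>\<omega>. 0 \<le> q \<omega>"
    and tail: "\<And>r. emeasure M {\<omega> \<in> space M. r \<le> q \<omega>} \<le> ennreal (exp (- m * r))"
  shows "(\<integral>\<^sup>+\<omega>. ennreal ((q \<omega>)\<^sup>2) \<partial>M) \<le> ennreal (8 / m\<^sup>2 * exp (m / 2) / (1 - exp (- m / 2)))"
proof -
  have le: "ennreal ((q \<omega>)\<^sup>2) \<le>
    (\<Sum>k. ennreal (8 / m\<^sup>2 * exp (m / 2 * (real k + 1))) * indicator {\<omega> \<in> space M. real k \<le> q \<omega>} \<omega>)"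
    (is "_ \<le> suminf (?f \<omega>)") if "\<omega> \<in> space M" for \<omega>
  proof -
    define k where "k = nat \<lfloor>q \<omega>\<rfloor>"
    have k: "real k \<le> q \<omega>" "q \<omega> \<le> real k + 1" unfolding k_def using q0[of \<omega>] by linarith+
    define x where "x = m / 2 * q \<omega>"
    have "0 \<le> x" unfolding x_def using m q0 by simp
    then have "1 + x + x\<^sup>2 / 2 \<le> exp x" by (rule exp_lower_Taylor_quadratic)
    then have "x\<^sup>2 \<le> 2 * exp x" using \<open>0 \<le> x\<close> by simp
    then have "(q \<omega>)\<^sup>2 \<le> 8 / m\<^sup>2 * exp x"
      unfolding x_def using m by (simp add: field_simps power2_eq_square)
    also have "\<dots> \<le> 8 / m\<^sup>2 * exp (m / 2 * (real k + 1))"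
      unfolding x_def using m k by (intro mult_left_mono) auto
    finally have "ennreal ((q \<omega>)\<^sup>2) \<le> ?f \<omega> k" using that k(1) by (simp add: ennreal_leI)
    also have "\<dots> \<le> suminf (?f \<omega>)"
    proof -
      have "h k \<le> suminf h" for h :: "nat \<Rightarrow> ennreal"
        using sum_le_suminf[of h "{k}"] by simp
      then show ?thesis .
    qed
    finally show ?thesis .
  qed
  define a where "a = exp (- m / 2)"
  have a: "0 \<le> a" "a < 1" unfolding a_def using m by auto
  have "(\<integral>\<^sup>+\<omega>. ennreal ((q \<omega>)\<^sup>2) \<partial>M) \<le> (\<integral>\<^sup>+\<omega>. suminf (?f \<omega>) \<partial>M)"
    by (rule nn_integral_mono) (rule le)
  also have "\<dots> = (\<Sum>k. \<integral>\<^sup>+\<omega>. ?f \<omega> k \<partial>M)" by (rule nn_integral_suminf) simp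
  also have "\<dots> \<le> (\<Sum>k. ennreal (8 / m\<^sup>2 * exp (m / 2) * a ^ k))"
  proof (rule suminf_le)
    fix k
    have "(\<integral>\<^sup>+\<omega>. ?f \<omega> k \<partial>M) = ennreal (8 / m\<^sup>2 * exp (m / 2 * (real k + 1))) * emeasure M {\<omega> \<in> space M. real k \<le> q \<omega>}"
      by (subst nn_integral_cmult_indicator) auto
    also have "\<dots> \<le> ennreal (8 / m\<^sup>2 * exp (m / 2 * (real k + 1))) * ennreal (exp (- m * real k))"
      by (rule mult_left_mono[OF tail]) simp
    also have "\<dots> = ennreal (8 / m\<^sup>2 * (exp (m / 2 * (real k + 1)) * exp (- m * real k)))"
      by (subst ennreal_mult[symmetric]) (auto simp: mult.assoc)
    also have "exp (m / 2 * (real k + 1)) * exp (- m * real k) = exp (m / 2) * a ^ k"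
      unfolding a_def by (simp add: exp_add[symmetric] exp_of_nat_mult[symmetric] field_simps)
    finally show "(\<integral>\<^sup>+\<omega>. ?f \<omega> k \<partial>M) \<le> ennreal (8 / m\<^sup>2 * exp (m / 2) * a ^ k)" by (simp add: mult.assoc)
  qed auto
  also have "\<dots> = ennreal (\<Sum>k. 8 / m\<^sup>2 * exp (m / 2) * a ^ k)"
    using a m by (intro suminf_ennreal2 summable_mult summable_geometric) auto
  also have "(\<Sum>k. 8 / m\<^sup>2 * exp (m / 2) * a ^ k) = 8 / m\<^sup>2 * exp (m / 2) / (1 - a)"
    using a by (subst suminf_mult) (auto simp: suminf_geometric summable_geometric)
  finally show ?thesis unfolding a_def .
qed

text \<open>The bound does not depend on \<open>t\<close>, which keeps the second moment of the
  inventory bounded for all time. The starting time \<open>s\<close> may depend on the sample point: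
  it is approximated by grid points, at which the Lindley walk exceeds the rise, and Fatou passes to
  the limit.\<close>

lemma drift_range_square_bound:
  assumes pos: "\<mu> > 0" "\<sigma> > 0" and t: "0 \<le> t"
    and Z[measurable]: "Z \<in> borel_measurable M"
    and Zle: "AE \<omega> in M. \<exists>s\<in>{0..t}. Z \<omega> \<le> (\<sigma> * W t \<omega> - \<mu> * t) - (\<sigma> * W s \<omega> - \<mu> * s)"
  defines "m \<equiv> 2 * \<mu> / \<sigma>\<^sup>2"
  shows "(\<integral>\<^sup>+\<omega>. ennreal ((max 0 (Z \<omega>))\<^sup>2) \<partial>M) \<le> ennreal (8 / m\<^sup>2 * exp (m / 2) / (1 - exp (- m / 2)))"
proof (cases "t = 0")
  case True
  have "(\<integral>\<^sup>+\<omega>. ennreal ((max 0 (Z \<omega>))\<^sup>2) \<partial>M) = (\<integral>\<^sup>+\<omega>. 0 \<partial>M)"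
    using Zle by (intro nn_integral_cong_AE) (auto simp: True max_def elim!: eventually_mono)
  then show ?thesis by simp
next
  case False
  then have t: "t > 0" using t by simp
  define T where "T n i = t * real i / real (Suc n)" for n i
  define d where "d n \<omega> i = \<sigma> * (W (T n (Suc i)) \<omega> - W (T n i) \<omega>) - \<mu> * (T n (Suc i) - T n i)" for n \<omega> i
  define q where "q n \<omega> = lindley (d n \<omega>) (Suc n)" for n \<omega>
  have T: "0 \<le> T n 0" "T n i < T n (Suc i)" for n i
    unfolding T_def using t by (simp_all add: divide_strict_right_mono)
  have T_last: "T n (Suc n) = t" for n unfolding T_def by simp
  have m: "m > 0" unfolding m_def using pos by simp
  have qm[measurable]: "q n \<in> borel_measurable M" for n
    using Fil_measurable[OF lindley_tail(1)[OF pos T(1,2)]] unfolding q_def d_def .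
  have q2: "(\<integral>\<^sup>+\<omega>. ennreal ((q n \<omega>)\<^sup>2) \<partial>M) \<le> ennreal (8 / m\<^sup>2 * exp (m / 2) / (1 - exp (- m / 2)))" for n
  proof (rule nn_integral_square_of_exp_tail[OF m qm])
    show "emeasure M {\<omega> \<in> space M. r \<le> q n \<omega>} \<le> ennreal (exp (- m * r))" for r
      using lindley_tail(2)[where t = "T n" and n = "Suc n" and r = r, OF pos T(1,2)] unfolding q_def d_def m_def .
  qed (simp add: q_def lindley_nonneg)
  have "AE \<omega> in M. ennreal ((max 0 (Z \<omega>))\<^sup>2) \<le> liminf (\<lambda>n. ennreal ((q n \<omega>)\<^sup>2))"
    using Zle AE_W
  proof eventually_elim
    case (elim \<omega>)
    then obtain s where s: "0 \<le> s" "s \<le> t"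
      and le: "Z \<omega> \<le> (\<sigma> * W t \<omega> - \<mu> * t) - (\<sigma> * W s \<omega> - \<mu> * s)" by auto
    define b where "b u = \<sigma> * W u \<omega> - \<mu> * u" for u
    have cont: "continuous_on {0..} b"
      unfolding b_def using elim by (intro continuous_intros) auto
    \<comment> \<open>Index of the last grid point not beyond \<open>s\<close>.\<close>
    define j where "j n = nat \<lfloor>s / t * real (Suc n)\<rfloor>" for n
    have j: "real (j n) \<le> s / t * real (Suc n)" "s / t * real (Suc n) < real (j n) + 1" for n
      unfolding j_def using s t by (simp_all add: floor_less_iff)
    have jn: "j n \<le> Suc n" for n
    proof -
      have "s / t * real (Suc n) \<le> 1 * real (Suc n)" using s t by (intro mult_right_mono) auto
      with j(1)[of n] have "real (j n) \<le> 1 * real (Suc n)" by (rule order_trans)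
      then show ?thesis by simp
    qed
    have Tj: "T n (j n) \<le> s" "s - t / real (Suc n) \<le> T n (j n)" for n
    proof -
      define N where "N = real (Suc n)"
      have N: "N > 0" by (simp add: N_def)
      have 1: "t * real (j n) \<le> s * N" "s * N \<le> t * real (j n) + t"
        using j[of n] t unfolding N_def by (simp_all add: field_simps)
      show "T n (j n) \<le> s"
        unfolding T_def N_def[symmetric] using 1 N by (simp add: pos_divide_le_eq)
      have "s - t / N = (s * N - t) / N" using N by (simp add: field_simps)
      also have "\<dots> \<le> t * real (j n) / N" using 1 N by (intro divide_right_mono) auto
      finally show "s - t / real (Suc n) \<le> T n (j n)" unfolding T_def N_def .
    qed
    have "(\<lambda>n. T n (j n)) \<longlonglongrightarrow> s"
    proof (rule tendsto_sandwich[of "\<lambda>n. s - t / real (Suc n)" _ _ "\<lambda>_. s"])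
      show "(\<lambda>n. s - t / real (Suc n)) \<longlonglongrightarrow> s"
        using tendsto_diff[OF tendsto_const[of s] LIMSEQ_Suc[OF lim_const_over_n[of t]]] by simp
    qed (use Tj in auto)
    then have lim: "(\<lambda>n. b (T n (j n))) \<longlonglongrightarrow> b s"
      by (rule continuous_on_tendsto_compose[OF cont]) (use s t in \<open>auto simp: T_def\<close>)
    have ge: "b t - b (T n (j n)) \<le> q n \<omega>" for n
      using lindley_ge_diff[OF jn, of n "d n \<omega>" "\<lambda>i. b (T n i)"] T_last[of n]
      unfolding q_def by (simp add: d_def b_def algebra_simps)
    have "(\<lambda>n. ennreal ((max 0 (b t - b (T n (j n))))\<^sup>2)) \<longlonglongrightarrow> ennreal ((max 0 (b t - b s))\<^sup>2)"
      by (intro tendsto_intros lim)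
    then have "ennreal ((max 0 (b t - b s))\<^sup>2) = liminf (\<lambda>n. ennreal ((max 0 (b t - b (T n (j n))))\<^sup>2))"
      using lim_imp_Liminf[OF sequentially_bot] by metis
    also have "\<dots> \<le> liminf (\<lambda>n. ennreal ((q n \<omega>)\<^sup>2))"
      using ge lindley_nonneg by (intro Liminf_mono always_eventually allI ennreal_leI power_mono) (auto simp: q_def)
    finally have "ennreal ((max 0 (b t - b s))\<^sup>2) \<le> liminf (\<lambda>n. ennreal ((q n \<omega>)\<^sup>2))" .
    moreover have "ennreal ((max 0 (Z \<omega>))\<^sup>2) \<le> ennreal ((max 0 (b t - b s))\<^sup>2)"
      using le unfolding b_def by (intro ennreal_leI power_mono) auto
    ultimately show ?case by (rule order_trans[rotated])
  qed
  then have "(\<integral>\<^sup>+\<omega>. ennreal ((max 0 (Z \<omega>))\<^sup>2) \<partial>M) \<le> (\<integral>\<^sup>+\<omega>. liminf (\<lambda>n. ennreal ((q n \<omega>)\<^sup>2)) \<partial>M)"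
    by (rule nn_integral_mono_AE)
  also have "\<dots> \<le> liminf (\<lambda>n. \<integral>\<^sup>+\<omega>. ennreal ((q n \<omega>)\<^sup>2) \<partial>M)"
    by (rule nn_integral_liminf) simp
  also have "\<dots> \<le> ennreal (8 / m\<^sup>2 * exp (m / 2) / (1 - exp (- m / 2)))"
    using q2 by (intro Liminf_le) auto
  finally show ?thesis .
qed

end


section \<open>Change of variables along a path\<close>

text \<open>Compactness of [0,t] makes the local estimates uniform, and the increments of
  \<open>V\<close> telescope. Measuring errors against a monotone clock \<open>V\<close> treats
  jumps and continuous pieces alike: where \<open>V\<close> jumps by 1, an absolute error of
  \<epsilon> is admissible.\<close>

lemma grid_error_tendsto_zero:
  fixes e :: "real \<Rightarrow> real \<Rightarrow> real" and V :: "real \<Rightarrow> real"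
  assumes t: "0 < t"
    and V: "\<And>u v. 0 \<le> u \<Longrightarrow> u \<le> v \<Longrightarrow> v \<le> t \<Longrightarrow> V u \<le> V v"
    and loc: "\<And>s \<epsilon>. 0 \<le> s \<Longrightarrow> s \<le> t \<Longrightarrow> 0 < \<epsilon> \<Longrightarrow>
      \<exists>\<delta>>0. \<forall>u v. 0 \<le> u \<and> u \<le> v \<and> v \<le> t \<and> \<bar>u - s\<bar> < \<delta> \<and> \<bar>v - s\<bar> < \<delta> \<longrightarrow> \<bar>e u v\<bar> \<le> \<epsilon> * (V v - V u)"
  shows "(\<lambda>n. \<Sum>i<Suc n. e (t * real i / real (Suc n)) (t * real (Suc i) / real (Suc n))) \<longlonglongrightarrow> 0"
proof (rule LIMSEQ_I)
  fix r :: real assume r: "0 < r"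
  \<comment> \<open>The summand 1 keeps the quotient meaningful when \<open>V\<close> is
    constant.\<close>
  define \<epsilon> where "\<epsilon> = r / (V t - V 0 + 1)"
  have V0: "0 \<le> V t - V 0" using V[of 0 t] t by simp
  then have \<epsilon>: "\<epsilon> > 0" unfolding \<epsilon>_def using r by simp
  obtain \<delta> where \<delta>: "\<And>s. s \<in> {0..t} \<Longrightarrow> \<delta> s > 0 \<and> (\<forall>u v. 0 \<le> u \<and> u \<le> v \<and> v \<le> t \<and>
      \<bar>u - s\<bar> < \<delta> s \<and> \<bar>v - s\<bar> < \<delta> s \<longrightarrow> \<bar>e u v\<bar> \<le> \<epsilon> * (V v - V u))"
    using loc[OF _ _ \<epsilon>] by (metis atLeastAtMost_iff)
  \<comment> \<open>A Lebesgue number of the cover: every cell of a finer grid lies in one of the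
    neighbourhoods.\<close>
  obtain \<rho> where \<rho>: "0 < \<rho>" "\<And>x. x \<in> {0..t} \<Longrightarrow> \<exists>G\<in>(\<lambda>s. ball s (\<delta> s)) ` {0..t}. ball x \<rho> \<subseteq> G"
  proof (rule Heine_Borel_lemma[of "{0..t}" "(\<lambda>s. ball s (\<delta> s)) ` {0..t}"])
    show "{0..t} \<subseteq> \<Union> ((\<lambda>s. ball s (\<delta> s)) ` {0..t})"
    proof
      fix x assume x: "x \<in> {0..t}"
      then have "x \<in> ball x (\<delta> x)" using \<delta>[OF x] by simp
      with x show "x \<in> \<Union> ((\<lambda>s. ball s (\<delta> s)) ` {0..t})" by blast
    qed
  qed auto
  obtain n0 where n0: "t / \<rho> < real n0" using reals_Archimedean2 by blast
  show "\<exists>no. \<forall>n\<ge>no. norm ((\<Sum>i<Suc n. e (t * real i / real (Suc n)) (t * real (Suc i) / real (Suc n))) - 0) < r"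
  proof (intro exI[of _ n0] allI impI)
    fix n assume n: "n0 \<le> n"
    define T where "T i = t * real i / real (Suc n)" for i
    have step: "T (Suc i) = T i + t / real (Suc n)" for i unfolding T_def by (simp add: distrib_left add_divide_distrib)
    have mesh: "t / real (Suc n) < \<rho>"
    proof -
      have "t / \<rho> < real (Suc n)" using n n0 by simp
      then show ?thesis using \<rho>(1) by (simp add: field_simps)
    qed
    have mesh0: "0 < t / real (Suc n)" using t by simp
    have T0: "0 \<le> T i" for i unfolding T_def using t by simp
    have T_le: "T i \<le> t" if "i \<le> Suc n" for i
    proof -
      have "t * real i \<le> t * real (Suc n)" using that t by (intro mult_left_mono) auto
      then show ?thesis unfolding T_def by (simp add: pos_divide_le_eq)
    qed
    have cell: "\<bar>e (T i) (T (Suc i))\<bar> \<le> \<epsilon> * (V (T (Suc i)) - V (T i))" if i: "i < Suc n" for i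
    proof -
      have "T i \<in> {0..t}" using T0 T_le i by auto
      then obtain s where s: "s \<in> {0..t}" "ball (T i) \<rho> \<subseteq> ball s (\<delta> s)" using \<rho>(2) by blast
      have "T i \<in> ball (T i) \<rho>" "T (Suc i) \<in> ball (T i) \<rho>"
        using \<rho>(1) mesh mesh0 by (auto simp: step dist_real_def)
      then have "T i \<in> ball s (\<delta> s)" "T (Suc i) \<in> ball s (\<delta> s)" using s(2) by blast+
      then have "\<bar>T i - s\<bar> < \<delta> s" "\<bar>T (Suc i) - s\<bar> < \<delta> s"
        by (simp_all add: dist_real_def abs_minus_commute)
      moreover have "T i \<le> T (Suc i)" using mesh0 step by simp
      moreover have "T (Suc i) \<le> t" using T_le i by simp
      ultimately show ?thesis using \<delta>[OF s(1)] T0 by blast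
    qed
    have "\<bar>\<Sum>i<Suc n. e (T i) (T (Suc i))\<bar> \<le> (\<Sum>i<Suc n. \<bar>e (T i) (T (Suc i))\<bar>)" by (rule sum_abs)
    also have "\<dots> \<le> (\<Sum>i<Suc n. \<epsilon> * (V (T (Suc i)) - V (T i)))" using cell by (intro sum_mono) auto
    also have "\<dots> = \<epsilon> * (\<Sum>i<Suc n. V (T (Suc i)) - V (T i))" by (rule sum_distrib_left[symmetric])
    also have "(\<Sum>i<Suc n. V (T (Suc i)) - V (T i)) = V (T (Suc n)) - V (T 0)" by (rule sum_lessThan_telescope)
    also have "\<dots> = V t - V 0" unfolding T_def by simp
    also have "\<epsilon> * (V t - V 0) < r" unfolding \<epsilon>_def using V0 r by (simp add: divide_simps)
    finally show "norm ((\<Sum>i<Suc n. e (t * real i / real (Suc n)) (t * real (Suc i) / real (Suc n))) - 0) < r"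
      unfolding T_def by simp
  qed
qed

text \<open>Increments of the primitive \<open>\<Phi>\<close> telescope, so only the error of each
  summand against its increment has to vanish.\<close>

lemma grid_sum_tendsto:
  fixes f :: "real \<Rightarrow> real \<Rightarrow> real" and V \<Phi> :: "real \<Rightarrow> real"
  assumes t: "0 < t"
    and V: "\<And>u v. 0 \<le> u \<Longrightarrow> u \<le> v \<Longrightarrow> v \<le> t \<Longrightarrow> V u \<le> V v"
    and loc: "\<And>s \<epsilon>. 0 \<le> s \<Longrightarrow> s \<le> t \<Longrightarrow> 0 < \<epsilon> \<Longrightarrow>
      \<exists>\<delta>>0. \<forall>u v. 0 \<le> u \<and> u \<le> v \<and> v \<le> t \<and> \<bar>u - s\<bar> < \<delta> \<and> \<bar>v - s\<bar> < \<delta> \<longrightarrow>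
        \<bar>f u v - (\<Phi> v - \<Phi> u)\<bar> \<le> \<epsilon> * (V v - V u)"
  shows "(\<lambda>n. \<Sum>i<Suc n. f (t * real i / real (Suc n)) (t * real (Suc i) / real (Suc n))) \<longlonglongrightarrow> \<Phi> t - \<Phi> 0"
proof -
  have "(\<Sum>i<Suc n. \<Phi> (t * real (Suc i) / real (Suc n)) - \<Phi> (t * real i / real (Suc n))) = \<Phi> t - \<Phi> 0" for n
    by (subst sum_lessThan_telescope) simp
  then have "(\<Sum>i<Suc n. \<Phi> (t * real (Suc i) / real (Suc n))) - (\<Sum>i<Suc n. \<Phi> (t * real i / real (Suc n))) = \<Phi> t - \<Phi> 0" for n
    by (simp only: sum_subtractf)
  then have "(\<lambda>n. \<Sum>i<Suc n. f (t * real i / real (Suc n)) (t * real (Suc i) / real (Suc n)) -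
      (\<Phi> (t * real (Suc i) / real (Suc n)) - \<Phi> (t * real i / real (Suc n)))) =
    (\<lambda>n. (\<Sum>i<Suc n. f (t * real i / real (Suc n)) (t * real (Suc i) / real (Suc n))) - (\<Phi> t - \<Phi> 0))"
    by (simp only: sum_subtractf)
  then show ?thesis
    using grid_error_tendsto_zero[of t V "\<lambda>u v. f u v - (\<Phi> v - \<Phi> u)", OF t V loc]
    by (simp only: LIM_zero_iff)
qed

text \<open>A short cell near \<open>s\<close> either sees a constant discrete state or straddles
  \<open>s\<close>, with state \<open>q\<close> before and \<open>st s\<close> from \<open>s\<close>
  on. The estimate splits into these two situations, which are treated separately for each change of
  variables.\<close>

lemma local_property_by_state:
  fixes st :: "real \<Rightarrow> 'b" and P :: "real \<Rightarrow> real \<Rightarrow> bool"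
  assumes s: "0 \<le> s"
    and right: "\<exists>\<delta>>0. \<forall>a. s \<le> a \<and> a < s + \<delta> \<longrightarrow> st a = st s"
    and left: "0 < s \<Longrightarrow> \<exists>\<delta>>0. \<forall>a. 0 \<le> a \<and> s - \<delta> < a \<and> a < s \<longrightarrow> st a = q"
    and cell: "\<exists>\<delta>>0. \<forall>u v. 0 \<le> u \<and> u \<le> v \<and> \<bar>u - s\<bar> < \<delta> \<and> \<bar>v - s\<bar> < \<delta> \<and>
      (\<forall>a. u \<le> a \<and> a \<le> v \<longrightarrow> st a = st u) \<longrightarrow> P u v"
    and jump: "0 < s \<Longrightarrow> q \<noteq> st s \<Longrightarrow> \<exists>\<delta>>0. \<forall>u v. 0 \<le> u \<and> u < s \<and> s \<le> v \<and> \<bar>u - s\<bar> < \<delta> \<and> \<bar>v - s\<bar> < \<delta> \<and>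
      (\<forall>a. u \<le> a \<and> a < s \<longrightarrow> st a = q) \<and> (\<forall>a. s \<le> a \<and> a \<le> v \<longrightarrow> st a = st s) \<longrightarrow> P u v"
  shows "\<exists>\<delta>>0. \<forall>u v. 0 \<le> u \<and> u \<le> v \<and> \<bar>u - s\<bar> < \<delta> \<and> \<bar>v - s\<bar> < \<delta> \<longrightarrow> P u v"
proof -
  obtain \<delta>1 where \<delta>1: "\<delta>1 > 0" "\<And>a. s \<le> a \<Longrightarrow> a < s + \<delta>1 \<Longrightarrow> st a = st s"
    using right by blast
  have "\<exists>\<delta>>0. \<forall>a. 0 \<le> a \<and> s - \<delta> < a \<and> a < s \<longrightarrow> st a = q"
    by (cases "s = 0") (use left s in \<open>auto intro: exI[of _ 1]\<close>)
  then obtain \<delta>2 where \<delta>2: "\<delta>2 > 0" "\<And>a. 0 \<le> a \<Longrightarrow> s - \<delta>2 < a \<Longrightarrow> a < s \<Longrightarrow> st a = q"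
    by blast
  obtain \<delta>3 where \<delta>3: "\<delta>3 > 0" and cell3: "\<forall>u v. 0 \<le> u \<and> u \<le> v \<and> \<bar>u - s\<bar> < \<delta>3 \<and> \<bar>v - s\<bar> < \<delta>3 \<and>
      (\<forall>a. u \<le> a \<and> a \<le> v \<longrightarrow> st a = st u) \<longrightarrow> P u v"
    using cell by (elim exE conjE) (rule that)
  let ?J = "\<lambda>\<delta>. \<forall>u v. 0 \<le> u \<and> u < s \<and> s \<le> v \<and> \<bar>u - s\<bar> < \<delta> \<and> \<bar>v - s\<bar> < \<delta> \<and>
      (\<forall>a. u \<le> a \<and> a < s \<longrightarrow> st a = q) \<and> (\<forall>a. s \<le> a \<and> a \<le> v \<longrightarrow> st a = st s) \<longrightarrow> P u v"
  obtain \<delta>4 where \<delta>4: "\<delta>4 > 0" and jump4: "0 < s \<Longrightarrow> q \<noteq> st s \<Longrightarrow> ?J \<delta>4"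
  proof (cases "0 < s \<and> q \<noteq> st s")
    case True
    have "\<exists>\<delta>>0. ?J \<delta>" by (rule jump[OF conjunct1[OF True] conjunct2[OF True]])
    then show thesis by (elim exE conjE) (rule that)
  next
    case False
    show thesis by (rule that[of 1]) (use False in simp_all)
  qed
  show ?thesis
  proof (intro exI[of _ "min (min \<delta>1 \<delta>2) (min \<delta>3 \<delta>4)"] conjI allI impI)
    show "0 < min (min \<delta>1 \<delta>2) (min \<delta>3 \<delta>4)" using \<delta>1 \<delta>2 \<delta>3 \<delta>4 by simp
    fix u v
    assume "0 \<le> u \<and> u \<le> v \<and> \<bar>u - s\<bar> < min (min \<delta>1 \<delta>2) (min \<delta>3 \<delta>4) \<and> \<bar>v - s\<bar> < min (min \<delta>1 \<delta>2) (min \<delta>3 \<delta>4)"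
    then have uv: "0 \<le> u" "u \<le> v" and d1: "v < s + \<delta>1" and d2: "s - \<delta>2 < u"
      and d3: "\<bar>u - s\<bar> < \<delta>3" "\<bar>v - s\<bar> < \<delta>3" and d4: "\<bar>u - s\<bar> < \<delta>4" "\<bar>v - s\<bar> < \<delta>4"
      by auto
    have hi: "st a = st s" if "s \<le> a" "a \<le> v" for a using \<delta>1(2)[of a] that d1 by simp
    have lo: "st a = q" if "u \<le> a" "a < s" for a using \<delta>2(2)[of a] that d2 uv by simp
    have const: "P u v" if "\<And>a. u \<le> a \<Longrightarrow> a \<le> v \<Longrightarrow> st a = st u"
    proof -
      have "0 \<le> u \<and> u \<le> v \<and> \<bar>u - s\<bar> < \<delta>3 \<and> \<bar>v - s\<bar> < \<delta>3 \<and> (\<forall>a. u \<le> a \<and> a \<le> v \<longrightarrow> st a = st u)"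
        by (intro conjI allI impI uv d3) (elim conjE, rule that)
      then show ?thesis by (rule cell3[THEN spec, THEN spec, THEN mp])
    qed
    consider "s \<le> u" | "v < s" | "u < s" "s \<le> v" "q = st s" | "u < s" "s \<le> v" "q \<noteq> st s" by linarith
    then show "P u v"
    proof cases
      case 1
      have "st a = st u" if "u \<le> a" "a \<le> v" for a
        using hi[of a] hi[of u] that 1 uv by simp
      then show ?thesis by (rule const)
    next
      case 2
      have "st a = st u" if "u \<le> a" "a \<le> v" for a
        using lo[of a] lo[of u] that 2 uv by simp
      then show ?thesis by (rule const)
    next
      case 3
      have *: "st a = st s" if "u \<le> a" "a \<le> v" for a
        using lo[of a] hi[of a] that 3 by (cases "a < s") simp_all
      have "st a = st u" if "u \<le> a" "a \<le> v" for a
        using *[of a] *[of u] that uv by simp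
      then show ?thesis by (rule const)
    next
      case 4
      have "0 < s" using uv 4(1) by simp
      have "0 \<le> u \<and> u < s \<and> s \<le> v \<and> \<bar>u - s\<bar> < \<delta>4 \<and> \<bar>v - s\<bar> < \<delta>4 \<and>
        (\<forall>a. u \<le> a \<and> a < s \<longrightarrow> st a = q) \<and> (\<forall>a. s \<le> a \<and> a \<le> v \<longrightarrow> st a = st s)"
        by (intro conjI allI impI uv(1) 4 d4) (elim conjE, erule (1) lo hi)+
      then show ?thesis by (rule jump4[OF \<open>0 < s\<close> 4(3), THEN spec, THEN spec, THEN mp])
    qed
  qed
qed

section \<open>Change of variables for the square of the inventory\<close>

lemma continuous_on_atLeast_near:
  fixes f :: "real \<Rightarrow> real"
  assumes "continuous_on {0..} f" "0 \<le> s" "0 < \<eta>"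
  shows "\<exists>\<delta>>0. \<forall>a\<ge>0. \<bar>a - s\<bar> < \<delta> \<longrightarrow> \<bar>f a - f s\<bar> < \<eta>"
  using assms unfolding continuous_on_iff dist_real_def by (meson atLeast_iff)

text \<open>By the balance equation a jump of \<open>X\<close> has size \<open>z - y\<close>, so an order brings the path from \<open>y\<close> to \<open>z\<close>.\<close>

locale regulated_path =
  fixes \<mu> \<sigma> X\<^sub>0 y z :: real and w X L n :: "real \<Rightarrow> real"
  assumes mu: "0 < \<mu>" and sigma: "0 < \<sigma>" and y: "0 \<le> y" and yz: "y < z"
    and w_cont: "continuous_on {0..} w" and w_0: "w 0 = 0"
    and X_eq: "\<And>t. 0 \<le> t \<Longrightarrow> X t = X\<^sub>0 - \<mu> * t + \<sigma> * w t + L t + (z - y) * n t"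
    and X_nonneg: "\<And>t. 0 \<le> t \<Longrightarrow> 0 \<le> X t"
    and L_0: "L 0 = 0" and L_cont: "continuous_on {0..} L" and L_mono: "mono_on {0..} L"
    and L_flat: "\<And>s t. 0 \<le> s \<Longrightarrow> s \<le> t \<Longrightarrow> (\<And>u. s \<le> u \<Longrightarrow> u \<le> t \<Longrightarrow> 0 < X u) \<Longrightarrow> L t = L s"
    and n_0: "n 0 = 0" and n_mono: "mono_on {0..} n"
    and n_right: "\<And>s. 0 \<le> s \<Longrightarrow> \<exists>\<delta>>0. \<forall>t. s \<le> t \<and> t < s + \<delta> \<longrightarrow> n t = n s"
    and n_left: "\<And>s. 0 < s \<Longrightarrow> (\<exists>\<delta>>0. \<forall>t. 0 \<le> t \<and> s - \<delta> < t \<and> t < s \<longrightarrow> n t = n s) \<or>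
      (X s = z \<and> (\<exists>\<delta>>0. \<forall>t. 0 \<le> t \<and> s - \<delta> < t \<and> t < s \<longrightarrow> n t = n s - 1))"
begin

text \<open>The path with the orders removed. It is continuous, and between orders \<open>X\<close>
  differs from it by a constant.\<close>

definition c :: "real \<Rightarrow> real" where "c t = X\<^sub>0 - \<mu> * t + \<sigma> * w t + L t"

lemma c_cont: "continuous_on {0..} c"
  unfolding c_def using w_cont L_cont by (intro continuous_intros)

lemma X_c: "0 \<le> t \<Longrightarrow> X t = c t + (z - y) * n t"
  unfolding c_def using X_eq by simp

lemma L_le: "0 \<le> s \<Longrightarrow> s \<le> t \<Longrightarrow> L s \<le> L t"
  using L_mono by (auto simp: mono_on_def)

lemma n_le: "0 \<le> s \<Longrightarrow> s \<le> t \<Longrightarrow> n s \<le> n t"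
  using n_mono by (auto simp: mono_on_def)

lemma X_0: "X 0 = X\<^sub>0"
  using X_eq[of 0] w_0 L_0 n_0 by simp

lemma X_integrable:
  assumes "0 \<le> a" shows "X integrable_on {a..b}"
proof (rule integrable_eq[where f = "\<lambda>t. c t + (z - y) * n t"])
  have "continuous_on {a..b} c" by (rule continuous_on_subset[OF c_cont]) (use assms in auto)
  moreover have "mono_on {a..b} n" using n_mono assms by (auto simp: mono_on_def)
  ultimately show "(\<lambda>t. c t + (z - y) * n t) integrable_on {a..b}"
    by (intro integrable_add integrable_on_mult_right integrable_continuous_real integrable_on_mono_on)
qed (use X_c assms in auto)

text \<open>The last alternative is the pathwise substitute for the vanishing of the integral of X
  against dL: if \<open>X v\<close> exceeds \<eta>, the oscillation bound keeps \<open>X\<close>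
  positive on the whole cell, so \<open>L\<close> stands still.\<close>

lemma cell_close:
  assumes s: "0 \<le> s" and \<eta>: "0 < \<eta>"
  shows "\<exists>\<delta>>0. \<forall>u v. 0 \<le> u \<and> u \<le> v \<and> \<bar>u - s\<bar> < \<delta> \<and> \<bar>v - s\<bar> < \<delta> \<and> (\<forall>a. u \<le> a \<and> a \<le> v \<longrightarrow> n a = n u) \<longrightarrow>
     v - u \<le> \<eta> \<and> L v - L u \<le> \<eta> \<and> (\<forall>a. u \<le> a \<and> a \<le> v \<longrightarrow> \<bar>X a - X v\<bar> \<le> \<eta>) \<and> (L v = L u \<or> X v \<le> \<eta>)"
proof -
  have \<eta>2: "0 < \<eta> / 2" using \<eta> by simp
  obtain \<delta>1 where \<delta>1: "\<delta>1 > 0" "\<And>a. a \<ge> 0 \<Longrightarrow> \<bar>a - s\<bar> < \<delta>1 \<Longrightarrow> \<bar>c a - c s\<bar> < \<eta> / 2"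
    using continuous_on_atLeast_near[OF c_cont s \<eta>2] by blast
  obtain \<delta>2 where \<delta>2: "\<delta>2 > 0" "\<And>a. a \<ge> 0 \<Longrightarrow> \<bar>a - s\<bar> < \<delta>2 \<Longrightarrow> \<bar>L a - L s\<bar> < \<eta> / 2"
    using continuous_on_atLeast_near[OF L_cont s \<eta>2] by blast
  show ?thesis
  proof (intro exI[of _ "min (\<eta> / 2) (min \<delta>1 \<delta>2)"] conjI allI impI; (elim conjE)?)
    fix u v
    assume uv: "0 \<le> u" "u \<le> v" "\<bar>u - s\<bar> < min (\<eta> / 2) (min \<delta>1 \<delta>2)" "\<bar>v - s\<bar> < min (\<eta> / 2) (min \<delta>1 \<delta>2)"
      and n: "\<forall>a. u \<le> a \<and> a \<le> v \<longrightarrow> n a = n u"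
    show "v - u \<le> \<eta>" using uv by (auto simp: abs_if split: if_splits)
    have "\<bar>L u - L s\<bar> < \<eta> / 2" "\<bar>L v - L s\<bar> < \<eta> / 2"
      using \<delta>2(2)[of u] \<delta>2(2)[of v] uv by auto
    then show "L v - L u \<le> \<eta>" by linarith
    have close: "\<bar>X a - X v\<bar> \<le> \<eta>" if "u \<le> a" "a \<le> v" for a
    proof -
      have "n a = n v" using n that uv by (metis order_refl)
      then have "X a - X v = c a - c v" using X_c[of a] X_c[of v] that uv by simp
      moreover have "\<bar>a - s\<bar> < \<delta>1" using that uv by (auto simp: abs_if split: if_splits)
      moreover have "\<bar>c v - c s\<bar> < \<eta> / 2" using \<delta>1(2)[of v] uv by auto
      moreover have "\<bar>c a - c s\<bar> < \<eta> / 2" using \<delta>1(2)[of a] calculation that uv by auto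
      ultimately show ?thesis by linarith
    qed
    show "\<bar>X a - X v\<bar> \<le> \<eta>" if "u \<le> a" "a \<le> v" for a using close[OF that] .
    show "L v = L u \<or> X v \<le> \<eta>"
    proof (rule disjCI)
      assume "\<not> X v \<le> \<eta>"
      then have "0 < X a" if "u \<le> a" "a \<le> v" for a using close[OF that] by simp
      then show "L v = L u" using L_flat[of u v] uv by simp
    qed
  qed (use \<delta>1 \<delta>2 \<eta> in auto)
qed

lemma integral_close:
  assumes "0 \<le> u" "u \<le> v" "\<And>a. u \<le> a \<Longrightarrow> a \<le> v \<Longrightarrow> \<bar>X a - p\<bar> \<le> \<eta>"
  shows "\<bar>p * (v - u) - integral {u..v} X\<bar> \<le> \<eta> * (v - u)"
proof -
  have i: "X integrable_on {u..v}" using X_integrable assms(1) .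
  have b: "X a \<le> p + \<eta>" "p - \<eta> \<le> X a" if "a \<in> {u..v}" for a
    using assms(3)[of a] that by (auto simp: abs_le_iff)
  have "integral {u..v} X \<le> integral {u..v} (\<lambda>_. p + \<eta>)"
    by (rule integral_le) (use i b in auto)
  moreover have "integral {u..v} (\<lambda>_. p - \<eta>) \<le> integral {u..v} X"
    by (rule integral_le) (use i b in auto)
  ultimately show ?thesis using assms(2) by (simp add: abs_le_iff algebra_simps)
qed

lemma integral_split:
  assumes "0 \<le> u" "u \<le> v"
  shows "integral {0..v} X - integral {0..u} X = integral {u..v} X"
  using Henstock_Kurzweil_Integration.integral_combine[OF assms X_integrable[of 0 v]] by simp

text \<open>Summand of a left-endpoint sum of \<open>X - \<sigma> * w\<close> against
  \<open>\<sigma> * w\<close>, minus the increment of the candidate primitive. The term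
  \<open>(X\<^sup>2 - \<sigma>\<^sup>2 * w\<^sup>2) / 2\<close> comes from integration by parts; the
  others collect X against the finite-variation part, namely drift and orders, the reflection term
  being 0.\<close>

definition quad_error :: "real \<Rightarrow> real \<Rightarrow> real" where
  "quad_error u v = (X u - \<sigma> * w u) * \<sigma> * (w v - w u) -
     ((((X v)\<^sup>2 - \<sigma>\<^sup>2 * (w v)\<^sup>2) / 2 + \<mu> * integral {0..v} X - (z\<^sup>2 - y\<^sup>2) / 2 * n v) -
      (((X u)\<^sup>2 - \<sigma>\<^sup>2 * (w u)\<^sup>2) / 2 + \<mu> * integral {0..u} X - (z\<^sup>2 - y\<^sup>2) / 2 * n u))"

text \<open>With \<open>G = X - \<sigma> w\<close> and \<open>q\<close> its increment: integration by parts for \<open>G\<^sup>2 / 2 + \<sigma> G w\<close>.\<close>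

lemma quad_error_eq:
  assumes "0 \<le> u" "u \<le> v"
  defines "q \<equiv> (L v - L u) - \<mu> * (v - u) + (z - y) * (n v - n u)"
  shows "quad_error u v = - (X v - q / 2) * q - \<mu> * integral {u..v} X + (z\<^sup>2 - y\<^sup>2) / 2 * (n v - n u)"
proof -
  have q: "q = (X v - \<sigma> * w v) - (X u - \<sigma> * w u)"
    unfolding q_def using X_eq[of u] X_eq[of v] assms by (simp add: algebra_simps)
  have "integral {0..v} X = integral {0..u} X + integral {u..v} X" using integral_split[OF assms(1,2)] by simp
  then show ?thesis unfolding quad_error_def q by (simp add: field_simps power2_eq_square)
qed

text \<open>Without an order three errors remain: the oscillation of \<open>X\<close> against time,
  the product \<open>X v * l\<close>, small because \<open>L\<close> grows only near 0, and the
  square of the increment \<open>q\<close>. Each is \<eta> times the growth of time plus local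
  time.\<close>

lemma quad_error_cell:
  assumes s: "0 \<le> s" and \<epsilon>: "0 < \<epsilon>"
  shows "\<exists>\<delta>>0. \<forall>u v. 0 \<le> u \<and> u \<le> v \<and> \<bar>u - s\<bar> < \<delta> \<and> \<bar>v - s\<bar> < \<delta> \<and> (\<forall>a. u \<le> a \<and> a \<le> v \<longrightarrow> n a = n u) \<longrightarrow>
     \<bar>quad_error u v\<bar> \<le> \<epsilon> * ((v + L v + n v) - (u + L u + n u))"
proof -
  \<comment> \<open>The summands 1, \<mu> and (\<mu>+1)^2 are the coefficients of the local time
    error, the time error and the quadratic error.\<close>
  define K where "K = 1 + \<mu> + (\<mu> + 1) * (\<mu> + 1)"
  have K: "K > 0" unfolding K_def using mu by (simp add: add_pos_pos)
  define \<eta> where "\<eta> = \<epsilon> / K"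
  have \<eta>: "\<eta> > 0" unfolding \<eta>_def using \<epsilon> K by simp
  obtain \<delta> where \<delta>: "\<delta> > 0" "\<And>u v. 0 \<le> u \<and> u \<le> v \<and> \<bar>u - s\<bar> < \<delta> \<and> \<bar>v - s\<bar> < \<delta> \<and> (\<forall>a. u \<le> a \<and> a \<le> v \<longrightarrow> n a = n u) \<Longrightarrow>
     v - u \<le> \<eta> \<and> L v - L u \<le> \<eta> \<and> (\<forall>a. u \<le> a \<and> a \<le> v \<longrightarrow> \<bar>X a - X v\<bar> \<le> \<eta>) \<and> (L v = L u \<or> X v \<le> \<eta>)"
    using cell_close[OF s \<eta>] by blast
  show ?thesis
  proof (intro exI[of _ \<delta>] conjI allI impI)
    fix u v
    assume uv: "0 \<le> u \<and> u \<le> v \<and> \<bar>u - s\<bar> < \<delta> \<and> \<bar>v - s\<bar> < \<delta> \<and> (\<forall>a. u \<le> a \<and> a \<le> v \<longrightarrow> n a = n u)"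
    then have u0: "0 \<le> u" and uv': "u \<le> v" and nuv: "n v = n u" by blast+
    note cl = \<delta>(2)[OF uv]
    define l where "l = L v - L u"
    define d where "d = v - u"
    have l: "0 \<le> l" "l \<le> \<eta>" and d: "0 \<le> d" "d \<le> \<eta>"
      using cl uv' L_le[OF u0 uv'] unfolding l_def d_def by auto
    have Xv: "0 \<le> X v" using X_nonneg u0 uv' by simp
    have int: "\<bar>X v * d - integral {u..v} X\<bar> \<le> \<eta> * d"
      unfolding d_def by (rule integral_close) (use cl u0 uv' in auto)
    define q where "q = l - \<mu> * d"
    have md: "0 \<le> \<mu> * d" using mu d by simp
    have md2: "\<mu> * d \<le> \<mu> * \<eta>" using mu d by (intro mult_left_mono) auto
    have qa: "\<bar>q\<bar> \<le> l + \<mu> * d" unfolding q_def using l md by linarith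
    have "quad_error u v = - (X v - q / 2) * q - \<mu> * integral {u..v} X"
      using quad_error_eq[OF u0 uv'] nuv by (simp add: q_def l_def d_def)
    also have "\<dots> = \<mu> * (X v * d - integral {u..v} X) - X v * l + q * q / 2"
      unfolding q_def by (simp add: field_simps)
    finally have eq: "quad_error u v = \<mu> * (X v * d - integral {u..v} X) - X v * l + q * q / 2" .
    have 1: "\<bar>\<mu> * (X v * d - integral {u..v} X)\<bar> \<le> \<mu> * (\<eta> * d)"
      unfolding abs_mult using mu int by (simp add: mult_left_mono)
    have 2: "0 \<le> X v * l" "X v * l \<le> \<eta> * l"
      using cl l Xv unfolding l_def by (auto intro: mult_right_mono)
    have A: "\<bar>q\<bar> \<le> (\<mu> + 1) * \<eta>" using qa l md2 by (simp add: algebra_simps)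
    have ml: "0 \<le> \<mu> * l" using mu l by simp
    have B: "\<bar>q\<bar> \<le> (\<mu> + 1) * (d + l)"
      unfolding distrib_left distrib_right using qa l d ml by linarith
    have "0 \<le> (\<mu> + 1) * \<eta>" using A by linarith
    with A B have "\<bar>q\<bar> * \<bar>q\<bar> \<le> ((\<mu> + 1) * \<eta>) * ((\<mu> + 1) * (d + l))"
      by (intro mult_mono) simp_all
    moreover have "0 \<le> q * q" "\<bar>q\<bar> * \<bar>q\<bar> = q * q" by simp_all
    ultimately have 3: "0 \<le> q * q / 2" "q * q / 2 \<le> ((\<mu> + 1) * \<eta>) * ((\<mu> + 1) * (d + l))"
      by linarith+
    have "\<bar>quad_error u v\<bar> \<le> \<mu> * (\<eta> * d) + \<eta> * l + ((\<mu> + 1) * \<eta>) * ((\<mu> + 1) * (d + l))"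
      unfolding eq using 1 2 3 by linarith
    moreover have "\<mu> * (\<eta> * d) \<le> \<mu> * (\<eta> * (d + l))" using mu \<eta> l by (intro mult_left_mono) auto
    moreover have "\<eta> * l \<le> \<eta> * (d + l)" using \<eta> d by (intro mult_left_mono) auto
    moreover have "\<mu> * (\<eta> * (d + l)) + \<eta> * (d + l) + ((\<mu> + 1) * \<eta>) * ((\<mu> + 1) * (d + l)) = (\<eta> * K) * (d + l)"
      unfolding K_def by (simp add: algebra_simps)
    ultimately have "\<bar>quad_error u v\<bar> \<le> (\<eta> * K) * (d + l)" by linarith
    moreover have "\<eta> * K = \<epsilon>" unfolding \<eta>_def using K by simp
    moreover have "d + l = (v + L v + n v) - (u + L u + n u)" unfolding d_def l_def using nuv by simp
    ultimately show "\<bar>quad_error u v\<bar> \<le> \<epsilon> * ((v + L v + n v) - (u + L u + n u))" by (simp only:)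
  qed (use \<delta> in auto)
qed

text \<open>The product \<open>(X v - q / 2) * q\<close> is a trapezoidal rule: near the order it is
  close to (z - (z-y)/2)(z-y) = (z^2 - y^2)/2, the weight given to \<open>n\<close>. As
  \<open>n\<close> grows by 1, an absolute error of \<epsilon> is enough.\<close>

lemma quad_error_jump:
  assumes s: "0 < s" "X s = z" and \<epsilon>: "0 < \<epsilon>"
  shows "\<exists>\<delta>>0. \<forall>u v. 0 \<le> u \<and> u < s \<and> s \<le> v \<and> \<bar>u - s\<bar> < \<delta> \<and> \<bar>v - s\<bar> < \<delta> \<and>
      (\<forall>a. u \<le> a \<and> a < s \<longrightarrow> n a = n s - 1) \<and> (\<forall>a. s \<le> a \<and> a \<le> v \<longrightarrow> n a = n s) \<longrightarrow>
     \<bar>quad_error u v\<bar> \<le> \<epsilon> * ((v + L v + n v) - (u + L u + n u))"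
proof -
  have s0: "0 \<le> s" using s by simp
  define K where "K = z + 2 * (z + 1) + \<mu> * (2 * (z + 1))"
  have z: "z > 0" using y yz by simp
  have K: "K > 0" unfolding K_def using mu z by (simp add: add_pos_pos)
  define \<eta> where "\<eta> = min 1 (\<epsilon> / K)"
  have \<eta>: "\<eta> > 0" "\<eta> \<le> 1" "\<eta> * K \<le> \<epsilon>"
    unfolding \<eta>_def using \<epsilon> K by (auto simp: min_def field_simps)
  \<comment> \<open>A bound for the cell length that makes both the length and its drift at most
    \<eta>/2.\<close>
  define \<eta>' where "\<eta>' = \<eta> / (2 * (\<mu> + 1))"
  have \<eta>': "\<eta>' > 0" "2 * \<eta>' \<le> \<eta>" "2 * (\<mu> * \<eta>') \<le> \<eta>"
    unfolding \<eta>'_def using \<eta> mu by (auto simp: field_simps)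
  obtain \<delta>1 where \<delta>1: "\<delta>1 > 0" "\<And>a. a \<ge> 0 \<Longrightarrow> \<bar>a - s\<bar> < \<delta>1 \<Longrightarrow> \<bar>c a - c s\<bar> < \<eta>"
    using continuous_on_atLeast_near[OF c_cont s0 \<eta>(1)] by blast
  have \<eta>4: "0 < \<eta> / 4" using \<eta> by simp
  obtain \<delta>2 where \<delta>2: "\<delta>2 > 0" "\<And>a. a \<ge> 0 \<Longrightarrow> \<bar>a - s\<bar> < \<delta>2 \<Longrightarrow> \<bar>L a - L s\<bar> < \<eta> / 4"
    using continuous_on_atLeast_near[OF L_cont s0 \<eta>4] by blast
  define \<delta> where "\<delta> = min (\<eta>' / 2) (min \<delta>1 \<delta>2)"
  show ?thesis
  proof (intro exI[of _ \<delta>] conjI allI impI)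
    show "0 < \<delta>" unfolding \<delta>_def using \<eta>' \<delta>1 \<delta>2 by auto
    fix u v
    assume uv: "0 \<le> u \<and> u < s \<and> s \<le> v \<and> \<bar>u - s\<bar> < \<delta> \<and> \<bar>v - s\<bar> < \<delta> \<and>
      (\<forall>a. u \<le> a \<and> a < s \<longrightarrow> n a = n s - 1) \<and> (\<forall>a. s \<le> a \<and> a \<le> v \<longrightarrow> n a = n s)"
    then have u: "0 \<le> u" "u < s" "\<bar>u - s\<bar> < \<delta>" and v: "s \<le> v" "\<bar>v - s\<bar> < \<delta>"
      and n1: "\<And>a. u \<le> a \<Longrightarrow> a < s \<Longrightarrow> n a = n s - 1" and n2: "\<And>a. s \<le> a \<Longrightarrow> a \<le> v \<Longrightarrow> n a = n s"
      by blast+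
    have uv': "u \<le> v" and v0: "0 \<le> v" using u v by auto
    have nu: "n u = n s - 1" and nv: "n v = n s" using n1[of u] n2[of v] u v by auto
    have near: "\<bar>c a - c s\<bar> < \<eta>" if "u \<le> a" "a \<le> v" for a
      by (rule \<delta>1(2)) (use that u v in \<open>auto simp: \<delta>_def\<close>)
    have cs: "c s + (z - y) * n s = z" using X_c[OF s0] s(2) by simp
    \<comment> \<open>Crude on purpose: values between 0 and z + 1 suffice, since the integral of
      \<open>X\<close> is taken over a short cell only.\<close>
    have Xa: "\<bar>X a - (z + 1)\<bar> \<le> 2 * (z + 1)" if a: "u \<le> a" "a \<le> v" for a
    proof -
      have a0: "0 \<le> a" using a u by simp
      have "X a \<le> z + 1"
      proof (cases "a < s")
        case True
        have "X a = c a + (z - y) * n s - (z - y)"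
          using X_c[OF a0] n1[OF a(1) True] by (simp add: algebra_simps)
        then show ?thesis using near[OF a] cs \<eta>(2) yz by linarith
      next
        case False
        then have "X a = c a + (z - y) * n s" using X_c[OF a0] n2[of a] a by simp
        then show ?thesis using near[OF a] cs \<eta>(2) by linarith
      qed
      then show ?thesis using X_nonneg[OF a0] z unfolding abs_le_iff distrib_left by simp
    qed
    define d where "d = v - u"
    have d: "0 \<le> d" "d \<le> \<eta>'" unfolding d_def using u v unfolding \<delta>_def by auto
    have int: "\<bar>(z + 1) * d - integral {u..v} X\<bar> \<le> 2 * (z + 1) * d"
      unfolding d_def by (rule integral_close[OF u(1) uv' Xa])
    have int0: "0 \<le> integral {u..v} X"
      by (rule integral_nonneg[OF X_integrable[OF u(1)]]) (use X_nonneg u in auto)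
    define I where "I = integral {u..v} X"
    have I: "0 \<le> I" "I \<le> 3 * (z + 1) * d" using int int0 unfolding I_def by linarith+
    define \<alpha> where "\<alpha> = X v - z"
    have "X v = c v + (z - y) * n s" using X_c[OF v0] nv by simp
    then have \<alpha>: "\<bar>\<alpha>\<bar> \<le> \<eta>" unfolding \<alpha>_def using near[of v] cs uv' by linarith
    define \<beta> where "\<beta> = (L v - L u) - \<mu> * d"
    have "\<mu> * d \<le> \<mu> * \<eta>'" using mu d by (intro mult_left_mono) auto
    moreover have "0 \<le> \<mu> * d" using mu d by simp
    moreover have "\<bar>L u - L s\<bar> < \<eta> / 4" "\<bar>L v - L s\<bar> < \<eta> / 4"
      using \<delta>2(2)[of u] \<delta>2(2)[of v] u v by (auto simp: \<delta>_def)
    ultimately have \<beta>: "\<bar>\<beta>\<bar> \<le> \<eta>" unfolding \<beta>_def using \<eta>' by linarith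
    have "quad_error u v = - (X v - (\<beta> + (z - y)) / 2) * (\<beta> + (z - y)) - \<mu> * I + (z\<^sup>2 - y\<^sup>2) / 2"
      using quad_error_eq[OF u(1) uv'] unfolding nu nv \<beta>_def d_def I_def by simp
    also have "\<dots> = - ((z + y) / 2 * \<beta>) - (\<alpha> - \<beta> / 2) * (\<beta> + (z - y)) - \<mu> * I"
      unfolding \<alpha>_def by (simp add: field_simps power2_eq_square)
    finally have eq: "quad_error u v = - ((z + y) / 2 * \<beta>) - (\<alpha> - \<beta> / 2) * (\<beta> + (z - y)) - \<mu> * I" .
    have 1: "\<bar>(z + y) / 2 * \<beta>\<bar> \<le> z * \<eta>"
      unfolding abs_mult using \<beta> y yz by (intro mult_mono) auto
    have "\<bar>\<alpha> - \<beta> / 2\<bar> \<le> 2 * \<eta>" using \<alpha> \<beta> by linarith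
    moreover have "\<bar>\<beta> + (z - y)\<bar> \<le> z + 1" using \<beta> \<eta>(2) y yz by linarith
    ultimately have 2: "\<bar>(\<alpha> - \<beta> / 2) * (\<beta> + (z - y))\<bar> \<le> 2 * \<eta> * (z + 1)"
      unfolding abs_mult using \<eta> by (intro mult_mono) auto
    have "3 * (z + 1) * d \<le> 3 * (z + 1) * (\<eta> / 2)"
      using d \<eta>' z by (intro mult_left_mono) auto
    then have "I \<le> 2 * (z + 1) * \<eta>" using I z \<eta> by (simp add: algebra_simps)
    then have "\<mu> * I \<le> \<mu> * (2 * (z + 1) * \<eta>)" "0 \<le> \<mu> * I"
      using mu I by (auto intro: mult_left_mono)
    then have "\<bar>quad_error u v\<bar> \<le> z * \<eta> + 2 * \<eta> * (z + 1) + \<mu> * (2 * (z + 1) * \<eta>)"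
      unfolding eq using 1 2 by linarith
    also have "\<dots> = \<eta> * K" unfolding K_def by (simp add: algebra_simps)
    also have "\<dots> \<le> \<epsilon>" by (rule \<eta>(3))
    also have "\<epsilon> = \<epsilon> * 1" by simp
    also have "\<epsilon> * 1 \<le> \<epsilon> * ((v + L v + n v) - (u + L u + n u))"
      using \<epsilon> uv' L_le[OF u(1) uv'] nu nv by (intro mult_left_mono) auto
    finally show "\<bar>quad_error u v\<bar> \<le> \<epsilon> * ((v + L v + n v) - (u + L u + n u))" .
  qed
qed

lemma quad_grid_sum:
  assumes t: "0 < t"
  shows "(\<lambda>k. \<Sum>i<Suc k. (X (t * real i / real (Suc k)) - \<sigma> * w (t * real i / real (Suc k))) * \<sigma> *
      (w (t * real (Suc i) / real (Suc k)) - w (t * real i / real (Suc k))))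
    \<longlonglongrightarrow> ((X t)\<^sup>2 - \<sigma>\<^sup>2 * (w t)\<^sup>2) / 2 + \<mu> * integral {0..t} X - (z\<^sup>2 - y\<^sup>2) / 2 * n t - X\<^sub>0\<^sup>2 / 2"
proof -
  define \<Phi> where "\<Phi> t = ((X t)\<^sup>2 - \<sigma>\<^sup>2 * (w t)\<^sup>2) / 2 + \<mu> * integral {0..t} X - (z\<^sup>2 - y\<^sup>2) / 2 * n t" for t
  \<comment> \<open>The clock of this change of variables: time, local time and number of
    orders.\<close>
  define V where "V t = t + L t + n t" for t
  have \<Phi>0: "\<Phi> 0 = X\<^sub>0\<^sup>2 / 2" unfolding \<Phi>_def using X_0 w_0 n_0 by simp
  have err: "quad_error u v = (X u - \<sigma> * w u) * \<sigma> * (w v - w u) - (\<Phi> v - \<Phi> u)" for u v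
    unfolding quad_error_def \<Phi>_def by simp
  have "(\<lambda>k. \<Sum>i<Suc k. (X (t * real i / real (Suc k)) - \<sigma> * w (t * real i / real (Suc k))) * \<sigma> *
      (w (t * real (Suc i) / real (Suc k)) - w (t * real i / real (Suc k)))) \<longlonglongrightarrow> \<Phi> t - \<Phi> 0"
  proof (rule grid_sum_tendsto[OF t, of V])
    show "V u \<le> V v" if "0 \<le> u" "u \<le> v" "v \<le> t" for u v
      unfolding V_def using that L_le[OF that(1,2)] n_le[OF that(1,2)] by simp
    fix s \<epsilon> :: real assume s: "0 \<le> s" "s \<le> t" and \<epsilon>: "0 < \<epsilon>"
    have "\<exists>\<delta>>0. \<forall>u v. 0 \<le> u \<and> u \<le> v \<and> \<bar>u - s\<bar> < \<delta> \<and> \<bar>v - s\<bar> < \<delta> \<longrightarrow>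
        \<bar>quad_error u v\<bar> \<le> \<epsilon> * (V v - V u)"
    proof (cases "\<exists>\<delta>>0. \<forall>t. 0 \<le> t \<and> s - \<delta> < t \<and> t < s \<longrightarrow> n t = n s")
      case True
      show ?thesis
        unfolding V_def
        by (rule local_property_by_state[where s = s and st = n and q = "n s", OF s(1)])
          (rule n_right[OF s(1)], rule True, rule quad_error_cell[OF s(1) \<epsilon>], erule notE, rule refl)
    next
      case False
      have "s \<noteq> 0"
      proof
        assume "s = 0"
        then have "\<exists>\<delta>>0. \<forall>t. 0 \<le> t \<and> s - \<delta> < t \<and> t < s \<longrightarrow> n t = n s"
          by (intro exI[of _ 1]) auto
        with False show False by (rule notE)
      qed
      then have "0 < s" using s by linarith
      from n_left[OF this, unfolded disj_imp] False
      have jump: "X s = z \<and> (\<exists>\<delta>>0. \<forall>t. 0 \<le> t \<and> s - \<delta> < t \<and> t < s \<longrightarrow> n t = n s - 1)"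
        by (rule mp)
      note left = conjunct2[OF jump]
      show ?thesis
        unfolding V_def
        by (rule local_property_by_state[where s = s and st = n and q = "n s - 1", OF s(1)])
          (rule n_right[OF s(1)], rule left, rule quad_error_cell[OF s(1) \<epsilon>],
            rule quad_error_jump[OF \<open>0 < s\<close> conjunct1[OF jump] \<epsilon>])
    qed
    then show "\<exists>\<delta>>0. \<forall>u v. 0 \<le> u \<and> u \<le> v \<and> v \<le> t \<and> \<bar>u - s\<bar> < \<delta> \<and> \<bar>v - s\<bar> < \<delta> \<longrightarrow>
        \<bar>(X u - \<sigma> * w u) * \<sigma> * (w v - w u) - (\<Phi> v - \<Phi> u)\<bar> \<le> \<epsilon> * (V v - V u)"
      unfolding err[symmetric] by blast
  qed
  then show ?thesis unfolding \<Phi>0 unfolding \<Phi>_def .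
qed

end


section \<open>Change of variables for the exponential of the inventory\<close>

text \<open>
  \<open>Mo\<close> is the mode of the delayed policy: 1 from the first hit of 0 until the next order, 0 otherwise.
\<close>

locale triggered_path = regulated_path +
  fixes Mo :: "real \<Rightarrow> real"
  assumes Mo_01: "\<And>t. 0 \<le> t \<Longrightarrow> Mo t = 0 \<or> Mo t = 1" and Mo_0: "Mo 0 = 0"
    and Mo_pos: "\<And>t. 0 \<le> t \<Longrightarrow> Mo t = 0 \<Longrightarrow> 0 < X t"
    and Mo_le: "\<And>t. 0 \<le> t \<Longrightarrow> Mo t = 1 \<Longrightarrow> X t \<le> y"
    and n_Mo_mono: "mono_on {0..} (\<lambda>t. n t + Mo t)"
    and Mo_right: "\<And>s. 0 \<le> s \<Longrightarrow> \<exists>\<delta>>0. \<forall>t. s \<le> t \<and> t < s + \<delta> \<longrightarrow> (n t, Mo t) = (n s, Mo s)"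
    and Mo_left: "\<And>s. 0 < s \<Longrightarrow>
      (\<exists>\<delta>>0. \<forall>t. 0 \<le> t \<and> s - \<delta> < t \<and> t < s \<longrightarrow> (n t, Mo t) = (n s, Mo s)) \<or>
      (X s = 0 \<and> Mo s = 1 \<and> (\<exists>\<delta>>0. \<forall>t. 0 \<le> t \<and> s - \<delta> < t \<and> t < s \<longrightarrow> (n t, Mo t) = (n s, 0))) \<or>
      (X s = z \<and> Mo s = 0 \<and> (\<exists>\<delta>>0. \<forall>t. 0 \<le> t \<and> s - \<delta> < t \<and> t < s \<longrightarrow> (n t, Mo t) = (n s - 1, 1)))"
begin

definition m :: real where "m = 2 * \<mu> / \<sigma>\<^sup>2"

lemma m_pos: "0 < m"
  unfolding m_def using mu sigma by simp

text \<open>The clock of the exponential change of variables. \<open>n + Mo\<close> rises by 1 when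
  the mode switches on and stays put at an order, where \<open>n\<close> rises instead; so
  \<open>V\<close> grows by at least 1 at every change of state. Time is absent because free motion
  produces no error.\<close>

definition V :: "real \<Rightarrow> real" where "V t = L t + n t + (n t + Mo t)"

text \<open>Increment of the exponential martingale, weighted by the mode, minus the increment of
  the candidate primitive: the switched function \<open>exp (m * X) - 1\<close>, corrected for
  reflection by \<open>m * L\<close> and for its drop at orders by
  \<open>(exp (m * y) - 1) * n\<close>.\<close>

definition exp_error :: "real \<Rightarrow> real \<Rightarrow> real" where
  "exp_error u v = Mo u * exp (m * X u) * (exp (m * (\<sigma> * (w v - w u) - \<mu> * (v - u))) - 1) -
     ((Mo v * (exp (m * X v) - 1) - m * L v + (exp (m * y) - 1) * n v) -
      (Mo u * (exp (m * X u) - 1) - m * L u + (exp (m * y) - 1) * n u))"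

text \<open>The multiplicative step is exact: \<open>exp (m * X u)\<close> times the exponential of
  the free increment is the exponential of \<open>m\<close> times \<open>X v\<close> with local time
  and orders taken off. Hence \<open>w\<close> and the drift disappear from the error.\<close>

lemma exp_error_eq:
  assumes "0 \<le> u" "u \<le> v"
  shows "exp_error u v = Mo u * exp (m * (X v - (L v - L u) - (z - y) * (n v - n u))) - Mo u
    - Mo v * (exp (m * X v) - 1) + m * (L v - L u) - (exp (m * y) - 1) * (n v - n u)"
proof -
  have "X v - (L v - L u) - (z - y) * (n v - n u) = X u + (\<sigma> * (w v - w u) - \<mu> * (v - u))"
    using X_eq[of u] X_eq[of v] assms by (simp add: algebra_simps)
  then have "m * (X v - (L v - L u) - (z - y) * (n v - n u)) = m * X u + m * (\<sigma> * (w v - w u) - \<mu> * (v - u))"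
    by (simp only: distrib_left)
  then have "exp (m * (X v - (L v - L u) - (z - y) * (n v - n u))) = exp (m * X u) * exp (m * (\<sigma> * (w v - w u) - \<mu> * (v - u)))"
    by (simp only: exp_add)
  then show ?thesis unfolding exp_error_def by (simp add: algebra_simps)
qed

text \<open>Chooses the closeness by solving for \<eta>. The factor
  \<open>m + 3 + exp (m * y)\<close> dominates all coefficients met below: \<open>m\<close> inside a
  cell, 1 at a switch and \<open>1 + exp (m * y)\<close> at an order.\<close>

lemma scale_ex:
  assumes \<epsilon>: "0 < \<epsilon>"
  obtains \<eta> where "0 < \<eta>" "(exp (2 * m * \<eta>) - 1) * (m + 3 + exp (m * y)) = \<epsilon>"
proof -
  define K where "K = m + 3 + exp (m * y)"
  have K: "K > 0" unfolding K_def using m_pos by (simp add: add_pos_pos)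
  define \<eta> where "\<eta> = ln (1 + \<epsilon> / K) / (2 * m)"
  have pos: "0 < \<epsilon> / K" using K \<epsilon> by simp
  then have "0 < \<eta>" unfolding \<eta>_def using m_pos by (simp add: ln_gt_zero)
  moreover have "exp (2 * m * \<eta>) = 1 + \<epsilon> / K" unfolding \<eta>_def using m_pos pos by simp
  then have "(exp (2 * m * \<eta>) - 1) * K = \<epsilon>" using K by simp
  ultimately show thesis using that unfolding K_def by blast
qed

text \<open>To first order the expression is \<open>(1 - E) * x\<close>. Here \<open>x\<close>
  stands for \<open>m\<close> times the growth of local time and \<open>E\<close> for
  \<open>exp (m * X v)\<close>, close to 1 as reflection occurs near 0. The two sides use exp(-x)
  \<ge> 1 - x and exp(-x) \<le> 1 - x + x^2.\<close>

lemma exp_cell_bound: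
  fixes x E q :: real
  assumes "0 \<le> x" "x \<le> q" "1 \<le> E" "E \<le> exp q"
  shows "\<bar>E * (exp (- x) - 1) + x\<bar> \<le> (exp (2 * q) - 1) * x"
proof -
  have q: "0 \<le> q" using assms by simp
  have eq: "1 \<le> exp q" using q by simp
  have e2: "exp (2 * q) = exp q * exp q" by (simp add: exp_add[symmetric])
  have le: "exp q \<le> exp q * exp q" using eq by simp
  have "1 - x \<le> exp (- x)" using exp_ge_add_one_self[of "- x"] by simp
  then have "E * (- x) \<le> E * (exp (- x) - 1)" using assms by (intro mult_left_mono) auto
  moreover have "(E - 1) * x \<le> (exp (2 * q) - 1) * x"
  proof (rule mult_right_mono)
    show "E - 1 \<le> exp (2 * q) - 1" unfolding e2 using assms(4) le by linarith
  qed (use assms in simp)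
  ultimately have lower: "- ((exp (2 * q) - 1) * x) \<le> E * (exp (- x) - 1) + x"
    by (simp add: algebra_simps)
  have "exp (- x) \<le> 1 - x + x * x"
  proof -
    have "exp (- x) = 1 / exp x" by (simp add: exp_minus field_simps)
    also have "\<dots> \<le> 1 / (1 + x)" using assms exp_ge_add_one_self[of x] by (intro divide_left_mono) auto
    also have "\<dots> \<le> 1 - x + x * x"
    proof -
      have "1 \<le> (1 - x + x * x) * (1 + x)" using assms by (simp add: algebra_simps)
      then show ?thesis using assms by (simp add: pos_divide_le_eq)
    qed
    finally show ?thesis .
  qed
  then have "E * (exp (- x) - 1) \<le> E * (- x + x * x)" using assms by (intro mult_left_mono) auto
  moreover have "1 * x \<le> E * x" using assms by (intro mult_right_mono) auto
  ultimately have "E * (exp (- x) - 1) + x \<le> E * (x * x)" by (simp add: algebra_simps)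
  also have "\<dots> = (E * x) * x" by simp
  also have "\<dots> \<le> (exp (2 * q) - 1) * x"
  proof (rule mult_right_mono)
    have "E * x \<le> exp q * (exp q - 1)"
    proof (rule mult_mono)
      show "x \<le> exp q - 1" using assms(2) exp_ge_add_one_self[of q] by linarith
    qed (use assms in auto)
    also have "\<dots> \<le> exp (2 * q) - 1" unfolding e2 using eq by (simp add: algebra_simps)
    finally show "E * x \<le> exp (2 * q) - 1" .
  qed (use assms in simp)
  finally show ?thesis using lower by (simp add: abs_le_iff)
qed

text \<open>With constant state and constant \<open>L\<close> the error is exactly 0. In mode 0 the
  path is positive, so \<open>L\<close> is constant. There remains mode 1 with growing
  \<open>L\<close>, where \<open>X v\<close> is close to 0.\<close>

lemma exp_error_cell:
  assumes s: "0 \<le> s" and \<epsilon>: "0 < \<epsilon>"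
  shows "\<exists>\<delta>>0. \<forall>u v. 0 \<le> u \<and> u \<le> v \<and> \<bar>u - s\<bar> < \<delta> \<and> \<bar>v - s\<bar> < \<delta> \<and>
      (\<forall>a. u \<le> a \<and> a \<le> v \<longrightarrow> (n a, Mo a) = (n u, Mo u)) \<longrightarrow>
     \<bar>exp_error u v\<bar> \<le> \<epsilon> * (V v - V u)"
proof -
  obtain \<eta> where \<eta>: "0 < \<eta>" "(exp (2 * m * \<eta>) - 1) * (m + 3 + exp (m * y)) = \<epsilon>" using scale_ex[OF \<epsilon>] .
  obtain \<delta> where \<delta>: "\<delta> > 0" and close: "\<forall>u v. 0 \<le> u \<and> u \<le> v \<and> \<bar>u - s\<bar> < \<delta> \<and> \<bar>v - s\<bar> < \<delta> \<and> (\<forall>a. u \<le> a \<and> a \<le> v \<longrightarrow> n a = n u) \<longrightarrow>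
     v - u \<le> \<eta> \<and> L v - L u \<le> \<eta> \<and> (\<forall>a. u \<le> a \<and> a \<le> v \<longrightarrow> \<bar>X a - X v\<bar> \<le> \<eta>) \<and> (L v = L u \<or> X v \<le> \<eta>)"
    using cell_close[OF s \<eta>(1)] by (elim exE conjE) (rule that)
  have bound: "\<bar>exp_error u v\<bar> \<le> \<epsilon> * (V v - V u)"
    if uv: "0 \<le> u" "u \<le> v" and near: "\<bar>u - s\<bar> < \<delta>" "\<bar>v - s\<bar> < \<delta>"
      and st: "\<And>a. u \<le> a \<Longrightarrow> a \<le> v \<Longrightarrow> n a = n u \<and> Mo a = Mo u" for u v
  proof -
    have nn: "n v = n u" "Mo v = Mo u" using st[of v] uv by auto
    have V: "V v - V u = L v - L u" unfolding V_def using nn by simp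
    have l0: "0 \<le> L v - L u" using L_le[OF uv] by simp
    have prem: "0 \<le> u \<and> u \<le> v \<and> \<bar>u - s\<bar> < \<delta> \<and> \<bar>v - s\<bar> < \<delta> \<and> (\<forall>a. u \<le> a \<and> a \<le> v \<longrightarrow> n a = n u)"
      using uv near by (intro conjI allI impI) (auto dest: st)
    have cl: "L v - L u \<le> \<eta>" "L v = L u \<or> X v \<le> \<eta>"
      using close[THEN spec, THEN spec, THEN mp, OF prem] by auto
    show ?thesis
    proof (cases "L v = L u")
      case True
      then have "exp_error u v = 0" using exp_error_eq[OF uv] nn by (simp add: algebra_simps)
      then show ?thesis using V True by simp
    next
      case False
      have "Mo u \<noteq> 0"
      proof
        assume "Mo u = 0"
        then have "0 < X a" if "u \<le> a" "a \<le> v" for a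
          using Mo_pos[of a] st[OF that] that uv by simp
        then show False using L_flat[OF uv] False by simp
      qed
      then have Mo: "Mo u = 1" using Mo_01 uv by blast
      define x where "x = m * (L v - L u)"
      have x: "0 \<le> x" "x \<le> m * \<eta>" unfolding x_def using l0 cl m_pos by simp_all
      have Xv: "0 \<le> X v" "X v \<le> \<eta>" using X_nonneg[of v] uv cl False by auto
      have "exp_error u v = exp (m * X v - x) - 1 - (exp (m * X v) - 1) + x"
        using exp_error_eq[OF uv] nn Mo by (simp add: x_def algebra_simps)
      also have "\<dots> = exp (m * X v) * (exp (- x) - 1) + x"
        unfolding diff_conv_add_uminus[of "m * X v" x] exp_add by (simp add: algebra_simps)
      finally have "\<bar>exp_error u v\<bar> \<le> (exp (2 * (m * \<eta>)) - 1) * x"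
        using exp_cell_bound[OF x, of "exp (m * X v)"] Xv m_pos by simp
      also have "\<dots> = (exp (2 * m * \<eta>) - 1) * m * (L v - L u)" unfolding x_def by (simp add: mult.assoc)
      also have "\<dots> \<le> (exp (2 * m * \<eta>) - 1) * (m + 3 + exp (m * y)) * (L v - L u)"
        using m_pos \<eta>(1) l0 by (intro mult_right_mono mult_left_mono) (simp_all add: add_nonneg_nonneg)
      finally show ?thesis unfolding V \<eta>(2) .
    qed
  qed
  show ?thesis
    using \<delta> by (intro exI[of _ \<delta>] conjI allI impI; (elim conjE)?) (auto intro!: bound)
qed

text \<open>Two changes of state. At a hit of 0 the function \<open>exp (m * X) - 1\<close> is
  switched on while it vanishes. At an order it is switched off near the value
  \<open>exp (m * y) - 1\<close>, which the term in \<open>n\<close> gives back.\<close>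

lemma exp_error_jump:
  assumes s: "0 < s" and \<epsilon>: "0 < \<epsilon>"
    and q: "(X s = 0 \<and> Mo s = 1 \<and> q = (n s, 0)) \<or> (X s = z \<and> Mo s = 0 \<and> q = (n s - 1, 1))"
  shows "\<exists>\<delta>>0. \<forall>u v. 0 \<le> u \<and> u < s \<and> s \<le> v \<and> \<bar>u - s\<bar> < \<delta> \<and> \<bar>v - s\<bar> < \<delta> \<and>
      (\<forall>a. u \<le> a \<and> a < s \<longrightarrow> (n a, Mo a) = q) \<and> (\<forall>a. s \<le> a \<and> a \<le> v \<longrightarrow> (n a, Mo a) = (n s, Mo s)) \<longrightarrow>
     \<bar>exp_error u v\<bar> \<le> \<epsilon> * (V v - V u)"
proof -
  obtain \<eta> where \<eta>: "0 < \<eta>" "(exp (2 * m * \<eta>) - 1) * (m + 3 + exp (m * y)) = \<epsilon>" using scale_ex[OF \<epsilon>] .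
  define r where "r = exp (2 * m * \<eta>) - 1"
  have r: "0 < r" unfolding r_def using \<eta>(1) m_pos by simp
  have mr: "2 * (m * \<eta>) \<le> r" unfolding r_def using exp_ge_add_one_self[of "2 * m * \<eta>"] by linarith
  have s0: "0 \<le> s" using s by simp
  obtain \<delta>1 where \<delta>1: "\<delta>1 > 0" "\<And>a. a \<ge> 0 \<Longrightarrow> \<bar>a - s\<bar> < \<delta>1 \<Longrightarrow> \<bar>c a - c s\<bar> < \<eta>"
    using continuous_on_atLeast_near[OF c_cont s0 \<eta>(1)] by blast
  have \<eta>2: "0 < \<eta> / 2" using \<eta> by simp
  obtain \<delta>2 where \<delta>2: "\<delta>2 > 0" "\<And>a. a \<ge> 0 \<Longrightarrow> \<bar>a - s\<bar> < \<delta>2 \<Longrightarrow> \<bar>L a - L s\<bar> < \<eta> / 2"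
    using continuous_on_atLeast_near[OF L_cont s0 \<eta>2] by blast
  have bound: "\<bar>exp_error u v\<bar> \<le> \<epsilon> * (V v - V u)"
    if u: "0 \<le> u" "u < s" and v: "s \<le> v" and near: "\<bar>u - s\<bar> < min \<delta>1 \<delta>2" "\<bar>v - s\<bar> < min \<delta>1 \<delta>2"
      and qu: "(n u, Mo u) = q" and qv: "(n v, Mo v) = (n s, Mo s)" for u v
  proof -
    have uv: "u \<le> v" and v0: "0 \<le> v" using u v by auto
    define l where "l = L v - L u"
    have "\<bar>L u - L s\<bar> < \<eta> / 2" "\<bar>L v - L s\<bar> < \<eta> / 2"
      using \<delta>2(2)[of u] \<delta>2(2)[of v] u v0 near by auto
    then have l: "0 \<le> l" "l \<le> \<eta>" unfolding l_def using L_le[OF u(1) uv] by linarith+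
    then have ml: "0 \<le> m * l" "m * l \<le> m * \<eta>" using m_pos by simp_all
    have "X v - X s = c v - c s" using X_c[OF v0] X_c[OF s0] qv by simp
    then have Xv: "\<bar>X v - X s\<bar> \<le> \<eta>" using \<delta>1(2)[of v] v0 near by simp
    have small: "\<bar>exp_error u v\<bar> \<le> r * (m + 3 + exp (m * y)) \<and> 1 \<le> V v - V u"
      using q
    proof
      assume A: "X s = 0 \<and> Mo s = 1 \<and> q = (n s, 0)"
      have eq: "exp_error u v = - (exp (m * X v) - 1) + m * l"
        using exp_error_eq[OF u(1) uv] A qu qv by (simp add: l_def)
      have "m * X v \<le> 2 * m * \<eta>" "0 \<le> m * X v"
        using Xv A m_pos \<eta>(1) X_nonneg[OF v0] by simp_all
      then have "0 \<le> exp (m * X v) - 1" "exp (m * X v) - 1 \<le> r" unfolding r_def by simp_all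
      then have "\<bar>exp_error u v\<bar> \<le> r * 1" unfolding eq using ml mr r by linarith
      also have "\<dots> \<le> r * (m + 3 + exp (m * y))"
        using r m_pos by (intro mult_left_mono) (simp_all add: add_nonneg_nonneg less_imp_le)
      finally show ?thesis using l A qu qv unfolding V_def l_def by auto
    next
      assume A: "X s = z \<and> Mo s = 0 \<and> q = (n s - 1, 1)"
      define p where "p = X v - l - (z - y) - y"
      have eq: "exp_error u v = exp (m * y) * (exp (m * p) - 1) + m * l"
      proof -
        have "exp_error u v = exp (m * (X v - l - (z - y))) - 1 + m * l - (exp (m * y) - 1)"
          using exp_error_eq[OF u(1) uv] A qu qv by (simp add: l_def)
        also have "m * (X v - l - (z - y)) = m * y + m * p" unfolding p_def by (simp add: algebra_simps)
        finally show ?thesis unfolding exp_add by (simp add: algebra_simps)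
      qed
      have "\<bar>p\<bar> \<le> 2 * \<eta>" unfolding p_def using Xv l A by (simp add: abs_le_iff)
      then have mp: "\<bar>m * p\<bar> \<le> 2 * m * \<eta>" unfolding abs_mult using m_pos by simp
      have "\<bar>exp (m * p) - 1\<bar> \<le> r"
      proof -
        have "exp (m * p) \<le> exp (2 * m * \<eta>)" using mp by simp
        moreover have "- r \<le> exp (m * p) - 1"
        proof -
          have "- (2 * m * \<eta>) \<le> m * p" using mp by (simp add: abs_le_iff)
          then have "exp (- (2 * m * \<eta>)) \<le> exp (m * p)" by simp
          moreover have "2 \<le> exp (2 * m * \<eta>) + exp (- (2 * m * \<eta>))"
            using exp_ge_add_one_self[of "2 * m * \<eta>"] exp_ge_add_one_self[of "- (2 * m * \<eta>)"] by linarith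
          ultimately show ?thesis unfolding r_def by linarith
        qed
        ultimately show ?thesis unfolding r_def by (simp add: abs_le_iff)
      qed
      then have "\<bar>exp (m * y) * (exp (m * p) - 1)\<bar> \<le> exp (m * y) * r" unfolding abs_mult by simp
      then have "\<bar>exp_error u v\<bar> \<le> exp (m * y) * r + r" unfolding eq using ml mr r by linarith
      also have "\<dots> = r * (1 + exp (m * y))" by (simp add: algebra_simps)
      also have "\<dots> \<le> r * (m + 3 + exp (m * y))"
        using r m_pos by (intro mult_left_mono) auto
      finally show ?thesis using l A qu qv unfolding V_def l_def by auto
    qed
    then have "\<bar>exp_error u v\<bar> \<le> \<epsilon> * 1" using \<eta>(2) unfolding r_def by simp
    also have "\<dots> \<le> \<epsilon> * (V v - V u)" using small \<epsilon> by (intro mult_left_mono) auto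
    finally show ?thesis .
  qed
  have "0 < min \<delta>1 \<delta>2" using \<delta>1 \<delta>2 by simp
  moreover have "\<bar>exp_error u v\<bar> \<le> \<epsilon> * (V v - V u)"
    if "0 \<le> u \<and> u < s \<and> s \<le> v \<and> \<bar>u - s\<bar> < min \<delta>1 \<delta>2 \<and> \<bar>v - s\<bar> < min \<delta>1 \<delta>2 \<and>
      (\<forall>a. u \<le> a \<and> a < s \<longrightarrow> (n a, Mo a) = q) \<and> (\<forall>a. s \<le> a \<and> a \<le> v \<longrightarrow> (n a, Mo a) = (n s, Mo s))" for u v
  proof (rule bound)
    show "(n u, Mo u) = q" "(n v, Mo v) = (n s, Mo s)" using that by (meson order_refl)+
  qed (use that in blast)+
  ultimately show ?thesis by blast
qed

lemma exp_grid_sum: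
  assumes t: "0 < t"
  shows "(\<lambda>k. \<Sum>i<Suc k. Mo (t * real i / real (Suc k)) * exp (m * X (t * real i / real (Suc k))) *
      (exp (m * (\<sigma> * (w (t * real (Suc i) / real (Suc k)) - w (t * real i / real (Suc k))) -
         \<mu> * (t * real (Suc i) / real (Suc k) - t * real i / real (Suc k)))) - 1))
    \<longlonglongrightarrow> Mo t * (exp (m * X t) - 1) - m * L t + (exp (m * y) - 1) * n t"
proof -
  define \<Psi> where "\<Psi> t = Mo t * (exp (m * X t) - 1) - m * L t + (exp (m * y) - 1) * n t" for t
  have \<Psi>0: "\<Psi> 0 = 0" unfolding \<Psi>_def using Mo_0 L_0 n_0 by simp
  have err: "exp_error u v = Mo u * exp (m * X u) * (exp (m * (\<sigma> * (w v - w u) - \<mu> * (v - u))) - 1) - (\<Psi> v - \<Psi> u)" for u v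
    unfolding exp_error_def \<Psi>_def by simp
  have "(\<lambda>k. \<Sum>i<Suc k. Mo (t * real i / real (Suc k)) * exp (m * X (t * real i / real (Suc k))) *
      (exp (m * (\<sigma> * (w (t * real (Suc i) / real (Suc k)) - w (t * real i / real (Suc k))) -
         \<mu> * (t * real (Suc i) / real (Suc k) - t * real i / real (Suc k)))) - 1)) \<longlonglongrightarrow> \<Psi> t - \<Psi> 0"
  proof (rule grid_sum_tendsto[OF t, of V])
    show "V u \<le> V v" if "0 \<le> u" "u \<le> v" "v \<le> t" for u v
    proof -
      have "n u + Mo u \<le> n v + Mo v"
        using n_Mo_mono that by (auto simp: mono_on_def)
      then show ?thesis unfolding V_def using L_le[OF that(1,2)] n_le[OF that(1,2)] by linarith
    qed
    fix s \<epsilon> :: real assume s: "0 \<le> s" "s \<le> t" and \<epsilon>: "0 < \<epsilon>"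
    \<comment> \<open>\<open>q\<close> is the state just before \<open>s\<close>; at
      \<open>s = 0\<close> nothing is required of it. If it differs from the state at
      \<open>s\<close>, then \<open>s\<close> is a switch or an order.\<close>
    have "\<exists>q. (0 < s \<longrightarrow> (\<exists>\<delta>>0. \<forall>a. 0 \<le> a \<and> s - \<delta> < a \<and> a < s \<longrightarrow> (n a, Mo a) = q)) \<and>
        (0 < s \<longrightarrow> q \<noteq> (n s, Mo s) \<longrightarrow>
          ((X s = 0 \<and> Mo s = 1 \<and> q = (n s, 0)) \<or> (X s = z \<and> Mo s = 0 \<and> q = (n s - 1, 1))))"
    proof (cases "0 < s")
      case True
      from Mo_left[OF this] show ?thesis
      proof (elim disjE conjE)
        assume "\<exists>\<delta>>0. \<forall>t. 0 \<le> t \<and> s - \<delta> < t \<and> t < s \<longrightarrow> (n t, Mo t) = (n s, Mo s)"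
        then show ?thesis by (intro exI[of _ "(n s, Mo s)"] conjI impI) (assumption, simp)
      next
        assume *: "X s = 0" "Mo s = 1" "\<exists>\<delta>>0. \<forall>t. 0 \<le> t \<and> s - \<delta> < t \<and> t < s \<longrightarrow> (n t, Mo t) = (n s, 0)"
        show ?thesis by (intro exI[of _ "(n s, 0)"] conjI impI) (rule *(3), simp add: *)
      next
        assume *: "X s = z" "Mo s = 0" "\<exists>\<delta>>0. \<forall>t. 0 \<le> t \<and> s - \<delta> < t \<and> t < s \<longrightarrow> (n t, Mo t) = (n s - 1, 1)"
        show ?thesis by (intro exI[of _ "(n s - 1, 1)"] conjI impI) (rule *(3), simp add: *)
      qed
    next
      case False
      then show ?thesis by (intro exI conjI impI) (erule (1) notE)+
    qed
    then obtain q where left0: "0 < s \<longrightarrow> (\<exists>\<delta>>0. \<forall>a. 0 \<le> a \<and> s - \<delta> < a \<and> a < s \<longrightarrow> (n a, Mo a) = q)"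
      and q0: "0 < s \<longrightarrow> q \<noteq> (n s, Mo s) \<longrightarrow>
          (X s = 0 \<and> Mo s = 1 \<and> q = (n s, 0)) \<or> (X s = z \<and> Mo s = 0 \<and> q = (n s - 1, 1))"
      by (elim exE conjE) (rule that)
    note left = left0[THEN mp] and q = q0[THEN mp, THEN mp]
    have "\<exists>\<delta>>0. \<forall>u v. 0 \<le> u \<and> u \<le> v \<and> \<bar>u - s\<bar> < \<delta> \<and> \<bar>v - s\<bar> < \<delta> \<longrightarrow>
        \<bar>exp_error u v\<bar> \<le> \<epsilon> * (V v - V u)"
    proof (rule local_property_by_state[where s = s and st = "\<lambda>a. (n a, Mo a)" and q = q])
      show "\<exists>\<delta>>0. \<forall>u v. 0 \<le> u \<and> u < s \<and> s \<le> v \<and> \<bar>u - s\<bar> < \<delta> \<and> \<bar>v - s\<bar> < \<delta> \<and>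
          (\<forall>a. u \<le> a \<and> a < s \<longrightarrow> (n a, Mo a) = q) \<and> (\<forall>a. s \<le> a \<and> a \<le> v \<longrightarrow> (n a, Mo a) = (n s, Mo s)) \<longrightarrow>
          \<bar>exp_error u v\<bar> \<le> \<epsilon> * (V v - V u)" if "0 < s" "q \<noteq> (n s, Mo s)"
        by (rule exp_error_jump[OF that(1) \<epsilon> q[OF that]])
    qed (rule s(1) Mo_right[OF s(1)] exp_error_cell[OF s(1) \<epsilon>] left, assumption?)+
    then show "\<exists>\<delta>>0. \<forall>u v. 0 \<le> u \<and> u \<le> v \<and> v \<le> t \<and> \<bar>u - s\<bar> < \<delta> \<and> \<bar>v - s\<bar> < \<delta> \<longrightarrow>
        \<bar>Mo u * exp (m * X u) * (exp (m * (\<sigma> * (w v - w u) - \<mu> * (v - u))) - 1) - (\<Psi> v - \<Psi> u)\<bar> \<le> \<epsilon> * (V v - V u)"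
      unfolding err[symmetric] by (elim exE conjE) (rule exI, rule conjI, assumption, intro allI impI, elim allE, erule mp, simp)
  qed
  then show ?thesis unfolding \<Psi>0 unfolding \<Psi>_def by simp
qed

end


section \<open>Paths controlled by an ordering policy\<close>

text \<open>\<open>pre_level\<close> for a single path, so that the locales on paths mention no
  sample point.\<close>

definition left_level :: "real \<Rightarrow> (real \<Rightarrow> real) \<Rightarrow> real \<Rightarrow> real" where
  "left_level x\<^sub>0 f t = (if t \<le> 0 then x\<^sub>0 else Lim (at_left t) f)"

lemma pre_level_eq_left_level: "pre_level x\<^sub>0 X t \<omega> = left_level x\<^sub>0 (\<lambda>s. X s \<omega>) t"
  by (simp add: pre_level_def left_level_def)

lemma ereal_less_right:
  assumes "ereal s < e"
  obtains \<delta> :: real where "0 < \<delta>" "\<And>t. t < s + \<delta> \<Longrightarrow> ereal t < e"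
proof (cases e)
  case (real r)
  then show thesis using assms by (intro that[of "r - s"]) auto
next
  case PInf
  then show thesis by (intro that[of 1]) auto
qed (use assms in simp)

lemma ereal_less_left:
  assumes "e < ereal s"
  obtains \<delta> :: real where "0 < \<delta>" "\<And>t. s - \<delta> < t \<Longrightarrow> e < ereal t"
proof (cases e)
  case (real r)
  then show thesis using assms by (intro that[of "s - r"]) auto
next
  case MInf
  then show thesis by (intro that[of 1]) auto
qed (use assms in simp)

text \<open>An infimum of times is missed only when times decrease to it; a gap to its right
  excludes this.\<close>

lemma ereal_Inf_mem:
  fixes P :: "real \<Rightarrow> bool"
  assumes Inf: "Inf {ereal t | t. P t} = ereal s" and \<delta>: "0 < \<delta>"
    and no: "\<And>t. s < t \<Longrightarrow> t < s + \<delta> \<Longrightarrow> \<not> P t"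
  shows "P s"
proof (rule ccontr)
  assume "\<not> P s"
  have "ereal (s + \<delta>) \<le> Inf {ereal t | t. P t}"
  proof (rule Inf_greatest, safe)
    fix t assume t: "P t"
    then have "Inf {ereal t | t. P t} \<le> ereal t" by (intro Inf_lower) auto
    then have "s \<le> t" unfolding Inf by simp
    moreover have "t \<noteq> s" using t \<open>\<not> P s\<close> by auto
    ultimately show "ereal (s + \<delta>) \<le> ereal t" using no[of t] t by fastforce
  qed
  then show False unfolding Inf using \<delta> by simp
qed

lemma ereal_Inf_not_before:
  fixes P :: "real \<Rightarrow> bool"
  shows "ereal t < Inf {ereal t | t. P t} \<Longrightarrow> \<not> P t"
  by (metis (mono_tags, lifting) Inf_lower leD mem_Collect_eq)

text \<open>What both policies share at one sample point. Order times are only weakly increasing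
  here: simultaneous and accumulating orders are still possible, and an order at time 0 is
  allowed.\<close>

locale ordered_path =
  fixes \<mu> \<sigma> x\<^sub>0 y z :: real and w X L :: "real \<Rightarrow> real" and \<tau> :: "nat \<Rightarrow> ereal" and Y :: "nat \<Rightarrow> real"
  assumes mu: "0 < \<mu>" and sigma: "0 < \<sigma>" and x0: "0 < x\<^sub>0" and y: "0 \<le> y" and yz: "y < z"
    and w_cont: "continuous_on {0..} w" and w_0: "w 0 = 0"
    and sums: "\<And>t. 0 \<le> t \<Longrightarrow> (\<lambda>k. if \<tau> (Suc k) \<le> ereal t then Y (Suc k) else 0)
      sums (X t - (x\<^sub>0 - \<mu> * t + \<sigma> * w t + L t))"
    and X_nonneg: "\<And>t. 0 \<le> t \<Longrightarrow> 0 \<le> X t"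
    and L_0: "L 0 = 0" and L_cont: "continuous_on {0..} L" and L_mono: "mono_on {0..} L"
    and L_flat: "\<And>s t. 0 \<le> s \<Longrightarrow> s \<le> t \<Longrightarrow> (\<And>u. s \<le> u \<Longrightarrow> u \<le> t \<Longrightarrow> 0 < X u) \<Longrightarrow> L t = L s"
    and \<tau>_0: "\<tau> 0 = 0" and \<tau>_Suc: "\<And>k. \<tau> k \<le> \<tau> (Suc k)"
    and Y_nonneg: "\<And>k. 0 \<le> Y (Suc k)"
    and Y_eq: "\<And>k. \<tau> (Suc k) < \<infinity> \<Longrightarrow> Y (Suc k) = z - left_level x\<^sub>0 X (real_of_ereal (\<tau> (Suc k)))"
begin

definition c :: "real \<Rightarrow> real" where "c t = x\<^sub>0 - \<mu> * t + \<sigma> * w t + L t"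

definition S :: "nat \<Rightarrow> real" where "S k = (\<Sum>i<k. Y (Suc i))"

lemma c_0: "c 0 = x\<^sub>0"
  unfolding c_def using w_0 L_0 by simp

lemma c_cont: "continuous_on {0..} c"
  unfolding c_def using w_cont L_cont by (intro continuous_intros)

lemma \<tau>_mono: "j \<le> k \<Longrightarrow> \<tau> j \<le> \<tau> k"
  using \<tau>_Suc by (rule lift_Suc_mono_le)

lemma \<tau>_nonneg: "0 \<le> \<tau> k"
  using \<tau>_mono[of 0 k] \<tau>_0 by simp

lemma X_between:
  assumes t: "0 \<le> t" and k: "\<tau> k \<le> ereal t" "ereal t < \<tau> (Suc k)"
  shows "X t = c t + S k"
proof -
  have eq: "(if \<tau> (Suc i) \<le> ereal t then Y (Suc i) else 0) = (if i < k then Y (Suc i) else 0)" for i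
  proof (cases "i < k")
    case True
    then have "\<tau> (Suc i) \<le> ereal t" using \<tau>_mono[of "Suc i" k] k by auto
    then show ?thesis using True by simp
  next
    case False
    then have "\<not> \<tau> (Suc i) \<le> ereal t" using \<tau>_mono[of "Suc k" "Suc i"] k by auto
    then show ?thesis using False by simp
  qed
  have "(\<lambda>i. if i < k then Y (Suc i) else 0) sums S k"
    unfolding S_def using sums_If_finite_set[of "{..<k}" "\<lambda>i. Y (Suc i)"] by simp
  then have "S k = X t - (x\<^sub>0 - \<mu> * t + \<sigma> * w t + L t)"
    using sums[OF t] unfolding eq by (rule sums_unique2)
  then show ?thesis unfolding c_def by simp
qed

lemma X_beyond:
  assumes "0 \<le> t" "\<And>k. \<tau> k \<le> ereal t"
  shows "(\<lambda>i. Y (Suc i)) sums (X t - c t)"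
  using sums[OF assms(1)] assms(2) unfolding c_def by simp

lemma left_level_eq:
  assumes t: "0 < t" and \<delta>: "0 < \<delta>" and eq: "\<And>a. 0 \<le> a \<Longrightarrow> t - \<delta> < a \<Longrightarrow> a < t \<Longrightarrow> X a = c a + C"
  shows "left_level x\<^sub>0 X t = c t + C"
proof -
  have "(c \<longlongrightarrow> c t) (at t within {0..})" using c_cont t by (auto simp: continuous_on_def)
  moreover have "at t within {0..} = at t" using t by (intro at_within_interior) simp
  ultimately have "(c \<longlongrightarrow> c t) (at_left t)" by (metis filterlim_at_split)
  then have "((\<lambda>a. c a + C) \<longlongrightarrow> c t + C) (at_left t)" by (intro tendsto_intros)
  moreover have "eventually (\<lambda>a. c a + C = X a) (at_left t)"
    unfolding eventually_at_left_field using t \<delta>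
    by (intro exI[of _ "max 0 (t - \<delta>)"]) (auto simp: eq)
  ultimately have "(X \<longlongrightarrow> c t + C) (at_left t)" by (rule Lim_transform_eventually)
  then show ?thesis unfolding left_level_def using t by (simp add: tendsto_Lim)
qed

lemma stays_above:
  assumes s: "0 \<le> s" and \<delta>: "0 < \<delta>" "\<And>t. s \<le> t \<Longrightarrow> t < s + \<delta> \<Longrightarrow> X t = c t + C" and b: "b < c s + C"
  obtains \<rho> where "0 < \<rho>" "\<And>t. s \<le> t \<Longrightarrow> t < s + \<rho> \<Longrightarrow> b < X t"
    "\<And>t. s < t \<Longrightarrow> t < s + \<rho> \<Longrightarrow> b < left_level x\<^sub>0 X t"
proof -
  have "0 < c s + C - b" using b by simp
  from continuous_on_atLeast_near[OF c_cont s this] obtain \<delta>' where \<delta>': "\<delta>' > 0"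
    "\<And>a. a \<ge> 0 \<Longrightarrow> \<bar>a - s\<bar> < \<delta>' \<Longrightarrow> \<bar>c a - c s\<bar> < c s + C - b" by blast
  have above: "b < c t + C" if "s \<le> t" "t < s + \<delta>'" for t
  proof -
    have "\<bar>c t - c s\<bar> < c s + C - b" using \<delta>'(2)[of t] that s by simp
    then show ?thesis by linarith
  qed
  show thesis
  proof (rule that[of "min \<delta> \<delta>'"])
    show "0 < min \<delta> \<delta>'" using \<delta> \<delta>' by simp
    show "b < X t" if "s \<le> t" "t < s + min \<delta> \<delta>'" for t
      using above[of t] \<delta>(2)[of t] that by simp
    show "b < left_level x\<^sub>0 X t" if "s < t" "t < s + min \<delta> \<delta>'" for t
    proof -
      have "left_level x\<^sub>0 X t = c t + C"
        by (rule left_level_eq[of t "t - s"]) (use s that \<delta>(2) in auto)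
      then show ?thesis using above[of t] that by simp
    qed
  qed
qed

text \<open>The left limit at a group of simultaneous orders sees only the orders placed before the
  group; at time 0 there are none.\<close>

lemma left_level_first:
  assumes k: "\<tau> (Suc k) = ereal s" and first: "k = 0 \<or> \<tau> k < ereal s"
  shows "left_level x\<^sub>0 X s = c s + S k"
proof (cases "s = 0")
  case True
  then have "k = 0" using first \<tau>_nonneg[of k] by (auto simp: zero_ereal_def)
  then show ?thesis unfolding left_level_def S_def using True c_0 by simp
next
  case False
  then have s: "0 < s" using \<tau>_nonneg[of "Suc k"] k by (simp add: zero_ereal_def)
  have "\<tau> k < ereal s" using first s \<tau>_0 by (auto simp: zero_ereal_def)
  then obtain \<delta> where \<delta>: "0 < \<delta>" "\<And>t. s - \<delta> < t \<Longrightarrow> \<tau> k < ereal t" using ereal_less_left by blast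
  show ?thesis
    by (rule left_level_eq[OF s \<delta>(1)], rule X_between) (use \<delta>(2) k in \<open>auto simp: less_imp_le\<close>)
qed

text \<open>Simultaneous orders refer to the same left limit, so all have the same size
  \<open>d\<close>; one of them already lifts the level to \<open>z\<close>, and the others add a
  nonnegative amount. This is a bound rather than an equality because strictness of the order times
  is yet to be derived from it.\<close>

lemma right_of_order:
  assumes k: "\<tau> (Suc k) = ereal s"
  obtains \<delta> C where "0 < \<delta>" "\<And>t. s \<le> t \<Longrightarrow> t < s + \<delta> \<Longrightarrow> X t = c t + C" "z \<le> c s + C"
proof -
  have s: "0 \<le> s" using \<tau>_nonneg[of "Suc k"] k by (simp add: zero_ereal_def)
  define j where "j = (LEAST j. \<tau> (Suc j) = ereal s)"
  have j: "\<tau> (Suc j) = ereal s" unfolding j_def using k by (rule LeastI)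
  have "j = 0 \<or> \<tau> j < ereal s"
  proof (cases j)
    case (Suc i)
    then have "\<tau> (Suc i) \<noteq> ereal s" using not_less_Least[of i "\<lambda>j. \<tau> (Suc j) = ereal s"] j_def by auto
    then show ?thesis using \<tau>_Suc[of j] j Suc by (simp add: order.not_eq_order_implies_strict)
  qed simp
  then have pre: "left_level x\<^sub>0 X s = c s + S j" by (rule left_level_first[OF j])
  define d where "d = z - (c s + S j)"
  have Yd: "Y (Suc i) = d" if "\<tau> (Suc i) = ereal s" for i
    using Y_eq[of i] that pre unfolding d_def by simp
  have d: "0 \<le> d" using Y_nonneg[of j] Yd[OF j] by simp
  show thesis
  proof (cases "\<exists>q. ereal s < \<tau> q")
    case True
    define q where "q = (LEAST q. ereal s < \<tau> q)"
    have q: "ereal s < \<tau> q" unfolding q_def using True by (rule LeastI_ex)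
    have "Suc j < q" using \<tau>_mono[of q "Suc j"] q j by (metis leD leI)
    then obtain i where i: "q = Suc i" "Suc j \<le> i" by (cases q) auto
    have "\<not> ereal s < \<tau> i" using not_less_Least[of i "\<lambda>q. ereal s < \<tau> q"] i q_def by auto
    then have \<tau>i: "\<tau> i \<le> ereal s" by simp
    obtain \<delta> where \<delta>: "0 < \<delta>" "\<And>t. t < s + \<delta> \<Longrightarrow> ereal t < \<tau> q" using ereal_less_right[OF q] by blast
    show thesis
    proof (rule that[OF \<delta>(1)])
      show "X t = c t + S i" if "s \<le> t" "t < s + \<delta>" for t
        by (rule X_between) (use s that \<tau>i \<delta>(2) i in \<open>auto intro: order_trans\<close>)
      have "Y (Suc a) = d" if "j \<le> a" "a < i" for a
      proof (rule Yd, rule antisym)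
        show "\<tau> (Suc a) \<le> ereal s" using \<tau>_mono[of "Suc a" i] that \<tau>i by (auto intro: order_trans)
        show "ereal s \<le> \<tau> (Suc a)" using \<tau>_mono[of "Suc j" "Suc a"] that j by simp
      qed
      then have "(\<Sum>a\<in>{j..<i}. Y (Suc a)) = real (i - j) * d" by simp
      moreover have "S i = S j + (\<Sum>a\<in>{j..<i}. Y (Suc a))"
        unfolding S_def using i sum.atLeastLessThan_concat[of 0 j i "\<lambda>a. Y (Suc a)"] by (simp add: atLeast0LessThan)
      moreover have "1 * d \<le> real (i - j) * d" using i d by (intro mult_right_mono) auto
      ultimately show "z \<le> c s + S i" unfolding d_def by simp
    qed
  next
    case False
    then have all: "\<tau> q \<le> ereal s" for q by (simp add: not_less)
    have eq: "\<tau> (Suc i) = ereal s" if "j \<le> i" for i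
      using all[of "Suc i"] \<tau>_mono[of "Suc j" "Suc i"] that j by (intro antisym) auto
    \<comment> \<open>Infinitely many orders at one instant: their sizes are summable yet all equal
      to \<open>d\<close>, so \<open>d\<close> is 0 and the level is \<open>z\<close>
      already.\<close>
    have "(\<lambda>i. Y (Suc i)) \<longlonglongrightarrow> 0"
      using X_beyond[OF s all] by (intro summable_LIMSEQ_zero) (rule sums_summable)
    moreover have "(\<lambda>i. Y (Suc i)) \<longlonglongrightarrow> d"
    proof (rule tendsto_eventually)
      show "\<forall>\<^sub>F i in sequentially. Y (Suc i) = d"
        using eventually_ge_at_top[of j] by eventually_elim (rule Yd[OF eq])
    qed
    ultimately have d0: "d = 0" by (simp add: LIMSEQ_unique)
    have "Y (Suc i) = 0" if "j \<le> i" for i using Yd[OF eq[OF that]] d0 by simp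
    then have "(\<lambda>i. Y (Suc i)) sums S j" unfolding S_def by (intro sums_finite) auto
    then have X: "X t = c t + S j" if "s \<le> t" for t
    proof -
      have "\<tau> k \<le> ereal t" for k using all[of k] that by (metis ereal_less_eq(3) order_trans)
      then have "(\<lambda>i. Y (Suc i)) sums (X t - c t)"
        using that s by (intro X_beyond) simp_all
      then have "X t - c t = S j" using \<open>(\<lambda>i. Y (Suc i)) sums S j\<close> by (rule sums_unique2)
      then show ?thesis by simp
    qed
    show thesis by (rule that[of 1 "S j"]) (use X d0 d_def in auto)
  qed
qed

end

section \<open>Distinct order times, order counts and the balance equation\<close>

locale strictly_ordered_path = ordered_path +
  assumes strict: "\<And>k. \<tau> (Suc k) < \<infinity> \<Longrightarrow> \<tau> (Suc k) < \<tau> (Suc (Suc k))"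
    and pre_order: "\<And>k s. \<tau> (Suc k) = ereal s \<Longrightarrow> 0 < s \<Longrightarrow> left_level x\<^sub>0 X s = y"
begin

lemma before_order:
  assumes "\<tau> (Suc k) = ereal s" shows "k = 0 \<or> \<tau> k < ereal s"
proof (cases k)
  case (Suc j)
  have "\<tau> (Suc j) \<le> ereal s" using \<tau>_Suc[of k] assms Suc by simp
  also have "ereal s < \<infinity>" by simp
  finally show ?thesis using strict[of j] assms Suc by simp
qed simp

lemma X_at_order:
  assumes k: "\<tau> (Suc k) = ereal s" shows "X s = z"
proof -
  have s: "0 \<le> s" using \<tau>_nonneg[of "Suc k"] k by (simp add: zero_ereal_def)
  have "X s = c s + S (Suc k)" by (rule X_between[OF s]) (use k strict[of k] in auto)
  moreover have "Y (Suc k) = z - (c s + S k)"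
    using Y_eq[of k] left_level_first[OF k before_order[OF k]] k by simp
  ultimately show ?thesis unfolding S_def by simp
qed

lemma Y_const: "\<tau> (Suc k) = ereal s \<Longrightarrow> 0 < s \<Longrightarrow> Y (Suc k) = z - y"
  using Y_eq[of k] pre_order[of k s] by simp

text \<open>Infinitely many orders before \<open>t\<close> would all have the positive size
  \<open>z - y\<close>, apart from a possible order at time 0, and the balance equation requires a
  convergent series.\<close>

lemma order_beyond: "\<exists>k. ereal t < \<tau> k"
proof (rule ccontr)
  assume "\<not> ?thesis"
  then have all: "\<tau> k \<le> ereal t" for k by (simp add: not_less)
  have t: "0 \<le> t" using all[of 0] \<tau>_0 by (simp add: zero_ereal_def)
  \<comment> \<open>The very first order is left out: at time 0 its size is
    \<open>z - x\<^sub>0\<close>.\<close>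
  have Y: "Y (Suc k) = z - y" if "1 \<le> k" for k
  proof -
    obtain s where s: "\<tau> (Suc k) = ereal s"
      using all[of "Suc k"] \<tau>_nonneg[of "Suc k"] by (cases "\<tau> (Suc k)") auto
    have "\<tau> k < ereal s" using before_order[OF s] that by simp
    then have "0 < ereal s" using \<tau>_nonneg[of k] by (rule le_less_trans[rotated])
    then have "0 < s" by (simp add: zero_ereal_def)
    with s show ?thesis by (rule Y_const)
  qed
  have 1: "(\<lambda>i. Y (Suc i)) \<longlonglongrightarrow> 0"
    using X_beyond[OF t all] by (intro summable_LIMSEQ_zero) (rule sums_summable)
  have "(\<lambda>i. Y (Suc i)) \<longlonglongrightarrow> z - y"
  proof (rule tendsto_eventually)
    show "\<forall>\<^sub>F i in sequentially. Y (Suc i) = z - y"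
      using eventually_ge_at_top[of 1] by eventually_elim (rule Y)
  qed
  then have "z - y = 0" using 1 by (rule LIMSEQ_unique)
  then show False using yz by simp
qed

lemma current_order:
  assumes "0 \<le> t"
  obtains k where "\<tau> k \<le> ereal t" "ereal t < \<tau> (Suc k)"
proof -
  define q where "q = (LEAST q. ereal t < \<tau> q)"
  have q: "ereal t < \<tau> q" unfolding q_def using order_beyond by (rule LeastI_ex)
  then have "q \<noteq> 0" using \<tau>_0 assms by (intro notI) (simp add: zero_ereal_def)
  then obtain k where k: "q = Suc k" by (cases q) auto
  have "\<not> ereal t < \<tau> k" using not_less_Least[of k "\<lambda>q. ereal t < \<tau> q"] k q_def by auto
  then show thesis by (intro that[of k]) (use q k in \<open>simp_all add: not_less\<close>)
qed

text \<open>A series of indicators, so that measurability in the sample point follows term by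
  term.\<close>

definition N :: "real \<Rightarrow> real" where
  "N t = (\<Sum>k. if \<tau> (Suc k) \<le> ereal t then 1 else 0)"

lemma N_eq:
  assumes k: "\<tau> k \<le> ereal t" "ereal t < \<tau> (Suc k)"
  shows "N t = real k"
proof -
  have "(if \<tau> (Suc i) \<le> ereal t then 1 else 0) = (if i \<in> {..<k} then 1 else 0 :: real)" for i
    using \<tau>_mono[of "Suc i" k] \<tau>_mono[of "Suc k" "Suc i"] k
    by (cases "i < k") (auto simp: not_le intro: order_trans less_le_trans)
  then have "N t = (\<Sum>i. if i \<in> {..<k} then 1 else 0)" unfolding N_def by simp
  also have "\<dots> = (\<Sum>i\<in>{..<k}. 1)" by (rule sums_unique[OF sums_If_finite_set, symmetric]) simp
  finally show ?thesis by simp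
qed

lemma N_mono:
  assumes "0 \<le> s" "s \<le> t" shows "N s \<le> N t"
proof -
  have "0 \<le> t" using assms by simp
  obtain k where k: "\<tau> k \<le> ereal s" "ereal s < \<tau> (Suc k)" using current_order[OF assms(1)] .
  obtain l where l: "\<tau> l \<le> ereal t" "ereal t < \<tau> (Suc l)" using current_order[OF \<open>0 \<le> t\<close>] .
  have "k \<le> l"
  proof (rule ccontr)
    assume "\<not> k \<le> l"
    then have "\<tau> (Suc l) \<le> \<tau> k" by (intro \<tau>_mono) simp
    also have "\<dots> \<le> ereal s" by (rule k(1))
    also have "\<dots> \<le> ereal t" using assms by simp
    finally show False using l by simp
  qed
  then show ?thesis using N_eq[OF k] N_eq[OF l] by simp
qed

text \<open>An order at time 0 enters the initial level \<open>X_init\<close> below and is not counted.\<close>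

definition n :: "real \<Rightarrow> real" where "n t = N t - N 0"

definition X_init :: real where "X_init = X 0"

lemma X_init_cases: "(\<tau> 1 \<noteq> 0 \<and> N 0 = 0 \<and> X_init = x\<^sub>0) \<or> (\<tau> 1 = 0 \<and> N 0 = 1 \<and> X_init = z)"
proof (cases "\<tau> 1 = 0")
  case True
  then have 1: "\<tau> (Suc 0) = ereal 0" by (simp add: zero_ereal_def)
  have "N 0 = real 1" by (rule N_eq) (use 1 strict[of 0] in \<open>auto simp: zero_ereal_def\<close>)
  then show ?thesis using X_at_order[OF 1] True unfolding X_init_def by simp
next
  case False
  then have "ereal 0 < \<tau> (Suc 0)" using \<tau>_nonneg[of 1] by (simp add: zero_ereal_def order.not_eq_order_implies_strict)
  then have "N 0 = real 0" "X 0 = c 0 + S 0"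
    using N_eq[of 0 0] X_between[of 0 0] \<tau>_0 by (auto simp: zero_ereal_def)
  then show ?thesis using False c_0 unfolding X_init_def S_def by simp
qed

lemma X_decomp:
  assumes t: "0 \<le> t"
  shows "X t = X_init - \<mu> * t + \<sigma> * w t + L t + (z - y) * n t"
proof -
  obtain k where k: "\<tau> k \<le> ereal t" "ereal t < \<tau> (Suc k)" using current_order[OF t] .
  have X: "X t = c t + S k" by (rule X_between[OF t k])
  have nt: "n t = real k - N 0" unfolding n_def N_eq[OF k] ..
  have fin: "\<exists>s. \<tau> (Suc i) = ereal s" if "i < k" for i
  proof -
    have "\<tau> (Suc i) \<le> ereal t" using \<tau>_mono[of "Suc i" k] that k by (auto intro: order_trans)
    then show ?thesis using \<tau>_nonneg[of "Suc i"] by (cases "\<tau> (Suc i)") auto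
  qed
  have pos: "0 < s" if "\<tau> (Suc i) = ereal s" "\<tau> 1 \<noteq> 0 \<or> 1 \<le> i" for i s
  proof -
    have "0 < \<tau> (Suc i)"
    proof (cases "i = 0")
      case True
      then show ?thesis using that \<tau>_nonneg[of 1] by (simp add: order.not_eq_order_implies_strict)
    next
      case False
      then have "\<tau> i < ereal s" using before_order[OF that(1)] by simp
      then show ?thesis using \<tau>_nonneg[of i] that(1) by (metis le_less_trans)
    qed
    then show ?thesis using that(1) by (simp add: zero_ereal_def)
  qed
  have Y: "Y (Suc i) = z - y" if "i < k" "\<tau> 1 \<noteq> 0 \<or> 1 \<le> i" for i
    using fin[OF that(1)] pos[OF _ that(2)] Y_const by blast
  from X_init_cases show ?thesis
  proof
    assume A: "\<tau> 1 \<noteq> 0 \<and> N 0 = 0 \<and> X_init = x\<^sub>0"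
    then have "S k = real k * (z - y)" unfolding S_def using Y by simp
    then show ?thesis using X nt A unfolding c_def by simp
  next
    assume A: "\<tau> 1 = 0 \<and> N 0 = 1 \<and> X_init = z"
    then have "k \<noteq> 0" using k(2) t by (intro notI) (auto simp: zero_ereal_def)
    then obtain l where l: "k = Suc l" by (cases k) auto
    have "Y 1 = z - x\<^sub>0" using Y_eq[of 0] A by (simp add: left_level_def)
    moreover have "S k = Y 1 + (\<Sum>i<l. Y (Suc (Suc i)))" unfolding S_def l by (subst sum.lessThan_Suc_shift) simp
    moreover have "(\<Sum>i<l. Y (Suc (Suc i))) = real l * (z - y)" using Y l by simp
    ultimately show ?thesis using X nt A l unfolding c_def by simp
  qed
qed

text \<open>Start of the current cycle: the level there is bounded by a constant, and from then on
  the path moves like \<open>c\<close>. This is the source of the domination by the drifted Brownian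
  path.\<close>

lemma last_order:
  assumes t: "0 \<le> t" and k: "\<tau> k \<le> ereal t" "ereal t < \<tau> (Suc k)"
  obtains s where "0 \<le> s" "s \<le> t" "\<tau> k = ereal s" "X s \<le> max X_init z" "X t - X s = c t - c s"
proof -
  obtain s where s: "\<tau> k = ereal s" using k(1) \<tau>_nonneg[of k] by (cases "\<tau> k") auto
  have s0: "0 \<le> s" "s \<le> t" using \<tau>_nonneg[of k] s k(1) by (simp_all add: zero_ereal_def)
  have "ereal s < \<tau> (Suc k)" using s0 k(2) by (metis ereal_less_eq(3) le_less_trans)
  then have Xs: "X s = c s + S k" using X_between[OF s0(1), of k] s by simp
  have "X s \<le> max X_init z"
  proof (cases k)
    case 0
    then have "s = 0" using s \<tau>_0 by (simp add: zero_ereal_def)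
    then show ?thesis unfolding X_init_def by simp
  next
    case (Suc j)
    then show ?thesis using X_at_order[of j s] s by simp
  qed
  then show thesis using that s0 s Xs X_between[OF t k] by simp
qed

sublocale regulated: regulated_path \<mu> \<sigma> X_init y z w X L n
proof
  show "0 < \<mu>" "0 < \<sigma>" "0 \<le> y" "y < z" "continuous_on {0..} w" "w 0 = 0"
    "L 0 = 0" "continuous_on {0..} L" "mono_on {0..} L"
    using mu sigma y yz w_cont w_0 L_0 L_cont L_mono by auto
  show "n 0 = 0" unfolding n_def by simp
  show "mono_on {0..} n" unfolding n_def mono_on_def using N_mono by simp
  fix s :: real
  show "0 \<le> s \<Longrightarrow> X s = X_init - \<mu> * s + \<sigma> * w s + L s + (z - y) * n s" by (rule X_decomp)
  show "0 \<le> s \<Longrightarrow> 0 \<le> X s" by (rule X_nonneg)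
  show "0 \<le> s \<Longrightarrow> s \<le> t \<Longrightarrow> (\<And>u. s \<le> u \<Longrightarrow> u \<le> t \<Longrightarrow> 0 < X u) \<Longrightarrow> L t = L s" for t by (rule L_flat)
  show "\<exists>\<delta>>0. \<forall>t. s \<le> t \<and> t < s + \<delta> \<longrightarrow> n t = n s" if s: "0 \<le> s"
  proof -
    obtain k where k: "\<tau> k \<le> ereal s" "ereal s < \<tau> (Suc k)" using current_order[OF s] .
    obtain \<delta> where \<delta>: "0 < \<delta>" "\<And>t. t < s + \<delta> \<Longrightarrow> ereal t < \<tau> (Suc k)" using ereal_less_right[OF k(2)] by blast
    have "n t = n s" if "s \<le> t \<and> t < s + \<delta>" for t
    proof -
      have "\<tau> k \<le> ereal t" using k(1) that by (metis ereal_less_eq(3) order_trans)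
      then show ?thesis unfolding n_def using N_eq[OF k] N_eq[of k t] \<delta>(2) that by simp
    qed
    then show ?thesis using \<delta>(1) by blast
  qed
  show "(\<exists>\<delta>>0. \<forall>t. 0 \<le> t \<and> s - \<delta> < t \<and> t < s \<longrightarrow> n t = n s) \<or>
      (X s = z \<and> (\<exists>\<delta>>0. \<forall>t. 0 \<le> t \<and> s - \<delta> < t \<and> t < s \<longrightarrow> n t = n s - 1))" if s: "0 < s"
  proof -
    have "0 \<le> s" using s by simp
    obtain k where k: "\<tau> k \<le> ereal s" "ereal s < \<tau> (Suc k)" using current_order[OF \<open>0 \<le> s\<close>] .
    show ?thesis
    proof (cases "\<tau> k = ereal s")
      case False
      then have "\<tau> k < ereal s" using k by simp
      then obtain \<delta> where \<delta>: "0 < \<delta>" "\<And>t. s - \<delta> < t \<Longrightarrow> \<tau> k < ereal t" using ereal_less_left by blast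
      have "n t = n s" if "0 \<le> t \<and> s - \<delta> < t \<and> t < s" for t
      proof -
        have "ereal t < \<tau> (Suc k)" using k(2) that by (metis ereal_less(2) less_ereal.simps(1) less_trans)
        then show ?thesis unfolding n_def using N_eq[OF k] N_eq[of k t] \<delta>(2)[of t] that by simp
      qed
      then show ?thesis using \<delta>(1) by blast
    next
      case True
      then have "k \<noteq> 0" using s \<tau>_0 by (intro notI) (simp add: zero_ereal_def)
      then obtain j where j: "k = Suc j" by (cases k) auto
      have \<tau>j: "\<tau> (Suc j) = ereal s" using True j by simp
      have "\<tau> j < ereal s" using before_order[OF \<tau>j] s \<tau>_0 by (auto simp: zero_ereal_def)
      then obtain \<delta> where \<delta>: "0 < \<delta>" "\<And>t. s - \<delta> < t \<Longrightarrow> \<tau> j < ereal t" using ereal_less_left by blast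
      have "n t = n s - 1" if "0 \<le> t \<and> s - \<delta> < t \<and> t < s" for t
        unfolding n_def using N_eq[OF k] N_eq[of j t] \<delta>(2)[of t] that \<tau>j j by simp
      then show ?thesis using \<delta>(1) X_at_order[OF \<tau>j] by blast
    qed
  qed
qed

end


section \<open>The local time as a functional of the free path\<close>

context regulated_path
begin

lemma X_minus_L_right:
  assumes s: "0 \<le> s" and \<epsilon>: "0 < \<epsilon>"
  obtains \<delta> where "0 < \<delta>" "\<And>t. s \<le> t \<Longrightarrow> t < s + \<delta> \<Longrightarrow> \<bar>(X t - L t) - (X s - L s)\<bar> < \<epsilon>"
proof -
  have "continuous_on {0..} (\<lambda>t. c t - L t)" using c_cont L_cont by (intro continuous_intros)
  from continuous_on_atLeast_near[OF this s \<epsilon>] obtain \<delta>1 where \<delta>1: "\<delta>1 > 0"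
    "\<And>a. a \<ge> 0 \<Longrightarrow> \<bar>a - s\<bar> < \<delta>1 \<Longrightarrow> \<bar>(c a - L a) - (c s - L s)\<bar> < \<epsilon>" by blast
  obtain \<delta>2 where \<delta>2: "\<delta>2 > 0" "\<And>t. s \<le> t \<Longrightarrow> t < s + \<delta>2 \<Longrightarrow> n t = n s" using n_right[OF s] by blast
  show thesis
  proof (rule that[of "min \<delta>1 \<delta>2"])
    show "\<bar>(X t - L t) - (X s - L s)\<bar> < \<epsilon>" if t: "s \<le> t" "t < s + min \<delta>1 \<delta>2" for t
    proof -
      have "n t = n s" using \<delta>2(2)[of t] t by simp
      then have "(X t - L t) - (X s - L s) = (c t - L t) - (c s - L s)"
        using X_c[of t] X_c[OF s] t s by simp
      moreover have "\<bar>(c t - L t) - (c s - L s)\<bar> < \<epsilon>" using \<delta>1(2)[of t] t s by auto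
      ultimately show ?thesis by (simp only:)
    qed
  qed (use \<delta>1 \<delta>2 in simp)
qed

text \<open>
  The Skorokhod formula, with the supremum over a countable set of times,
  so that it exhibits \<open>L\<close> as an adapted process.
\<close>

lemma skorokhod_formula:
  assumes t: "0 \<le> t"
  shows "ereal (L t) = (SUP q\<in>insert t (\<rat> \<inter> {0..t}). ereal (max 0 (L q - X q)))"
proof (rule antisym)
  show "(SUP q\<in>insert t (\<rat> \<inter> {0..t}). ereal (max 0 (L q - X q))) \<le> ereal (L t)"
  proof (rule SUP_least)
    fix q assume "q \<in> insert t (\<rat> \<inter> {0..t})"
    then have q: "0 \<le> q" "q \<le> t" using t by auto
    then show "ereal (max 0 (L q - X q)) \<le> ereal (L t)"
      using L_le[OF q] L_le[of 0 t] X_nonneg[OF q(1)] L_0 t by simp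
  qed
  show "ereal (L t) \<le> (SUP q\<in>insert t (\<rat> \<inter> {0..t}). ereal (max 0 (L q - X q)))"
  proof (rule ereal_le_epsilon2)
    fix e :: real assume e: "0 < e"
    have "\<exists>q\<in>insert t (\<rat> \<inter> {0..t}). L t \<le> max 0 (L q - X q) + e"
    proof (cases "L t \<le> e")
      case True
      then show ?thesis by (intro bexI[of _ t]) auto
    next
      case False
      have e2: "0 < e / 2" using e by simp
      have "continuous_on {0..t} L" using L_cont by (rule continuous_on_subset) auto
      \<comment> \<open>\<open>L\<close> still grows after \<open>a\<close>, so the path must vanish
        at some \<open>r\<close> in [a,t], where \<open>L\<close> is within e/2 of its final
        value.\<close>
      then obtain a where a: "0 \<le> a" "a \<le> t" "L a = L t - e / 2"
        using IVT'[of L 0 "L t - e / 2" t] L_0 t e False by auto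
      have "\<exists>r. a \<le> r \<and> r \<le> t \<and> \<not> 0 < X r" using L_flat[OF a(1,2)] a(3) e by force
      then obtain r where r: "a \<le> r" "r \<le> t" "\<not> 0 < X r" by blast
      then have r0: "0 \<le> r" "X r = 0" using a X_nonneg[of r] by auto
      have Lr: "L t - e / 2 \<le> L r" using L_le[OF a(1) r(1)] a(3) by simp
      show ?thesis
      \<comment> \<open>No rational need lie between \<open>r\<close> and \<open>t\<close> if they
        coincide; for this case \<open>t\<close> itself belongs to the index set.\<close>
      proof (cases "r = t")
        case True
        then show ?thesis using r0 e by (intro bexI[of _ t]) auto
      next
        case False
        obtain \<delta> where \<delta>: "0 < \<delta>" "\<And>u. r \<le> u \<Longrightarrow> u < r + \<delta> \<Longrightarrow> \<bar>(X u - L u) - (X r - L r)\<bar> < e / 2"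
          using X_minus_L_right[OF r0(1) e2] by blast
        have "r < min t (r + \<delta>)" using False r \<delta> by simp
        then obtain q where q: "q \<in> \<rat>" "r < q" "q < min t (r + \<delta>)" using Rats_dense_in_real by blast
        have "\<bar>(X q - L q) - (X r - L r)\<bar> < e / 2" using \<delta>(2)[of q] q by simp
        then have "L t \<le> (L q - X q) + e" using Lr r0 by linarith
        then show ?thesis using q r0 by (intro bexI[of _ q]) auto
      qed
    qed
    then obtain q where q: "q \<in> insert t (\<rat> \<inter> {0..t})" "L t \<le> max 0 (L q - X q) + e" by blast
    have "ereal (L t) \<le> ereal (max 0 (L q - X q)) + ereal e"
      using q(2) by (simp only: plus_ereal.simps ereal_less_eq)
    also have "\<dots> \<le> (SUP q\<in>insert t (\<rat> \<inter> {0..t}). ereal (max 0 (L q - X q))) + ereal e"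
      using q(1) by (intro add_mono SUP_upper) auto
    finally show "ereal (L t) \<le> (SUP q\<in>insert t (\<rat> \<inter> {0..t}). ereal (max 0 (L q - X q))) + ereal e" .
  qed
qed

end

context ordered_path
begin

lemma left_level_between:
  assumes t: "\<tau> k < ereal t" "ereal t < \<tau> (Suc k)"
  shows "left_level x\<^sub>0 X t = X t"
proof -
  have t0: "0 < t" using le_less_trans[OF \<tau>_nonneg t(1)] by (simp add: zero_ereal_def)
  have X: "X a = c a + S k" if "0 \<le> a" "\<tau> k < ereal a" "a \<le> t" for a
  proof (rule X_between)
    show "ereal a < \<tau> (Suc k)" using t(2) that(3) by (metis ereal_less_eq(3) le_less_trans)
  qed (use that in auto)
  obtain \<delta> where \<delta>: "0 < \<delta>" "\<And>a. t - \<delta> < a \<Longrightarrow> \<tau> k < ereal a" using ereal_less_left[OF t(1)] by blast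
  have "left_level x\<^sub>0 X t = c t + S k" by (rule left_level_eq[OF t0 \<delta>(1)]) (use X \<delta>(2) in auto)
  then show ?thesis using X[of t] t0 t(1) by simp
qed

lemma stays_above_X:
  assumes "0 \<le> s" "0 < \<delta>" "\<And>t. s \<le> t \<Longrightarrow> t < s + \<delta> \<Longrightarrow> X t = c t + C" "b < c s + C"
  shows "\<exists>\<rho>>0. \<forall>t. s \<le> t \<and> t < s + \<rho> \<longrightarrow> b < X t"
  by (rule stays_above[OF assms]) blast+

lemma
  assumes k: "\<tau> (Suc k) = ereal s" and b: "b < z"
  shows after_order_X: "\<exists>\<rho>>0. \<forall>t. s \<le> t \<and> t < s + \<rho> \<longrightarrow> b < X t"
    and after_order_left_level: "\<exists>\<rho>>0. \<forall>t. s < t \<and> t < s + \<rho> \<longrightarrow> b < left_level x\<^sub>0 X t"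
proof -
  have s: "0 \<le> s" using \<tau>_nonneg[of "Suc k"] k by (simp add: zero_ereal_def)
  obtain \<delta> C where \<delta>: "0 < \<delta>" "\<And>t. s \<le> t \<Longrightarrow> t < s + \<delta> \<Longrightarrow> X t = c t + C" "z \<le> c s + C"
    using right_of_order[OF k] by blast
  have bC: "b < c s + C" using \<delta>(3) b by simp
  show "\<exists>\<rho>>0. \<forall>t. s \<le> t \<and> t < s + \<rho> \<longrightarrow> b < X t"
    by (rule stays_above_X[OF s \<delta>(1,2) bC])
  show "\<exists>\<rho>>0. \<forall>t. s < t \<and> t < s + \<rho> \<longrightarrow> b < left_level x\<^sub>0 X t"
    by (rule stays_above[OF s \<delta>(1,2) bC]) blast+
qed

end

section \<open>Paths of the standard policy\<close>

locale standard_path = ordered_path +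
  assumes first_order: "\<tau> 1 = Inf {ereal t | t. 0 \<le> t \<and> left_level x\<^sub>0 X t \<le> y}"
    and next_order: "\<And>k. 1 \<le> k \<Longrightarrow> \<tau> (Suc k) = Inf {ereal t | t. \<tau> k < ereal t \<and> left_level x\<^sub>0 X t \<le> y}"
begin

lemma \<tau>_Suc_eq: "\<tau> (Suc k) = Inf {ereal t | t. (if k = 0 then 0 \<le> t else \<tau> k < ereal t) \<and> left_level x\<^sub>0 X t \<le> y}"
  using first_order next_order[of k] by (cases "k = 0") auto

lemma above_between:
  assumes "\<tau> k < ereal t" "ereal t < \<tau> (Suc k)"
  shows "y < left_level x\<^sub>0 X t" "y < X t"
proof -
  have "0 \<le> t" using le_less_trans[OF \<tau>_nonneg assms(1)] by (simp add: zero_ereal_def)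
  then show "y < left_level x\<^sub>0 X t"
    using ereal_Inf_not_before[OF assms(2)[unfolded \<tau>_Suc_eq]] assms(1) by (auto split: if_splits)
  then show "y < X t" using left_level_between[OF assms] by simp
qed

text \<open>After an order the level stays near \<open>z\<close>, above \<open>y\<close>, for a
  while, so the next order is strictly later and the infimum is attained. The rule asks only for a
  level at most \<open>y\<close>; equality holds because the path comes down to it continuously from
  above.\<close>

sublocale strictly_ordered_path
proof
  show "\<tau> (Suc k) < \<tau> (Suc (Suc k))" if fin: "\<tau> (Suc k) < \<infinity>" for k
  proof -
    obtain s where s: "\<tau> (Suc k) = ereal s" using fin \<tau>_nonneg[of "Suc k"] by (cases "\<tau> (Suc k)") auto
    obtain \<rho> where \<rho>: "0 < \<rho>" "\<And>t. s < t \<Longrightarrow> t < s + \<rho> \<Longrightarrow> y < left_level x\<^sub>0 X t"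
      using after_order_left_level[OF s yz] by blast
    have "ereal (s + \<rho>) \<le> \<tau> (Suc (Suc k))"
      unfolding \<tau>_Suc_eq[of "Suc k"] s
    proof (rule Inf_greatest, safe)
      fix t assume "if Suc k = 0 then 0 \<le> t else ereal s < ereal t" "left_level x\<^sub>0 X t \<le> y"
      then have "s < t" "\<not> y < left_level x\<^sub>0 X t" by simp_all
      then have "\<not> t < s + \<rho>" using \<rho>(2) by blast
      then show "ereal (s + \<rho>) \<le> ereal t" by simp
    qed
    moreover have "\<tau> (Suc k) < ereal (s + \<rho>)" using s \<rho>(1) by simp
    ultimately show ?thesis by (rule less_le_trans[rotated])
  qed
  show "left_level x\<^sub>0 X s = y" if k: "\<tau> (Suc k) = ereal s" and s: "0 < s" for k s
  proof (rule antisym)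
    obtain \<rho> where \<rho>: "0 < \<rho>" "\<And>t. s < t \<Longrightarrow> t < s + \<rho> \<Longrightarrow> y < left_level x\<^sub>0 X t"
      using after_order_left_level[OF k yz] by blast
    have mem: "(if k = 0 then 0 \<le> s else \<tau> k < ereal s) \<and> left_level x\<^sub>0 X s \<le> y"
      by (rule ereal_Inf_mem[where P = "\<lambda>t. (if k = 0 then 0 \<le> t else \<tau> k < ereal t) \<and> left_level x\<^sub>0 X t \<le> y", OF _ \<rho>(1)]) (use k \<tau>_Suc_eq[of k] \<rho>(2) in \<open>auto simp: not_le\<close>)
    then show "left_level x\<^sub>0 X s \<le> y" ..
    have \<tau>k: "\<tau> k < ereal s" using mem s \<tau>_0 by (auto simp: zero_ereal_def split: if_splits)
    have pre: "left_level x\<^sub>0 X s = c s + S k" by (rule left_level_first[OF k]) (use \<tau>k in simp)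
    show "y \<le> left_level x\<^sub>0 X s"
    proof (rule ccontr)
      assume "\<not> y \<le> left_level x\<^sub>0 X s"
      then have pos: "0 < y - (c s + S k)" using pre by simp
      have s0: "0 \<le> s" using s by simp
      from continuous_on_atLeast_near[OF c_cont s0 pos] obtain \<delta> where \<delta>: "\<delta> > 0"
        "\<And>a. a \<ge> 0 \<Longrightarrow> \<bar>a - s\<bar> < \<delta> \<Longrightarrow> \<bar>c a - c s\<bar> < y - (c s + S k)" by blast
      obtain \<delta>' where \<delta>': "0 < \<delta>'" "\<And>t. s - \<delta>' < t \<Longrightarrow> \<tau> k < ereal t" using ereal_less_left[OF \<tau>k] by blast
      \<comment> \<open>A time shortly before \<open>s\<close> but after the previous order;
        \<open>s / 2\<close> keeps it positive.\<close>
      define a where "a = max (s / 2) (s - min \<delta> \<delta>' / 2)"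
      have a: "0 \<le> a" "a < s" "\<bar>a - s\<bar> < \<delta>" "s - \<delta>' < a"
        unfolding a_def using s \<delta>(1) \<delta>'(1) by (auto simp: max_def min_def)
      have as: "ereal a < \<tau> (Suc k)" using a k by simp
      have "X a = c a + S k" using X_between[OF a(1) _ as] \<delta>'(2)[OF a(4)] by simp
      moreover have "y < X a" using above_between(2)[OF \<delta>'(2)[OF a(4)] as] .
      moreover have "\<bar>c a - c s\<bar> < y - (c s + S k)" using \<delta>(2)[OF a(1,3)] .
      ultimately show False by linarith
    qed
  qed
qed

text \<open>Between orders the level exceeds \<open>y\<close>, at an order it is \<open>z\<close>,
  at time 0 it is \<open>x\<^sub>0\<close> or \<open>z\<close>. So 0 is never reached, even for y =
  0, and no local time arises.\<close>

lemma X_pos: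
  assumes t: "0 \<le> t" shows "0 < X t"
proof -
  obtain k where k: "\<tau> k \<le> ereal t" "ereal t < \<tau> (Suc k)" using current_order[OF t] .
  show ?thesis
  proof (cases "\<tau> k = ereal t")
    case True
    show ?thesis
    proof (cases k)
      case 0
      then have "t = 0" using True \<tau>_0 by (simp add: zero_ereal_def)
      then show ?thesis using X_init_cases x0 y yz unfolding X_init_def by auto
    next
      case (Suc j)
      then show ?thesis using X_at_order[of j t] True y yz by simp
    qed
  next
    case False
    then have "\<tau> k < ereal t" using k(1) by (simp add: order.not_eq_order_implies_strict)
    then have "y < X t" using k(2) by (rule above_between(2))
    then show ?thesis using y by simp
  qed
qed

lemma L_eq_0: "0 \<le> t \<Longrightarrow> L t = 0"
  using L_flat[of 0 t] L_0 X_pos by simp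

text \<open>As \<open>L\<close> vanishes, the rise since the last order is a rise of the free
  path.\<close>

lemma dominated:
  assumes t: "0 \<le> t"
  shows "\<exists>s\<in>{0..t}. X t - max X_init z \<le> (\<sigma> * w t - \<mu> * t) - (\<sigma> * w s - \<mu> * s)"
proof -
  obtain k where k: "\<tau> k \<le> ereal t" "ereal t < \<tau> (Suc k)" using current_order[OF t] .
  obtain s where s: "0 \<le> s" "s \<le> t" "X s \<le> max X_init z" "X t - X s = c t - c s"
    using last_order[OF t k] by blast
  then have "X t - max X_init z \<le> c t - c s" by linarith
  also have "c t - c s = (\<sigma> * w t - \<mu> * t) - (\<sigma> * w s - \<mu> * s)"
    unfolding c_def using L_eq_0[OF t] L_eq_0[OF s(1)] by simp
  finally show ?thesis using s by auto
qed

end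

section \<open>Paths of the delayed policy\<close>

definition trigger :: "(nat \<Rightarrow> ereal) \<Rightarrow> (real \<Rightarrow> real) \<Rightarrow> nat \<Rightarrow> ereal" where
  "trigger \<tau> X k = Inf {ereal t | t. 0 \<le> t \<and> \<tau> k \<le> ereal t \<and> X t = 0}"

locale delayed_path = ordered_path +
  assumes y_pos: "0 < y"
    and \<tau>_Suc_eq: "\<And>k. \<tau> (Suc k) = Inf {ereal t | t. 0 \<le> t \<and> trigger \<tau> X k \<le> ereal t \<and> left_level x\<^sub>0 X t = y}"
begin

abbreviation T :: "nat \<Rightarrow> ereal" where "T \<equiv> trigger \<tau> X"

lemma T_le: "T k \<le> \<tau> (Suc k)"
  unfolding \<tau>_Suc_eq[of k] by (rule Inf_greatest) auto

text \<open>Right after an order the level is near \<open>z\<close>, and initially it is near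
  \<open>x\<^sub>0\<close> or \<open>z\<close>; so 0 cannot be hit at once.\<close>

lemma \<tau>_less_T:
  assumes fin: "\<tau> k < \<infinity>" shows "\<tau> k < T k"
proof -
  obtain s where s: "\<tau> k = ereal s" using fin \<tau>_nonneg[of k] by (cases "\<tau> k") auto
  have s0: "0 \<le> s" using \<tau>_nonneg[of k] s by (simp add: zero_ereal_def)
  have z: "0 < z" using y yz by simp
  have "\<exists>\<rho>>0. \<forall>t. s \<le> t \<and> t < s + \<rho> \<longrightarrow> 0 < X t"
  proof (cases k)
    case (Suc j)
    then show ?thesis using after_order_X[of j s 0] s z by simp
  next
    case 0
    then have "s = 0" using s \<tau>_0 by (simp add: zero_ereal_def)
    show ?thesis
    proof (cases "\<tau> 1 = 0")
      case True
      then have "\<tau> (Suc 0) = ereal s" using \<open>s = 0\<close> by (simp add: zero_ereal_def)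
      then show ?thesis using after_order_X[of 0 s 0] z by simp
    next
      case False
      then have less: "ereal 0 < \<tau> (Suc 0)" using \<tau>_nonneg[of 1] by (simp add: zero_ereal_def order.not_eq_order_implies_strict)
      obtain \<delta> where \<delta>: "0 < \<delta>" "\<And>t. t < 0 + \<delta> \<Longrightarrow> ereal t < \<tau> (Suc 0)" using ereal_less_right[OF less] by blast
      have X: "X t = c t + 0" if "0 \<le> t" "t < 0 + \<delta>" for t
        using X_between[OF that(1), of 0] \<tau>_0 that \<delta>(2)[of t] by (simp add: zero_ereal_def S_def)
      have "0 < c 0 + 0" using c_0 x0 by simp
      from stays_above_X[OF order_refl \<delta>(1) X this] show ?thesis unfolding \<open>s = 0\<close> by simp
    qed
  qed
  then obtain \<rho> where \<rho>: "0 < \<rho>" "\<And>t. s \<le> t \<Longrightarrow> t < s + \<rho> \<Longrightarrow> 0 < X t" by blast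
  have "ereal (s + \<rho>) \<le> T k"
    unfolding trigger_def s
  proof (rule Inf_greatest, safe)
    fix t assume "0 \<le> t" "ereal s \<le> ereal t" "X t = 0"
    then have "s \<le> t" "\<not> 0 < X t" by simp_all
    then have "\<not> t < s + \<rho>" using \<rho>(2) by blast
    then show "ereal (s + \<rho>) \<le> ereal t" by simp
  qed
  moreover have "\<tau> k < ereal (s + \<rho>)" using s \<rho>(1) by simp
  ultimately show ?thesis by (rule less_le_trans[rotated])
qed

lemma X_pos_before_T: "0 \<le> t \<Longrightarrow> \<tau> k \<le> ereal t \<Longrightarrow> ereal t < T k \<Longrightarrow> 0 < X t"
  using ereal_Inf_not_before[of t "\<lambda>t. 0 \<le> t \<and> \<tau> k \<le> ereal t \<and> X t = 0"] X_nonneg[of t]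
  unfolding trigger_def by force

text \<open>An order at the trigger time would put the path near \<open>z\<close> from that time on;
  then the infimum of zeros would be attained at a time where the path is positive.\<close>

lemma T_less:
  assumes T: "T k = ereal s"
  shows "T k < \<tau> (Suc k)"
proof (rule ccontr)
  assume "\<not> T k < \<tau> (Suc k)"
  then have eq: "\<tau> (Suc k) = ereal s" using T_le[of k] T by simp
  have z: "0 < z" using y yz by simp
  obtain \<rho> where \<rho>: "0 < \<rho>" "\<And>t. s \<le> t \<Longrightarrow> t < s + \<rho> \<Longrightarrow> 0 < X t"
    using after_order_X[OF eq z] by blast
  have "0 \<le> s \<and> \<tau> k \<le> ereal s \<and> X s = 0"
  proof (rule ereal_Inf_mem[where P = "\<lambda>t. 0 \<le> t \<and> \<tau> k \<le> ereal t \<and> X t = 0", OF _ \<rho>(1)])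
    show "Inf {ereal t | t. 0 \<le> t \<and> \<tau> k \<le> ereal t \<and> X t = 0} = ereal s" using T unfolding trigger_def .
    show "\<not> (0 \<le> t \<and> \<tau> k \<le> ereal t \<and> X t = 0)" if "s < t" "t < s + \<rho>" for t
      using \<rho>(2)[of t] that by simp
  qed
  then show False using \<rho>(2)[of s] \<rho>(1) by simp
qed

lemma \<tau>_less_of_T: "T k = ereal s \<Longrightarrow> \<tau> k < ereal s"
proof -
  assume T: "T k = ereal s"
  have "\<tau> k \<le> T k" unfolding trigger_def by (rule Inf_greatest) auto
  then have "\<tau> k < \<infinity>" using T by auto
  then show ?thesis using \<tau>_less_T T by metis
qed

text \<open>The path is right-continuous at the trigger: a positive value there would persist,
  leaving a gap before the next zero.\<close>

lemma X_at_T: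
  assumes T: "T k = ereal s" shows "X s = 0"
proof (rule ccontr)
  assume X: "X s \<noteq> 0"
  have \<tau>k: "\<tau> k < ereal s" by (rule \<tau>_less_of_T[OF T])
  have s: "0 < s" using le_less_trans[OF \<tau>_nonneg \<tau>k] by (simp add: zero_ereal_def)
  have less: "ereal s < \<tau> (Suc k)" using T_less[OF T] T by simp
  obtain \<delta> where \<delta>: "0 < \<delta>" "\<And>t. t < s + \<delta> \<Longrightarrow> ereal t < \<tau> (Suc k)" using ereal_less_right[OF less] by blast
  have eq: "X t = c t + S k" if "s \<le> t" "t < s + \<delta>" for t
  proof (rule X_between)
    show "\<tau> k \<le> ereal t" using \<tau>k that(1) by (metis ereal_less_eq(3) less_imp_le order_trans)
  qed (use that s \<delta>(2) in auto)
  have "0 < c s + S k" using eq[of s] \<delta>(1) X X_nonneg[of s] s by simp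
  from stays_above_X[OF less_imp_le[OF s] \<delta>(1) eq this] obtain \<rho> where \<rho>: "0 < \<rho>" "\<And>t. s \<le> t \<Longrightarrow> t < s + \<rho> \<Longrightarrow> 0 < X t"
    by blast
  have "0 \<le> s \<and> \<tau> k \<le> ereal s \<and> X s = 0"
  proof (rule ereal_Inf_mem[where P = "\<lambda>t. 0 \<le> t \<and> \<tau> k \<le> ereal t \<and> X t = 0", OF _ \<rho>(1)])
    show "Inf {ereal t | t. 0 \<le> t \<and> \<tau> k \<le> ereal t \<and> X t = 0} = ereal s" using T unfolding trigger_def .
    show "\<not> (0 \<le> t \<and> \<tau> k \<le> ereal t \<and> X t = 0)" if "s < t" "t < s + \<rho>" for t
      using \<rho>(2)[of t] that by simp
  qed
  then show False using X by simp
qed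

sublocale strictly_ordered_path
proof
  show "\<tau> (Suc k) < \<tau> (Suc (Suc k))" if "\<tau> (Suc k) < \<infinity>" for k
    using \<tau>_less_T[OF that] T_le[of "Suc k"] by (rule less_le_trans)
  show "left_level x\<^sub>0 X s = y" if k: "\<tau> (Suc k) = ereal s" and s: "0 < s" for k s
  proof -
    obtain \<rho> where \<rho>: "0 < \<rho>" "\<And>t. s < t \<Longrightarrow> t < s + \<rho> \<Longrightarrow> y < left_level x\<^sub>0 X t"
      using after_order_left_level[OF k yz] by blast
    have "0 \<le> s \<and> T k \<le> ereal s \<and> left_level x\<^sub>0 X s = y"
    proof (rule ereal_Inf_mem[where P = "\<lambda>t. 0 \<le> t \<and> T k \<le> ereal t \<and> left_level x\<^sub>0 X t = y", OF _ \<rho>(1)])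
      show "Inf {ereal t | t. 0 \<le> t \<and> T k \<le> ereal t \<and> left_level x\<^sub>0 X t = y} = ereal s"
        using k \<tau>_Suc_eq[of k] by simp
      show "\<not> (0 \<le> t \<and> T k \<le> ereal t \<and> left_level x\<^sub>0 X t = y)" if "s < t" "t < s + \<rho>" for t
        using \<rho>(2)[OF that] by simp
    qed
    then show ?thesis by simp
  qed
qed

text \<open>From the trigger to the next order the path is continuous and starts at 0. To exceed
  \<open>y\<close> it would have to pass \<open>y\<close> first, and that would have been the
  order.\<close>

lemma X_le_after_T:
  assumes t: "0 \<le> t" "T k \<le> ereal t" "ereal t < \<tau> (Suc k)"
  shows "X t \<le> y"
proof (rule ccontr)
  assume above: "\<not> X t \<le> y"
  have "\<tau> k \<le> T k" unfolding trigger_def by (rule Inf_greatest) auto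
  then have "0 \<le> T k" using \<tau>_nonneg[of k] by (rule order_trans[rotated])
  then obtain s where s: "T k = ereal s" using t(2) by (cases "T k") auto
  have st: "s \<le> t" using s t(2) by simp
  have \<tau>k: "\<tau> k < ereal s" by (rule \<tau>_less_of_T[OF s])
  have s0: "0 \<le> s" using le_less_trans[OF \<tau>_nonneg \<tau>k] by (simp add: zero_ereal_def)
  have btw: "\<tau> k < ereal a" "ereal a < \<tau> (Suc k)" if "s \<le> a" "a \<le> t" for a
  proof -
    show "\<tau> k < ereal a" using \<tau>k that(1) by (metis ereal_less_eq(3) less_le_trans)
    show "ereal a < \<tau> (Suc k)" using t(3) that(2) by (metis ereal_less_eq(3) le_less_trans)
  qed
  have X: "X a = c a + S k" if "s \<le> a" "a \<le> t" for a
    using X_between[of a k] btw[OF that] that s0 by simp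
  have "continuous_on {s..t} (\<lambda>a. c a + S k)"
    by (intro continuous_intros continuous_on_subset[OF c_cont]) (use s0 in auto)
  moreover have "c s + S k \<le> y" using X[of s] X_at_T[OF s] st y by simp
  moreover have "y \<le> c t + S k" using X[of t] above st by simp
  ultimately obtain a where a: "s \<le> a" "a \<le> t" "c a + S k = y" using IVT'[of "\<lambda>a. c a + S k" s y t] st by blast
  then have "X a = y" using X by simp
  then have "left_level x\<^sub>0 X a = y" using left_level_between[OF btw[OF a(1,2)]] by simp
  moreover have "T k \<le> ereal a" using s a by simp
  ultimately show False
    using ereal_Inf_not_before[OF btw(2)[OF a(1,2), unfolded \<tau>_Suc_eq[of k]]] a(1) s0 by simp
qed

lemma \<tau>_le_T: "\<tau> k \<le> T k"
  unfolding trigger_def by (rule Inf_greatest) auto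

text \<open>Only rational times enter, so that the mode of the policy is seen to be adapted.\<close>

lemma T_le_iff:
  assumes t: "0 \<le> t" and k: "\<tau> k \<le> ereal t" "ereal t < \<tau> (Suc k)"
  shows "T k \<le> ereal t \<longleftrightarrow> (\<forall>i. \<exists>q\<in>\<rat> \<inter> {0..t}. \<tau> k \<le> ereal q \<and> X q < inverse (real (Suc i)))"
proof
  assume T: "T k \<le> ereal t"
  have "0 \<le> T k" using \<tau>_nonneg[of k] \<tau>_le_T[of k] by (rule order_trans)
  then obtain s where s: "T k = ereal s" using T by (cases "T k") auto
  have st: "s \<le> t" using s T by simp
  have \<tau>k: "\<tau> k < ereal s" by (rule \<tau>_less_of_T[OF s])
  have s0: "0 < s" using le_less_trans[OF \<tau>_nonneg \<tau>k] by (simp add: zero_ereal_def)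
  obtain \<delta>' where \<delta>': "0 < \<delta>'" "\<And>a. s - \<delta>' < a \<Longrightarrow> \<tau> k < ereal a" using ereal_less_left[OF \<tau>k] by blast
  have X: "X a = c a + S k" if a: "0 \<le> a" "s - \<delta>' < a" "a \<le> s" for a
  proof (rule X_between)
    show "\<tau> k \<le> ereal a" using \<delta>'(2)[OF a(2)] by simp
    have "ereal a \<le> ereal t" using a(3) st by simp
    then show "ereal a < \<tau> (Suc k)" using k(2) by (rule le_less_trans)
  qed (rule a)
  show "\<forall>i. \<exists>q\<in>\<rat> \<inter> {0..t}. \<tau> k \<le> ereal q \<and> X q < inverse (real (Suc i))"
  proof
    fix i
    have "0 < inverse (real (Suc i))" by simp
    from continuous_on_atLeast_near[OF c_cont less_imp_le[OF s0] this] obtain \<delta> where \<delta>: "\<delta> > 0"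
      "\<And>a. a \<ge> 0 \<Longrightarrow> \<bar>a - s\<bar> < \<delta> \<Longrightarrow> \<bar>c a - c s\<bar> < inverse (real (Suc i))" by blast
    have "max 0 (s - min \<delta> \<delta>') < s" using s0 \<delta>(1) \<delta>'(1) by simp
    then obtain q where q: "q \<in> \<rat>" "max 0 (s - min \<delta> \<delta>') < q" "q < s" using Rats_dense_in_real by blast
    then have q': "0 \<le> q" "s - \<delta>' < q" "\<bar>q - s\<bar> < \<delta>" by auto
    have "X q - X s = c q - c s" using X[OF q'(1,2)] X[of s] q(3) s0 \<delta>'(1) by simp
    then have "X q < inverse (real (Suc i))" using \<delta>(2)[OF q'(1,3)] X_at_T[OF s] by linarith
    then show "\<exists>q\<in>\<rat> \<inter> {0..t}. \<tau> k \<le> ereal q \<and> X q < inverse (real (Suc i))"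
      using q q' st \<delta>'(2)[OF q'(2)] by (intro bexI[of _ q]) auto
  qed
next
  assume near: "\<forall>i. \<exists>q\<in>\<rat> \<inter> {0..t}. \<tau> k \<le> ereal q \<and> X q < inverse (real (Suc i))"
  show "T k \<le> ereal t"
  proof (rule ccontr)
    assume "\<not> T k \<le> ereal t"
    then have T: "ereal t < T k" by simp
    obtain r where r: "\<tau> k = ereal r" using k(1) \<tau>_nonneg[of k] by (cases "\<tau> k") auto
    have r0: "0 \<le> r" "r \<le> t" using \<tau>_nonneg[of k] r k(1) by (simp_all add: zero_ereal_def)
    have X: "X a = c a + S k" "0 < X a" if a: "r \<le> a" "a \<le> t" for a
    proof -
      have a0: "0 \<le> a" using a r0 by simp
      have le: "\<tau> k \<le> ereal a" "ereal a \<le> ereal t" using a r by simp_all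
      show "X a = c a + S k" using X_between[OF a0 le(1)] le_less_trans[OF le(2) k(2)] by simp
      show "0 < X a" using X_pos_before_T[OF a0 le(1)] le_less_trans[OF le(2) T] by simp
    qed
    \<comment> \<open>Conversely, if 0 has not been hit, the path has a positive minimum on the
      compact interval since the last order, so it cannot come arbitrarily close to 0.\<close>
    have "continuous_on {r..t} (\<lambda>a. c a + S k)"
      by (intro continuous_intros continuous_on_subset[OF c_cont]) (use r0 in auto)
    then have "\<exists>a\<in>{r..t}. \<forall>b\<in>{r..t}. c a + S k \<le> c b + S k"
      by (intro continuous_attains_inf) (use r0 in auto)
    then obtain a where a: "r \<le> a" "a \<le> t" "\<And>b. r \<le> b \<Longrightarrow> b \<le> t \<Longrightarrow> X a \<le> X b"
      using X(1) by (metis atLeastAtMost_iff)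
    obtain i where i: "inverse (real (Suc i)) < X a" using reals_Archimedean[OF X(2)[OF a(1,2)]] by blast
    obtain q where "q \<in> \<rat> \<inter> {0..t}" "\<tau> k \<le> ereal q" "X q < inverse (real (Suc i))" using near by blast
    then show False using a(3)[of q] i r by simp
  qed
qed

text \<open>The rational criterion takes the place of the trigger time, an infimum over uncountably
  many times.\<close>

definition Mo :: "real \<Rightarrow> real" where
  "Mo t = (if \<exists>k. \<tau> k \<le> ereal t \<and> ereal t < \<tau> (Suc k) \<and>
     (\<forall>i. \<exists>q\<in>\<rat> \<inter> {0..t}. \<tau> k \<le> ereal q \<and> X q < inverse (real (Suc i))) then 1 else 0)"

lemma Mo_eq:
  assumes k: "\<tau> k \<le> ereal t" "ereal t < \<tau> (Suc k)"
  shows "Mo t = (if T k \<le> ereal t then 1 else 0)"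
proof -
  have t: "0 \<le> t" using order_trans[OF \<tau>_nonneg k(1)] by (simp add: zero_ereal_def)
  have "j = k" if "\<tau> j \<le> ereal t" "ereal t < \<tau> (Suc j)" for j
    using N_eq[OF that] N_eq[OF k] by simp
  then have "(\<exists>k. \<tau> k \<le> ereal t \<and> ereal t < \<tau> (Suc k) \<and>
     (\<forall>i. \<exists>q\<in>\<rat> \<inter> {0..t}. \<tau> k \<le> ereal q \<and> X q < inverse (real (Suc i)))) \<longleftrightarrow> T k \<le> ereal t"
    using T_le_iff[OF t k] k by metis
  then show ?thesis unfolding Mo_def by simp
qed

lemma X_pos_of_Mo_0:
  assumes "0 \<le> t" "Mo t = 0" shows "0 < X t"
proof -
  obtain k where k: "\<tau> k \<le> ereal t" "ereal t < \<tau> (Suc k)" using current_order[OF assms(1)] .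
  then show ?thesis using X_pos_before_T[OF assms(1) k(1)] Mo_eq[OF k] assms(2) by (simp add: not_le split: if_splits)
qed

text \<open>After the trigger the level is at most \<open>y\<close>, so s = t serves. Before it the
  path has been positive since the last order, so \<open>L\<close> has not moved and the rise is
  that of the free path.\<close>

lemma dominated:
  assumes t: "0 \<le> t"
  shows "\<exists>s\<in>{0..t}. X t - max X_init z \<le> (\<sigma> * w t - \<mu> * t) - (\<sigma> * w s - \<mu> * s)"
proof -
  obtain k where k: "\<tau> k \<le> ereal t" "ereal t < \<tau> (Suc k)" using current_order[OF t] .
  show ?thesis
  proof (cases "T k \<le> ereal t")
    case True
    then have "X t \<le> max X_init z" using X_le_after_T[OF t True k(2)] yz by simp
    then show ?thesis using t by (intro bexI[of _ t]) auto
  next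
    case False
    obtain s where s: "0 \<le> s" "s \<le> t" "\<tau> k = ereal s" "X s \<le> max X_init z" "X t - X s = c t - c s"
      using last_order[OF t k] by blast
    have "0 < X u" if "s \<le> u" "u \<le> t" for u
    proof (rule X_pos_before_T[of u k])
      show "ereal u < T k" using False that(2) by (metis ereal_less_eq(3) leI le_less_trans)
    qed (use s that in auto)
    then have "L t = L s" by (rule L_flat[OF s(1,2)])
    then have "c t - c s = (\<sigma> * w t - \<mu> * t) - (\<sigma> * w s - \<mu> * s)" unfolding c_def by simp
    moreover have "X t - max X_init z \<le> c t - c s" using s by linarith
    ultimately have "X t - max X_init z \<le> (\<sigma> * w t - \<mu> * t) - (\<sigma> * w s - \<mu> * s)" by simp
    then show ?thesis using s(1,2) by (intro bexI[of _ s]) simp_all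
  qed
qed

lemma \<tau>_1_pos: "0 < \<tau> (Suc 0)"
  using \<tau>_less_T[of 0] T_le[of 0] \<tau>_0 by auto

lemma N_0: "N 0 = 0"
  using X_init_cases \<tau>_1_pos by auto

sublocale triggered: triggered_path \<mu> \<sigma> X_init y z w X L n Mo
proof
  show "Mo 0 = 0"
  proof -
    have "Mo 0 = (if T 0 \<le> ereal 0 then 1 else 0)"
      by (rule Mo_eq) (use \<tau>_0 \<tau>_1_pos in \<open>simp_all add: zero_ereal_def\<close>)
    then show ?thesis using \<tau>_less_T[of 0] \<tau>_0 by (simp add: zero_ereal_def not_le[symmetric])
  qed
  fix s :: real
  show "Mo s = 0 \<or> Mo s = 1" unfolding Mo_def by simp
  show "0 \<le> s \<Longrightarrow> Mo s = 0 \<Longrightarrow> 0 < X s" by (rule X_pos_of_Mo_0)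
  show "X s \<le> y" if s: "0 \<le> s" and Mo: "Mo s = 1"
  proof -
    obtain k where k: "\<tau> k \<le> ereal s" "ereal s < \<tau> (Suc k)" using current_order[OF s] .
    then have "T k \<le> ereal s" using Mo_eq[OF k] Mo by (simp split: if_splits)
    then show ?thesis by (rule X_le_after_T[OF s _ k(2)])
  qed
  show "\<exists>\<delta>>0. \<forall>t. s \<le> t \<and> t < s + \<delta> \<longrightarrow> (n t, Mo t) = (n s, Mo s)" if s: "0 \<le> s"
  proof -
    obtain k where k: "\<tau> k \<le> ereal s" "ereal s < \<tau> (Suc k)" using current_order[OF s] .
    obtain \<delta>1 where \<delta>1: "0 < \<delta>1" "\<And>t. t < s + \<delta>1 \<Longrightarrow> ereal t < \<tau> (Suc k)" using ereal_less_right[OF k(2)] by blast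
    have "\<exists>\<delta>>0. \<forall>t. s \<le> t \<and> t < s + \<delta> \<longrightarrow> (T k \<le> ereal t \<longleftrightarrow> T k \<le> ereal s)"
    proof (cases "T k \<le> ereal s")
      case True
      have "T k \<le> ereal t" if "s \<le> t" for t using True that by (metis ereal_less_eq(3) order_trans)
      then show ?thesis using True by (intro exI[of _ 1]) auto
    next
      case False
      then have "ereal s < T k" by simp
      then obtain \<delta> where \<delta>: "0 < \<delta>" "\<And>t. t < s + \<delta> \<Longrightarrow> ereal t < T k" using ereal_less_right by blast
      have "\<not> T k \<le> ereal t" if "t < s + \<delta>" for t using \<delta>(2)[OF that] by simp
      then show ?thesis using False \<delta>(1) by blast
    qed
    then obtain \<delta>2 where \<delta>2: "0 < \<delta>2" "\<And>t. s \<le> t \<Longrightarrow> t < s + \<delta>2 \<Longrightarrow> (T k \<le> ereal t \<longleftrightarrow> T k \<le> ereal s)" by blast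
    have "(n t, Mo t) = (n s, Mo s)" if "s \<le> t \<and> t < s + min \<delta>1 \<delta>2" for t
    proof -
      have 1: "\<tau> k \<le> ereal t" using k(1) that by (metis ereal_less_eq(3) order_trans)
      have t: "s \<le> t" "t < s + \<delta>1" "t < s + \<delta>2" using that by (auto simp: min_def split: if_splits)
      have 2: "ereal t < \<tau> (Suc k)" using \<delta>1(2)[OF t(2)] .
      show ?thesis
        unfolding n_def N_eq[OF k] N_eq[OF 1 2] Mo_eq[OF k] Mo_eq[OF 1 2] using \<delta>2(2)[OF t(1,3)] by simp
    qed
    moreover have "0 < min \<delta>1 \<delta>2" using \<delta>1 \<delta>2 by simp
    ultimately show ?thesis by blast
  qed
  show "(\<exists>\<delta>>0. \<forall>t. 0 \<le> t \<and> s - \<delta> < t \<and> t < s \<longrightarrow> (n t, Mo t) = (n s, Mo s)) \<or>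
      (X s = 0 \<and> Mo s = 1 \<and> (\<exists>\<delta>>0. \<forall>t. 0 \<le> t \<and> s - \<delta> < t \<and> t < s \<longrightarrow> (n t, Mo t) = (n s, 0))) \<or>
      (X s = z \<and> Mo s = 0 \<and> (\<exists>\<delta>>0. \<forall>t. 0 \<le> t \<and> s - \<delta> < t \<and> t < s \<longrightarrow> (n t, Mo t) = (n s - 1, 1)))"
    if s: "0 < s"
  proof -
    have s0: "0 \<le> s" using s by simp
    obtain k where k: "\<tau> k \<le> ereal s" "ereal s < \<tau> (Suc k)" using current_order[OF s0] .
    have before: "ereal t < \<tau> (Suc k)" if "t < s" for t
      using k(2) that by (metis less_ereal.simps(1) less_trans)
    \<comment> \<open>The four positions of \<open>s\<close> in its cycle: at an order, after the
      trigger, at the trigger, before the trigger.\<close>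
    consider "\<tau> k = ereal s" | "\<tau> k < ereal s" "T k < ereal s" | "\<tau> k < ereal s" "T k = ereal s"
      | "\<tau> k < ereal s" "ereal s < T k" using k(1) by (metis less_linear order.not_eq_order_implies_strict)
    then show ?thesis
    proof cases
      case 1
      then have "k \<noteq> 0" using s \<tau>_0 by (intro notI) (simp add: zero_ereal_def)
      then obtain j where j: "k = Suc j" by (cases k) auto
      have \<tau>j: "\<tau> (Suc j) = ereal s" using 1 j by simp
      have "Mo s = 0" using Mo_eq[OF k] \<tau>_less_T[of k] 1 by simp
      have "\<tau> j < ereal s" using before_order[OF \<tau>j] s \<tau>_0 by (auto simp: zero_ereal_def)
      then have "T j < ereal s"
      proof -
        have "T j \<noteq> ereal s" using T_less[of j s] \<tau>j by auto
        then show ?thesis using T_le[of j] \<tau>j by (simp add: order.not_eq_order_implies_strict)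
      qed
      then obtain \<delta> where \<delta>: "0 < \<delta>" "\<And>t. s - \<delta> < t \<Longrightarrow> T j < ereal t" using ereal_less_left by blast
      have "(n t, Mo t) = (n s - 1, 1)" if t: "0 \<le> t \<and> s - \<delta> < t \<and> t < s" for t
      proof -
        have T: "T j < ereal t" using \<delta>(2) t by simp
        have a: "\<tau> j \<le> ereal t" using \<tau>_le_T[of j] T by (metis less_imp_le order_trans)
        have b: "ereal t < \<tau> (Suc j)" using \<tau>j t by simp
        show ?thesis unfolding n_def N_eq[OF k] N_eq[OF a b] Mo_eq[OF a b] j using T by simp
      qed
      then show ?thesis using \<delta>(1) X_at_order[OF \<tau>j] \<open>Mo s = 0\<close> by blast
    next
      case 2
      obtain \<delta> where \<delta>: "0 < \<delta>" "\<And>t. s - \<delta> < t \<Longrightarrow> T k < ereal t" using ereal_less_left[OF 2(2)] by blast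
      have "(n t, Mo t) = (n s, Mo s)" if t: "0 \<le> t \<and> s - \<delta> < t \<and> t < s" for t
      proof -
        have T: "T k < ereal t" using \<delta>(2) t by simp
        have a: "\<tau> k \<le> ereal t" using \<tau>_le_T[of k] T by (metis less_imp_le order_trans)
        have b: "ereal t < \<tau> (Suc k)" using before t by simp
        show ?thesis unfolding n_def N_eq[OF k] N_eq[OF a b] Mo_eq[OF a b] Mo_eq[OF k] using T 2 by (simp add: less_imp_le)
      qed
      then show ?thesis using \<delta>(1) by blast
    next
      case 3
      obtain \<delta> where \<delta>: "0 < \<delta>" "\<And>t. s - \<delta> < t \<Longrightarrow> \<tau> k < ereal t" using ereal_less_left[OF 3(1)] by blast
      have "(n t, Mo t) = (n s, 0)" if t: "0 \<le> t \<and> s - \<delta> < t \<and> t < s" for t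
      proof -
        have a: "\<tau> k \<le> ereal t" using \<delta>(2) t by (simp add: less_imp_le)
        have b: "ereal t < \<tau> (Suc k)" using before t by simp
        show ?thesis unfolding n_def N_eq[OF k] N_eq[OF a b] Mo_eq[OF a b] using 3(2) t by simp
      qed
      moreover have "Mo s = 1" using Mo_eq[OF k] 3(2) by simp
      ultimately show ?thesis using \<delta>(1) X_at_T[OF 3(2)] by blast
    next
      case 4
      obtain \<delta> where \<delta>: "0 < \<delta>" "\<And>t. s - \<delta> < t \<Longrightarrow> \<tau> k < ereal t" using ereal_less_left[OF 4(1)] by blast
      have "(n t, Mo t) = (n s, Mo s)" if t: "0 \<le> t \<and> s - \<delta> < t \<and> t < s" for t
      proof -
        have a: "\<tau> k \<le> ereal t" using \<delta>(2) t by (simp add: less_imp_le)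
        have b: "ereal t < \<tau> (Suc k)" using before t by simp
        have "ereal t < ereal s" using t by simp
        then have "ereal t < T k" using 4(2) by (rule less_trans)
        then show ?thesis unfolding n_def N_eq[OF k] N_eq[OF a b] Mo_eq[OF a b] Mo_eq[OF k]
          using 4(2) by (simp add: not_le[symmetric])
      qed
      then show ?thesis using \<delta>(1) by blast
    qed
  qed
  show "mono_on {0..} (\<lambda>t. n t + Mo t)"
  proof (rule mono_onI)
    fix a b :: real assume ab: "a \<in> {0..}" "b \<in> {0..}" "a \<le> b"
    then have a0: "0 \<le> a" and b0: "0 \<le> b" by auto
    obtain k where k: "\<tau> k \<le> ereal a" "ereal a < \<tau> (Suc k)" using current_order[OF a0] .
    obtain l where l: "\<tau> l \<le> ereal b" "ereal b < \<tau> (Suc l)" using current_order[OF b0] .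
    have "real k \<le> real l" using N_mono[OF a0 ab(3)] N_eq[OF k] N_eq[OF l] by simp
    then consider "k = l" | "k < l" by linarith
    then show "n a + Mo a \<le> n b + Mo b"
    proof cases
      case 1
      have "T l \<le> ereal b" if "T l \<le> ereal a" using that ab(3) by (metis ereal_less_eq(3) order_trans)
      then show ?thesis unfolding n_def N_eq[OF k] N_eq[OF l] Mo_eq[OF k] Mo_eq[OF l] using 1 by simp
    next
      case 2
      \<comment> \<open>At least one order intervenes, and its count outweighs the fall of the mode
        from 1 to 0.\<close>
      have "Mo a \<le> 1" "0 \<le> Mo b" unfolding Mo_def by auto
      moreover have "real k + 1 \<le> real l" using 2 by simp
      ultimately show ?thesis unfolding n_def N_eq[OF k] N_eq[OF l] by linarith
    qed
  qed
qed

end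


section \<open>Moment identities for controlled inventories\<close>

context brownian
begin

lemma
  assumes t: "0 \<le> t"
  shows W_square_integrable: "integrable M (\<lambda>\<omega>. (W t \<omega>)\<^sup>2)"
    and expectation_W: "expectation (W t) = 0"
    and expectation_W_square: "expectation (\<lambda>\<omega>. (W t \<omega>)\<^sup>2) = t"
proof -
  have "integrable M (\<lambda>\<omega>. (W t \<omega>)\<^sup>2) \<and> expectation (W t) = 0 \<and> expectation (\<lambda>\<omega>. (W t \<omega>)\<^sup>2) = t"
  proof (cases "t = 0")
    case True
    have 1: "AE \<omega> in M. W t \<omega> = 0" using AE_W True by auto
    then have 2: "AE \<omega> in M. (W t \<omega>)\<^sup>2 = 0" by auto
    have "integrable M (\<lambda>\<omega>. (W t \<omega>)\<^sup>2) \<longleftrightarrow> integrable M (\<lambda>_. 0 :: real)"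
      by (rule integrable_cong_AE) (use t 2 in auto)
    moreover have "expectation (W t) = expectation (\<lambda>_. 0)" by (rule integral_cong_AE) (use t 1 in auto)
    moreover have "expectation (\<lambda>\<omega>. (W t \<omega>)\<^sup>2) = expectation (\<lambda>_. 0)" by (rule integral_cong_AE) (use t 2 in auto)
    ultimately show ?thesis using True by simp
  next
    case False
    then have pos: "0 < t" using t by simp
    have 1: "AE \<omega> in M. W t \<omega> = W t \<omega> - W 0 \<omega>" using AE_W by auto
    then have 2: "AE \<omega> in M. (W t \<omega>)\<^sup>2 = (W t \<omega> - W 0 \<omega>)\<^sup>2" by auto
    have "integrable M (\<lambda>\<omega>. (W t \<omega>)\<^sup>2) \<longleftrightarrow> integrable M (\<lambda>\<omega>. (W t \<omega> - W 0 \<omega>)\<^sup>2)"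
      by (rule integrable_cong_AE) (use t 2 in auto)
    moreover have "expectation (W t) = expectation (\<lambda>\<omega>. W t \<omega> - W 0 \<omega>)"
      by (rule integral_cong_AE) (use t 1 in auto)
    moreover have "expectation (\<lambda>\<omega>. (W t \<omega>)\<^sup>2) = expectation (\<lambda>\<omega>. (W t \<omega> - W 0 \<omega>)\<^sup>2)"
      by (rule integral_cong_AE) (use t 2 in auto)
    ultimately show ?thesis
      using integrable_increment_sq[OF order_refl pos] expectation_increment[OF order_refl pos]
        expectation_increment_sq[OF order_refl pos] by simp
  qed
  then show "integrable M (\<lambda>\<omega>. (W t \<omega>)\<^sup>2)" "expectation (W t) = 0" "expectation (\<lambda>\<omega>. (W t \<omega>)\<^sup>2) = t" by auto
qed

end

text \<open>The constant \<open>C\<^sub>0\<close> bounds the level at the start of a cycle.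
  Adaptedness is asked of \<open>X\<close>, which enters the integrands; of \<open>L\<close> and
  \<open>n\<close> only expectations are taken.\<close>

locale inventory_model = brownian +
  fixes \<mu> \<sigma> X\<^sub>0 y z C\<^sub>0 :: real and X L n :: "real \<Rightarrow> 'a \<Rightarrow> real"
  assumes mu: "0 < \<mu>" and sigma: "0 < \<sigma>" and yz: "0 \<le> y" "y < z" and C0: "0 \<le> C\<^sub>0"
    and path: "AE \<omega> in M. regulated_path \<mu> \<sigma> X\<^sub>0 y z (\<lambda>t. W t \<omega>) (\<lambda>t. X t \<omega>) (\<lambda>t. L t \<omega>) (\<lambda>t. n t \<omega>)"
    and X_Fil: "\<And>t. 0 \<le> t \<Longrightarrow> X t \<in> borel_measurable (Fil t)"
    and L_meas: "\<And>t. 0 \<le> t \<Longrightarrow> L t \<in> borel_measurable M"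
    and n_meas: "\<And>t. 0 \<le> t \<Longrightarrow> n t \<in> borel_measurable M"
    and dominated: "AE \<omega> in M. \<forall>t\<ge>0. \<exists>s\<in>{0..t}. X t \<omega> - C\<^sub>0 \<le> (\<sigma> * W t \<omega> - \<mu> * t) - (\<sigma> * W s \<omega> - \<mu> * s)"
begin

lemma X_meas: "0 \<le> t \<Longrightarrow> X t \<in> borel_measurable M"
  using Fil_measurable[OF X_Fil] .

text \<open>The excess over \<open>C\<^sub>0\<close> is dominated by a rise of the free path, whose
  second moment is bounded uniformly in time.\<close>

lemma X_square_bound: "\<exists>K\<ge>0. \<forall>t\<ge>0. integrable M (\<lambda>\<omega>. (X t \<omega>)\<^sup>2) \<and> expectation (\<lambda>\<omega>. (X t \<omega>)\<^sup>2) \<le> K"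
proof -
  define m where "m = 2 * \<mu> / \<sigma>\<^sup>2"
  define C where "C = 8 / m\<^sup>2 * exp (m / 2) / (1 - exp (- m / 2))"
  have m: "m > 0" unfolding m_def using mu sigma by simp
  have C: "0 \<le> C" unfolding C_def using m by simp
  define K where "K = 2 * C\<^sub>0\<^sup>2 + 2 * C"
  have K: "0 \<le> K" unfolding K_def using C by simp
  have main: "integrable M (\<lambda>\<omega>. (X t \<omega>)\<^sup>2) \<and> expectation (\<lambda>\<omega>. (X t \<omega>)\<^sup>2) \<le> K" if t: "0 \<le> t" for t
  proof -
    have Xm[measurable]: "X t \<in> borel_measurable M" using X_meas[OF t] .
    have Zm: "(\<lambda>\<omega>. X t \<omega> - C\<^sub>0) \<in> borel_measurable M" by simp
    have "AE \<omega> in M. \<exists>s\<in>{0..t}. X t \<omega> - C\<^sub>0 \<le> (\<sigma> * W t \<omega> - \<mu> * t) - (\<sigma> * W s \<omega> - \<mu> * s)"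
      using dominated by eventually_elim (use t in blast)
    from drift_range_square_bound[OF mu sigma t Zm this]
    have tail: "(\<integral>\<^sup>+\<omega>. ennreal ((max 0 (X t \<omega> - C\<^sub>0))\<^sup>2) \<partial>M) \<le> ennreal C" unfolding C_def m_def .
    have "(\<integral>\<^sup>+\<omega>. ennreal ((X t \<omega>)\<^sup>2) \<partial>M)
      \<le> (\<integral>\<^sup>+\<omega>. ennreal (2 * C\<^sub>0\<^sup>2) + ennreal 2 * ennreal ((max 0 (X t \<omega> - C\<^sub>0))\<^sup>2) \<partial>M)"
    proof (rule nn_integral_mono_AE)
      show "AE \<omega> in M. ennreal ((X t \<omega>)\<^sup>2) \<le> ennreal (2 * C\<^sub>0\<^sup>2) + ennreal 2 * ennreal ((max 0 (X t \<omega> - C\<^sub>0))\<^sup>2)"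
        using path
      proof eventually_elim
        case (elim \<omega>)
        then have X0: "0 \<le> X t \<omega>" using t by (rule regulated_path.X_nonneg)
        define b where "b = max 0 (X t \<omega> - C\<^sub>0)"
        have "X t \<omega> \<le> C\<^sub>0 + b" unfolding b_def by simp
        then have "(X t \<omega>)\<^sup>2 \<le> (C\<^sub>0 + b)\<^sup>2" using X0 by (rule power_mono)
        also have "\<dots> \<le> 2 * C\<^sub>0\<^sup>2 + 2 * b\<^sup>2"
          using zero_le_power2[of "C\<^sub>0 - b"] unfolding power2_sum power2_diff by linarith
        finally have "ennreal ((X t \<omega>)\<^sup>2) \<le> ennreal (2 * C\<^sub>0\<^sup>2 + 2 * b\<^sup>2)" by (rule ennreal_leI)
        then show ?case unfolding b_def by (simp add: ennreal_plus ennreal_mult)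
      qed
    qed
    also have "\<dots> = ennreal (2 * C\<^sub>0\<^sup>2) + ennreal 2 * (\<integral>\<^sup>+\<omega>. ennreal ((max 0 (X t \<omega> - C\<^sub>0))\<^sup>2) \<partial>M)"
      by (subst nn_integral_add) (simp_all add: nn_integral_cmult emeasure_space_1)
    also have "\<dots> \<le> ennreal (2 * C\<^sub>0\<^sup>2) + ennreal 2 * ennreal C"
      by (intro add_left_mono mult_left_mono tail) simp
    also have "\<dots> = ennreal K" unfolding K_def using C by (simp add: ennreal_plus ennreal_mult)
    finally have le: "(\<integral>\<^sup>+\<omega>. ennreal ((X t \<omega>)\<^sup>2) \<partial>M) \<le> ennreal K" .
    then have i: "integrable M (\<lambda>\<omega>. (X t \<omega>)\<^sup>2)"
      by (intro integrableI_bounded) (auto simp: ennreal_less_top intro: le_less_trans)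
    moreover have "expectation (\<lambda>\<omega>. (X t \<omega>)\<^sup>2) \<le> K"
      using le i K by (subst (asm) nn_integral_eq_integral) auto
    ultimately show ?thesis ..
  qed
  show ?thesis using K main by blast
qed

lemma X_square_integrable: "0 \<le> t \<Longrightarrow> integrable M (\<lambda>\<omega>. (X t \<omega>)\<^sup>2)"
  using X_square_bound by blast

lemma X_integrable: "0 \<le> t \<Longrightarrow> integrable M (X t)"
  using integrable_of_square[OF X_meas X_square_integrable] .

lemma W_integrable: "0 \<le> t \<Longrightarrow> integrable M (W t)"
  using integrable_of_square[OF W_measurable W_square_integrable] .

text \<open>\<open>L\<close> and \<open>(z - y) * n\<close> are nonnegative and their sum is
  integrable by the balance equation, so each is integrable.\<close>

lemma
  assumes t: "0 \<le> t"
  shows L_integrable: "integrable M (L t)" and n_integrable: "integrable M (n t)"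
    and expectation_X: "expectation (X t) = X\<^sub>0 - \<mu> * t + expectation (L t) + (z - y) * expectation (n t)"
proof -
  have nonneg: "AE \<omega> in M. 0 \<le> L t \<omega> \<and> 0 \<le> n t \<omega> \<and>
    X t \<omega> = X\<^sub>0 - \<mu> * t + \<sigma> * W t \<omega> + L t \<omega> + (z - y) * n t \<omega>"
    using path
  proof eventually_elim
    case (elim \<omega>)
    interpret regulated_path \<mu> \<sigma> X\<^sub>0 y z "\<lambda>t. W t \<omega>" "\<lambda>t. X t \<omega>" "\<lambda>t. L t \<omega>" "\<lambda>t. n t \<omega>" by (rule elim)
    show ?case using X_eq[OF t] L_le[of 0 t] n_le[of 0 t] L_0 n_0 t by simp
  qed
  define A where "A \<omega> = X t \<omega> - X\<^sub>0 + \<mu> * t - \<sigma> * W t \<omega>" for \<omega>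
  have A: "integrable M A" unfolding A_def using X_integrable[OF t] W_integrable[OF t] by simp
  have zy: "0 < z - y" using yz by simp
  show iL: "integrable M (L t)"
  proof (rule Bochner_Integration.integrable_bound[OF A L_meas[OF t]])
    show "AE \<omega> in M. norm (L t \<omega>) \<le> norm (A \<omega>)"
      using nonneg
    proof eventually_elim
      case (elim \<omega>)
      then have "0 \<le> (z - y) * n t \<omega>" using zy by simp
      then show ?case using elim unfolding A_def by simp
    qed
  qed
  have "integrable M (\<lambda>\<omega>. (A \<omega> - L t \<omega>) / (z - y))" using A iL by simp
  moreover have eq: "AE \<omega> in M. n t \<omega> = (A \<omega> - L t \<omega>) / (z - y)"
    using nonneg by eventually_elim (use zy in \<open>simp add: A_def field_simps\<close>)
  ultimately show inn: "integrable M (n t)"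
    using integrable_cong_AE[OF n_meas[OF t] _ eq] by (simp add: borel_measurable_integrable)
  have "expectation (X t) = expectation (\<lambda>\<omega>. X\<^sub>0 - \<mu> * t + \<sigma> * W t \<omega> + L t \<omega> + (z - y) * n t \<omega>)"
    using nonneg X_meas[OF t] L_meas[OF t] n_meas[OF t] W_measurable[OF t] by (intro integral_cong_AE) auto
  also have "\<dots> = X\<^sub>0 - \<mu> * t + expectation (L t) + (z - y) * expectation (n t)"
    using iL inn W_integrable[OF t] expectation_W[OF t] by (simp add: prob_space)
  finally show "expectation (X t) = X\<^sub>0 - \<mu> * t + expectation (L t) + (z - y) * expectation (n t)" .
qed

text \<open>The time integral of \<open>X\<close> is recovered as a limit of martingale transforms:
  this gives a measurable version \<open>I\<close> and, since the limit has mean zero, its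
  expectation. The summand \<open>\<sigma>\<^sup>2 * t\<close> is the second moment of
  \<open>\<sigma> * W t\<close>.\<close>

lemma occupation_integral:
  assumes t: "0 < t"
  obtains I where "integrable M I" "AE \<omega> in M. integral {0..t} (\<lambda>s. X s \<omega>) = I \<omega>"
    "\<mu> * expectation I = (X\<^sub>0\<^sup>2 + (z\<^sup>2 - y\<^sup>2) * expectation (n t) + \<sigma>\<^sup>2 * t - expectation (\<lambda>\<omega>. (X t \<omega>)\<^sup>2)) / 2"
proof -
  have t0: "0 \<le> t" using t by simp
  define \<xi> where "\<xi> u \<omega> = (X u \<omega> - \<sigma> * W u \<omega>) * \<sigma>" for u \<omega>
  define S where "S k \<omega> = (\<Sum>i<Suc k. \<xi> (t * real i / real (Suc k)) \<omega> *
      (W (t * real (Suc i) / real (Suc k)) \<omega> - W (t * real i / real (Suc k)) \<omega>))" for k \<omega>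
  define R where "R \<omega> = ((X t \<omega>)\<^sup>2 - \<sigma>\<^sup>2 * (W t \<omega>)\<^sup>2) / 2 - (z\<^sup>2 - y\<^sup>2) / 2 * n t \<omega> - X\<^sub>0\<^sup>2 / 2" for \<omega>
  \<comment> \<open>Defined at every sample point, hence measurable; it is the true limit almost
    surely.\<close>
  define Z where "Z \<omega> = lim (\<lambda>k. S k \<omega>)" for \<omega>
  obtain K where K: "0 \<le> K" "\<And>u. 0 \<le> u \<Longrightarrow> expectation (\<lambda>\<omega>. (X u \<omega>)\<^sup>2) \<le> K"
    using X_square_bound by blast
  have \<xi>F: "\<xi> u \<in> borel_measurable (Fil u)" if "0 \<le> u" for u
    unfolding \<xi>_def using X_Fil[OF that] W_Fil[OF that order_refl] by simp
  have \<xi>m[measurable]: "\<xi> u \<in> borel_measurable M" if "0 \<le> u" for u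
    using Fil_measurable[OF \<xi>F[OF that]] .
  have Sm[measurable]: "S k \<in> borel_measurable M" for k
    unfolding S_def using t0 by (intro borel_measurable_sum borel_measurable_times borel_measurable_diff \<xi>m W_measurable) auto
  have Zm: "Z \<in> borel_measurable M" unfolding Z_def by measurable
  have lim: "AE \<omega> in M. (\<lambda>k. S k \<omega>) \<longlonglongrightarrow> R \<omega> + \<mu> * integral {0..t} (\<lambda>s. X s \<omega>)"
    using path
  proof eventually_elim
    case (elim \<omega>)
    interpret regulated_path \<mu> \<sigma> X\<^sub>0 y z "\<lambda>t. W t \<omega>" "\<lambda>t. X t \<omega>" "\<lambda>t. L t \<omega>" "\<lambda>t. n t \<omega>" by (rule elim)
    show ?case using quad_grid_sum[OF t] unfolding S_def \<xi>_def R_def by (simp add: algebra_simps)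
  qed
  have ZR: "AE \<omega> in M. Z \<omega> = R \<omega> + \<mu> * integral {0..t} (\<lambda>s. X s \<omega>)"
    using lim unfolding Z_def by eventually_elim (rule limI)
  have limZ: "AE \<omega> in M. (\<lambda>k. S k \<omega>) \<longlonglongrightarrow> Z \<omega>"
    using lim ZR by eventually_elim simp
  have \<xi>2: "integrable M (\<lambda>\<omega>. (\<xi> u \<omega>)\<^sup>2)" "expectation (\<lambda>\<omega>. (\<xi> u \<omega>)\<^sup>2) \<le> 2 * \<sigma>\<^sup>2 * (K + \<sigma>\<^sup>2 * t)"
    if u: "0 \<le> u" "u \<le> t" for u
  proof -
    have le: "(\<xi> u \<omega>)\<^sup>2 \<le> 2 * \<sigma>\<^sup>2 * ((X u \<omega>)\<^sup>2 + \<sigma>\<^sup>2 * (W u \<omega>)\<^sup>2)" for \<omega>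
    proof -
      have "(X u \<omega> - \<sigma> * W u \<omega>)\<^sup>2 \<le> 2 * ((X u \<omega>)\<^sup>2 + (\<sigma> * W u \<omega>)\<^sup>2)"
      proof -
        have "(a - b)\<^sup>2 \<le> 2 * (a\<^sup>2 + b\<^sup>2)" for a b :: real
          using zero_le_power2[of "a + b"] by (simp add: power2_sum power2_diff)
        then show ?thesis .
      qed
      then have "(X u \<omega> - \<sigma> * W u \<omega>)\<^sup>2 * \<sigma>\<^sup>2 \<le> 2 * ((X u \<omega>)\<^sup>2 + (\<sigma> * W u \<omega>)\<^sup>2) * \<sigma>\<^sup>2"
        by (intro mult_right_mono) auto
      then show ?thesis unfolding \<xi>_def power_mult_distrib by (simp add: algebra_simps)
    qed
    have i: "integrable M (\<lambda>\<omega>. 2 * \<sigma>\<^sup>2 * ((X u \<omega>)\<^sup>2 + \<sigma>\<^sup>2 * (W u \<omega>)\<^sup>2))"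
      using X_square_integrable[OF u(1)] W_square_integrable[OF u(1)] by simp
    show i2: "integrable M (\<lambda>\<omega>. (\<xi> u \<omega>)\<^sup>2)"
      by (rule Bochner_Integration.integrable_bound[OF i]) (use u \<xi>m le in \<open>auto intro: order_trans[OF le]\<close>)
    have "expectation (\<lambda>\<omega>. (\<xi> u \<omega>)\<^sup>2) \<le> expectation (\<lambda>\<omega>. 2 * \<sigma>\<^sup>2 * ((X u \<omega>)\<^sup>2 + \<sigma>\<^sup>2 * (W u \<omega>)\<^sup>2))"
      by (rule integral_mono[OF i2 i le])
    also have "\<dots> = 2 * \<sigma>\<^sup>2 * (expectation (\<lambda>\<omega>. (X u \<omega>)\<^sup>2) + \<sigma>\<^sup>2 * u)"
      using X_square_integrable[OF u(1)] W_square_integrable[OF u(1)] expectation_W_square[OF u(1)] by simp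
    also have "\<dots> \<le> 2 * \<sigma>\<^sup>2 * (K + \<sigma>\<^sup>2 * t)"
      using K(2)[OF u(1)] u by (intro mult_left_mono add_mono) auto
    finally show "expectation (\<lambda>\<omega>. (\<xi> u \<omega>)\<^sup>2) \<le> 2 * \<sigma>\<^sup>2 * (K + \<sigma>\<^sup>2 * t)" .
  qed
  \<comment> \<open>Plain Brownian increments: \<open>g\<close> ignores the cell length, and c = 1
    is the variance per unit time.\<close>
  have Z: "integrable M Z" "expectation Z = 0"
    using grid_transform_limit[where \<xi> = \<xi> and g = "\<lambda>d x. x" and c = 1 and Z = Z and K = "2 * \<sigma>\<^sup>2 * (K + \<sigma>\<^sup>2 * t)",
        OF t \<xi>F \<xi>2 _ _ _ _ Zm] limZ
    unfolding S_def
    by (simp_all add: integrable_increment_sq expectation_increment expectation_increment_sq)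
  have iR: "integrable M R"
    unfolding R_def using X_square_integrable[OF t0] W_square_integrable[OF t0] n_integrable[OF t0] by simp
  define I where "I \<omega> = (Z \<omega> - R \<omega>) / \<mu>" for \<omega>
  show thesis
  proof (rule that[of I])
    show "integrable M I" unfolding I_def using Z iR by simp
    show "AE \<omega> in M. integral {0..t} (\<lambda>s. X s \<omega>) = I \<omega>"
      using ZR unfolding I_def by eventually_elim (use mu in simp)
    have "\<mu> * expectation I = - expectation R" unfolding I_def using Z iR mu by simp
    also have "expectation R = (expectation (\<lambda>\<omega>. (X t \<omega>)\<^sup>2) - \<sigma>\<^sup>2 * t) / 2 - (z\<^sup>2 - y\<^sup>2) / 2 * expectation (n t) - X\<^sub>0\<^sup>2 / 2"
      unfolding R_def using X_square_integrable[OF t0] W_square_integrable[OF t0] n_integrable[OF t0]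
        expectation_W_square[OF t0] by (simp add: prob_space)
    finally show "\<mu> * expectation I =
      (X\<^sub>0\<^sup>2 + (z\<^sup>2 - y\<^sup>2) * expectation (n t) + \<sigma>\<^sup>2 * t - expectation (\<lambda>\<omega>. (X t \<omega>)\<^sup>2)) / 2"
      by (simp add: field_simps)
  qed
qed

end

section \<open>Exponential balance for the delayed policy\<close>

locale triggered_model = inventory_model +
  fixes Mo :: "real \<Rightarrow> 'a \<Rightarrow> real"
  assumes triggered: "AE \<omega> in M. triggered_path \<mu> \<sigma> X\<^sub>0 y z (\<lambda>t. W t \<omega>) (\<lambda>t. X t \<omega>) (\<lambda>t. L t \<omega>) (\<lambda>t. n t \<omega>) (\<lambda>t. Mo t \<omega>)"
    and Mo_Fil: "\<And>t. 0 \<le> t \<Longrightarrow> Mo t \<in> borel_measurable (Fil t)"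
begin

text \<open>The limit of the exponential transforms has mean zero. The bracket is then the mean of
  the switched function, which lies between 0 and \<open>exp (m * y)\<close> because mode 1 forces
  the level to be at most \<open>y\<close>; the same bound controls the integrand.\<close>

lemma local_time_balance:
  assumes t: "0 < t"
  defines "m \<equiv> 2 * \<mu> / \<sigma>\<^sup>2"
  shows "\<bar>m * expectation (L t) - (exp (m * y) - 1) * expectation (n t)\<bar> \<le> exp (m * y)"
proof -
  have t0: "0 \<le> t" using t by simp
  have m: "0 < m" unfolding m_def using mu sigma by simp
  have Mom: "Mo u \<in> borel_measurable M" if "0 \<le> u" for u using Fil_measurable[OF Mo_Fil[OF that]] .
  define \<xi> where "\<xi> u \<omega> = Mo u \<omega> * exp (m * X u \<omega>)" for u \<omega>
  define Z where "Z \<omega> = Mo t \<omega> * (exp (m * X t \<omega>) - 1) - m * L t \<omega> + (exp (m * y) - 1) * n t \<omega>" for \<omega>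
  have bounds: "AE \<omega> in M. \<forall>u\<ge>0. 0 \<le> \<xi> u \<omega> \<and> \<xi> u \<omega> \<le> exp (m * y) \<and>
      0 \<le> Mo u \<omega> * (exp (m * X u \<omega>) - 1) \<and> Mo u \<omega> * (exp (m * X u \<omega>) - 1) \<le> exp (m * y)"
    using triggered
  proof eventually_elim
    case (elim \<omega>)
    interpret P: triggered_path \<mu> \<sigma> X\<^sub>0 y z "\<lambda>t. W t \<omega>" "\<lambda>t. X t \<omega>" "\<lambda>t. L t \<omega>" "\<lambda>t. n t \<omega>" "\<lambda>t. Mo t \<omega>" by (rule elim)
    show ?case
    proof (intro allI impI)
      fix u :: real assume u: "0 \<le> u"
      show "0 \<le> \<xi> u \<omega> \<and> \<xi> u \<omega> \<le> exp (m * y) \<and>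
        0 \<le> Mo u \<omega> * (exp (m * X u \<omega>) - 1) \<and> Mo u \<omega> * (exp (m * X u \<omega>) - 1) \<le> exp (m * y)"
      proof (cases "Mo u \<omega> = 0")
        case False
        then have Mo: "Mo u \<omega> = 1" using P.Mo_01[OF u] by simp
        then have "m * X u \<omega> \<le> m * y" "0 \<le> m * X u \<omega>"
          using P.Mo_le[OF u] P.X_nonneg[OF u] m by simp_all
        then have "exp (m * X u \<omega>) \<le> exp (m * y)" "1 \<le> exp (m * X u \<omega>)" by simp_all
        then show ?thesis unfolding \<xi>_def Mo mult_1 by (intro conjI; linarith)
      qed (simp add: \<xi>_def)
    qed
  qed
  have \<xi>F: "\<xi> u \<in> borel_measurable (Fil u)" if "0 \<le> u" for u
    unfolding \<xi>_def using X_Fil[OF that] Mo_Fil[OF that] by simp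
  have \<xi>m: "\<xi> u \<in> borel_measurable M" if "0 \<le> u" for u using Fil_measurable[OF \<xi>F[OF that]] .
  have \<xi>2: "integrable M (\<lambda>\<omega>. (\<xi> u \<omega>)\<^sup>2)" "expectation (\<lambda>\<omega>. (\<xi> u \<omega>)\<^sup>2) \<le> (exp (m * y))\<^sup>2" if u: "0 \<le> u" "u \<le> t" for u
  proof -
    have ae: "AE \<omega> in M. (\<xi> u \<omega>)\<^sup>2 \<le> (exp (m * y))\<^sup>2"
      using bounds by eventually_elim (use u in \<open>auto intro: power_mono\<close>)
    show i: "integrable M (\<lambda>\<omega>. (\<xi> u \<omega>)\<^sup>2)"
      by (rule integrable_const_bound[of _ "(exp (m * y))\<^sup>2"]) (use ae \<xi>m[OF u(1)] in auto)
    have "expectation (\<lambda>\<omega>. (\<xi> u \<omega>)\<^sup>2) \<le> expectation (\<lambda>\<omega>. (exp (m * y))\<^sup>2)"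
      by (rule integral_mono_AE[OF i _ ae]) simp
    then show "expectation (\<lambda>\<omega>. (\<xi> u \<omega>)\<^sup>2) \<le> (exp (m * y))\<^sup>2" by (simp add: prob_space)
  qed
  define g where "g d x = exp (m * (\<sigma> * x - \<mu> * d)) - 1" for d x :: real
  have gm: "g d \<in> borel_measurable borel" for d unfolding g_def by measurable
  have ms: "(m * \<sigma>)\<^sup>2 = 2 * (m * \<mu>)" unfolding m_def using mu sigma by (simp add: power2_eq_square field_simps)
  have g: "integrable M (\<lambda>\<omega>. (g (v - u) (W v \<omega> - W u \<omega>))\<^sup>2)"
    "expectation (\<lambda>\<omega>. g (v - u) (W v \<omega> - W u \<omega>)) = 0"
    "expectation (\<lambda>\<omega>. (g (v - u) (W v \<omega> - W u \<omega>))\<^sup>2) \<le> 2 * (m * \<mu>) * exp (2 * (m * \<mu>) * t) * (v - u)"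
    if uv: "0 \<le> u" "u < v" "v \<le> t" for u v
  proof -
    define d where "d = v - u"
    have d: "0 < d" "d \<le> t" unfolding d_def using uv by auto
    define D where "D \<omega> = W v \<omega> - W u \<omega>" for \<omega>
    define e1 where "e1 \<omega> = exp (m * \<sigma> * D \<omega>) * exp (- (m * \<mu> * d))" for \<omega>
    define e2 where "e2 \<omega> = exp (2 * m * \<sigma> * D \<omega>) * exp (- (2 * m * \<mu> * d))" for \<omega>
    have i1: "integrable M e1" and i2: "integrable M e2"
      unfolding e1_def e2_def D_def using integrable_exp_increment[OF uv(1,2)] by simp_all
    have "expectation e1 = exp ((m * \<sigma>)\<^sup>2 * d / 2) * exp (- (m * \<mu> * d))"
      unfolding e1_def D_def d_def using expectation_exp_increment[OF uv(1,2), of "m * \<sigma>"] by simp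
    then have E1: "expectation e1 = 1" unfolding ms by (simp add: exp_add[symmetric])
    have "expectation e2 = exp ((2 * m * \<sigma>)\<^sup>2 * d / 2) * exp (- (2 * m * \<mu> * d))"
      unfolding e2_def D_def d_def using expectation_exp_increment[OF uv(1,2), of "2 * m * \<sigma>"] by simp
    also have "(2 * m * \<sigma>)\<^sup>2 = 4 * (m * \<sigma>)\<^sup>2" by (simp add: power2_eq_square)
    also have "exp (4 * (m * \<sigma>)\<^sup>2 * d / 2) * exp (- (2 * m * \<mu> * d)) = exp (2 * (m * \<mu>) * d)"
      unfolding ms by (simp add: exp_add[symmetric])
    finally have E2: "expectation e2 = exp (2 * (m * \<mu>) * d)" .
    have g1: "g (v - u) (W v \<omega> - W u \<omega>) = e1 \<omega> - 1" for \<omega>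
      unfolding g_def e1_def D_def d_def by (simp add: exp_add[symmetric] algebra_simps)
    have e12: "(e1 \<omega>)\<^sup>2 = e2 \<omega>" for \<omega>
      unfolding e1_def e2_def by (simp add: power_mult_distrib exp_double[symmetric] ac_simps)
    have g2: "(g (v - u) (W v \<omega> - W u \<omega>))\<^sup>2 = e2 \<omega> - 2 * e1 \<omega> + 1" for \<omega>
      unfolding g1 power2_diff e12 by simp
    show "integrable M (\<lambda>\<omega>. (g (v - u) (W v \<omega> - W u \<omega>))\<^sup>2)" unfolding g2 using i1 i2 by simp
    show "expectation (\<lambda>\<omega>. g (v - u) (W v \<omega> - W u \<omega>)) = 0" unfolding g1 using i1 E1 by (simp add: prob_space)
    have "expectation (\<lambda>\<omega>. (g (v - u) (W v \<omega> - W u \<omega>))\<^sup>2) = exp (2 * (m * \<mu>) * d) - 1"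
      unfolding g2 using i1 i2 E1 E2 by (simp add: prob_space)
    \<comment> \<open>From exp x - 1 \<le> x exp x: the second moment of an exponential increment is
      linear in the cell length, as the limit theorem for transforms demands.\<close>
    also have "\<dots> \<le> 2 * (m * \<mu>) * d * exp (2 * (m * \<mu>) * d)"
    proof -
      define x where "x = 2 * (m * \<mu>) * d"
      have "1 - x \<le> exp (- x)" using exp_ge_add_one_self[of "- x"] by simp
      then have "(1 - x) * exp x \<le> exp (- x) * exp x" by (intro mult_right_mono) auto
      then show ?thesis unfolding x_def[symmetric] by (simp add: exp_add[symmetric] algebra_simps)
    qed
    also have "\<dots> \<le> 2 * (m * \<mu>) * d * exp (2 * (m * \<mu>) * t)"
      using m mu d by (intro mult_left_mono) auto
    finally show "expectation (\<lambda>\<omega>. (g (v - u) (W v \<omega> - W u \<omega>))\<^sup>2) \<le> 2 * (m * \<mu>) * exp (2 * (m * \<mu>) * t) * (v - u)"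
      unfolding d_def[symmetric] by (simp only: ac_simps)
  qed
  have Zm: "Z \<in> borel_measurable M"
    unfolding Z_def using Mom[OF t0] X_meas[OF t0] L_meas[OF t0] n_meas[OF t0] by measurable
  have lim: "AE \<omega> in M. (\<lambda>k. \<Sum>i<Suc k. \<xi> (t * real i / real (Suc k)) \<omega> *
      g (t * real (Suc i) / real (Suc k) - t * real i / real (Suc k))
        (W (t * real (Suc i) / real (Suc k)) \<omega> - W (t * real i / real (Suc k)) \<omega>)) \<longlonglongrightarrow> Z \<omega>"
    using triggered
  proof eventually_elim
    case (elim \<omega>)
    interpret P: triggered_path \<mu> \<sigma> X\<^sub>0 y z "\<lambda>t. W t \<omega>" "\<lambda>t. X t \<omega>" "\<lambda>t. L t \<omega>" "\<lambda>t. n t \<omega>" "\<lambda>t. Mo t \<omega>" by (rule elim)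
    have "P.m = m" unfolding P.m_def m_def ..
    then show ?case using P.exp_grid_sum[OF t] unfolding \<xi>_def g_def Z_def by simp
  qed
  have Z: "expectation Z = 0"
    by (rule grid_transform_limit(2)[OF t \<xi>F \<xi>2 gm g Zm lim])
  define H where "H \<omega> = Mo t \<omega> * (exp (m * X t \<omega>) - 1)" for \<omega>
  have Hb: "AE \<omega> in M. 0 \<le> H \<omega> \<and> H \<omega> \<le> exp (m * y)"
    using bounds by eventually_elim (use t0 in \<open>simp add: H_def\<close>)
  have "H \<in> borel_measurable M"
    unfolding H_def using Mom[OF t0] X_meas[OF t0] by measurable
  then have iH: "integrable M H"
    by (intro integrable_const_bound[of _ "exp (m * y)"]) (use Hb in auto)
  have "0 \<le> expectation H" using Hb by (intro integral_nonneg_AE) auto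
  moreover have "expectation H \<le> expectation (\<lambda>_. exp (m * y))"
    by (rule integral_mono_AE[OF iH]) (use Hb in auto)
  then have "expectation H \<le> exp (m * y)" by (simp add: prob_space)
  moreover have "expectation Z = expectation H - m * expectation (L t) + (exp (m * y) - 1) * expectation (n t)"
    unfolding Z_def H_def[symmetric] using iH L_integrable[OF t0] n_integrable[OF t0] by simp
  ultimately show ?thesis using Z by linarith
qed

end


section \<open>Long-term average cost\<close>

context regulated_path
begin

text \<open>The cost is stated with the Lebesgue integral and the change of variables with the gauge
  integral. They agree, as \<open>X\<close> is a continuous plus a monotone function.\<close>

lemma X_set_integrable: "set_integrable lborel {0..t} X"
proof -
  have "continuous_on {0..t} c" using c_cont by (rule continuous_on_subset) auto
  then have "set_integrable lborel {0..t} c" by (rule borel_integrable_atLeastAtMost')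
  moreover have "set_integrable lborel {0..t} (\<lambda>s. (z - y) * n s)"
  proof (rule set_integrable_mult_right)
    have "mono_on {0..t} n" using n_mono by (auto simp: mono_on_def)
    then have m: "n \<in> borel_measurable (restrict_space borel {0..t})" by (rule borel_measurable_mono_on_fnc)
    have i: "integrable lborel (\<lambda>s. indicator {0..t} s *\<^sub>R n t)"
      using borel_integrable_atLeastAtMost'[of 0 t "\<lambda>_. n t"] unfolding set_integrable_def by simp
    show "set_integrable lborel {0..t} n"
      unfolding set_integrable_def
    proof (rule Bochner_Integration.integrable_bound[OF i])
      have "(\<lambda>s. indicator {0..t} s *\<^sub>R n s) \<in> borel_measurable borel"
        using m by (subst (asm) borel_measurable_restrict_space_iff) auto
      then show "(\<lambda>s. indicator {0..t} s *\<^sub>R n s) \<in> borel_measurable lborel" by simp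
      have "norm (indicator {0..t} s *\<^sub>R n s) \<le> norm (indicator {0..t} s *\<^sub>R n t)" for s
      proof (cases "s \<in> {0..t}")
        case True
        then show ?thesis using n_le[of 0 s] n_le[of s t] n_0 by simp
      qed simp
      then show "AE s in lborel. norm (indicator {0..t} s *\<^sub>R n s) \<le> norm (indicator {0..t} s *\<^sub>R n t)" by simp
    qed
  qed
  ultimately have "set_integrable lborel {0..t} (\<lambda>s. c s + (z - y) * n s)" by (rule set_integral_add)
  moreover have "set_integrable lborel {0..t} X \<longleftrightarrow> set_integrable lborel {0..t} (\<lambda>s. c s + (z - y) * n s)"
    by (rule set_integrable_cong) (use X_c in auto)
  ultimately show ?thesis by simp
qed

lemma holding_cost_eq: "(LBINT s:{0..t}. c0 c\<^sub>h (X s)) = c\<^sub>h * integral {0..t} X"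
  unfolding c0_def using set_borel_integral_eq_integral(2)[OF X_set_integrable] by simp

end

text \<open>Every order starts from \<open>y\<close>, except one at time 0, which starts from
  \<open>x\<^sub>0\<close>. Its cost is a constant and disappears in the long-run average.\<close>

lemma (in strictly_ordered_path) order_cost_eq:
  assumes t: "0 \<le> t"
  shows "(\<Sum>k. if \<tau> (Suc k) \<le> ereal t
      then ereal (c1 k\<^sub>1 k\<^sub>2 (left_level x\<^sub>0 X (real_of_ereal (\<tau> (Suc k)))) (X (real_of_ereal (\<tau> (Suc k))))) else 0)
    = ereal (c1 k\<^sub>1 k\<^sub>2 y z * n t + N 0 * c1 k\<^sub>1 k\<^sub>2 x\<^sub>0 z)"
proof -
  obtain k where k: "\<tau> k \<le> ereal t" "ereal t < \<tau> (Suc k)" using current_order[OF t] .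
  define f where "f i = c1 k\<^sub>1 k\<^sub>2 (if i = 0 \<and> \<tau> 1 = 0 then x\<^sub>0 else y) z" for i :: nat
  have eq: "(if \<tau> (Suc i) \<le> ereal t
      then ereal (c1 k\<^sub>1 k\<^sub>2 (left_level x\<^sub>0 X (real_of_ereal (\<tau> (Suc i)))) (X (real_of_ereal (\<tau> (Suc i))))) else 0)
    = (if i < k then ereal (f i) else 0)" for i
  proof (cases "i < k")
    case False
    then have "\<tau> (Suc k) \<le> \<tau> (Suc i)" by (intro \<tau>_mono) simp
    then have "\<not> \<tau> (Suc i) \<le> ereal t" using k(2) by simp
    then show ?thesis using False by simp
  next
    case True
    then have "\<tau> (Suc i) \<le> \<tau> k" by (intro \<tau>_mono) simp
    then have le: "\<tau> (Suc i) \<le> ereal t" using k(1) by (rule order_trans)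
    then obtain s where s: "\<tau> (Suc i) = ereal s" using \<tau>_nonneg[of "Suc i"] by (cases "\<tau> (Suc i)") auto
    have s0: "0 \<le> s" using \<tau>_nonneg[of "Suc i"] s by (simp add: zero_ereal_def)
    have "left_level x\<^sub>0 X s = (if i = 0 \<and> \<tau> 1 = 0 then x\<^sub>0 else y)"
    proof (cases "s = 0")
      case True
      then have "i = 0" using before_order[OF s] \<tau>_nonneg[of i] by (auto simp: zero_ereal_def)
      then show ?thesis using True s by (simp add: left_level_def zero_ereal_def)
    next
      case False
      then have "left_level x\<^sub>0 X s = y" using pre_order[OF s] s0 by simp
      then show ?thesis using False s by (auto simp: zero_ereal_def)
    qed
    then show ?thesis using True le s X_at_order[OF s] by (simp add: f_def)
  qed
  have "(\<Sum>i. if i < k then ereal (f i) else 0) = (\<Sum>i<k. (if i < k then ereal (f i) else 0))"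
    by (rule suminf_finite) auto
  also have "\<dots> = ereal (\<Sum>i<k. f i)" by simp
  also have "(\<Sum>i<k. f i) = c1 k\<^sub>1 k\<^sub>2 y z * n t + N 0 * c1 k\<^sub>1 k\<^sub>2 x\<^sub>0 z"
    using X_init_cases
  proof
    assume "\<tau> 1 \<noteq> 0 \<and> N 0 = 0 \<and> X_init = x\<^sub>0"
    then show ?thesis unfolding f_def n_def N_eq[OF k] by simp
  next
    assume A: "\<tau> 1 = 0 \<and> N 0 = 1 \<and> X_init = z"
    then have "k \<noteq> 0" using k(2) t by (intro notI) (auto simp: zero_ereal_def)
    then obtain l where l: "k = Suc l" by (cases k) auto
    show ?thesis unfolding f_def n_def N_eq[OF k] l using A
      by (subst sum.lessThan_Suc_shift) (simp add: algebra_simps)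
  qed
  finally show ?thesis unfolding eq .
qed

text \<open>Both integrals respect almost sure equality, so an integrable version \<open>g\<close>
  of the path cost is enough. Such a version exists for the holding term through
  \<open>I\<close>.\<close>

lemma ext_expectation_eq:
  assumes g: "integrable M g" and eq: "AE \<omega> in M. f \<omega> = ereal (g \<omega>)"
  shows "ext_expectation M f = ereal (integral\<^sup>L M g)"
proof -
  have 1: "(\<integral>\<^sup>+ \<omega>. e2ennreal (f \<omega>) \<partial>M) = (\<integral>\<^sup>+ \<omega>. ennreal (g \<omega>) \<partial>M)"
    using eq by (intro nn_integral_cong_AE) (auto simp: ennreal_def elim!: eventually_mono)
  have 2: "(\<integral>\<^sup>+ \<omega>. e2ennreal (- f \<omega>) \<partial>M) = (\<integral>\<^sup>+ \<omega>. ennreal (- g \<omega>) \<partial>M)"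
    using eq by (intro nn_integral_cong_AE) (auto simp: ennreal_def elim!: eventually_mono)
  obtain r q where rq: "0 \<le> r" "0 \<le> q" "(\<integral>\<^sup>+ \<omega>. ennreal (g \<omega>) \<partial>M) = ennreal r"
    "(\<integral>\<^sup>+ \<omega>. ennreal (- g \<omega>) \<partial>M) = ennreal q" "integral\<^sup>L M g = r - q"
    using real_lebesgue_integral_def[OF g] real_integrable_def[THEN iffD1, OF g]
    by (metis (no_types, lifting) enn2real_nonneg ennreal_enn2real infinity_ennreal_def top.not_eq_extremum)
  show ?thesis unfolding ext_expectation_def 1 2 rq(3-5) using rq(1,2) by simp
qed

lemma bounded_over_at_top:
  fixes f :: "real \<Rightarrow> real"
  assumes "\<And>t. 0 < t \<Longrightarrow> \<bar>f t\<bar> \<le> C"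
  shows "((\<lambda>t. f t / t) \<longlongrightarrow> 0) at_top"
proof (rule Lim_null_comparison)
  show "\<forall>\<^sub>F t in at_top. norm (f t / t) \<le> C / t"
    using eventually_gt_at_top[of 0]
    by eventually_elim (use assms in \<open>simp add: abs_divide divide_right_mono\<close>)
  show "((\<lambda>t. C / t) \<longlongrightarrow> 0) at_top"
    by (intro tendsto_divide_0[OF tendsto_const] filterlim_at_top_imp_at_infinity filterlim_ident)
qed

context inventory_model
begin

lemma expectation_X_over_t: "((\<lambda>t. (expectation (X t) - X\<^sub>0) / t) \<longlongrightarrow> 0) at_top"
  and expectation_X_square_over_t: "((\<lambda>t. expectation (\<lambda>\<omega>. (X t \<omega>)\<^sup>2) / t) \<longlongrightarrow> 0) at_top"
proof -
  obtain K where K: "0 \<le> K" "\<And>t. 0 \<le> t \<Longrightarrow> integrable M (\<lambda>\<omega>. (X t \<omega>)\<^sup>2)"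
      "\<And>t. 0 \<le> t \<Longrightarrow> expectation (\<lambda>\<omega>. (X t \<omega>)\<^sup>2) \<le> K"
    using X_square_bound by blast
  have "\<bar>expectation (X t) - X\<^sub>0\<bar> \<le> 1 + K + \<bar>X\<^sub>0\<bar>" if t: "0 < t" for t
  proof -
    have t0: "0 \<le> t" using t by simp
    have "\<bar>expectation (X t)\<bar> \<le> expectation (\<lambda>\<omega>. \<bar>X t \<omega>\<bar>)" by (rule integral_abs_bound)
    also have "\<dots> \<le> expectation (\<lambda>\<omega>. 1 + (X t \<omega>)\<^sup>2)"
    proof (rule integral_mono)
      show "\<bar>X t \<omega>\<bar> \<le> 1 + (X t \<omega>)\<^sup>2" for \<omega>
      proof -
        have "0 \<le> (\<bar>X t \<omega>\<bar> - 1)\<^sup>2" by simp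
        then have "2 * \<bar>X t \<omega>\<bar> \<le> 1 + (X t \<omega>)\<^sup>2" by (simp add: power2_diff)
        then show ?thesis by linarith
      qed
    qed (use X_integrable[OF t0] K(2)[OF t0] in auto)
    also have "\<dots> = 1 + expectation (\<lambda>\<omega>. (X t \<omega>)\<^sup>2)" using K(2)[OF t0] by (simp add: prob_space)
    finally show ?thesis using K(3)[OF t0] by linarith
  qed
  then show "((\<lambda>t. (expectation (X t) - X\<^sub>0) / t) \<longlongrightarrow> 0) at_top" by (rule bounded_over_at_top)
  have "\<bar>expectation (\<lambda>\<omega>. (X t \<omega>)\<^sup>2)\<bar> \<le> K" if "0 < t" for t
    using K(3)[of t] that by (simp add: abs_of_nonneg Bochner_Integration.integral_nonneg)
  then show "((\<lambda>t. expectation (\<lambda>\<omega>. (X t \<omega>)\<^sup>2) / t) \<longlongrightarrow> 0) at_top" by (rule bounded_over_at_top)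
qed

text \<open>After division by \<open>t\<close> the initial level, the bounded second moment and the
  constant \<open>\<kappa>\<close>, the cost of a possible order at time 0, vanish. The averages
  converge, so the upper limit is a limit.\<close>

lemma average_cost_eq:
  assumes n_lim: "((\<lambda>t. expectation (n t) / t) \<longlongrightarrow> \<nu>) at_top"
    and L_lim: "((\<lambda>t. expectation (L t) / t) \<longlongrightarrow> \<rho>) at_top"
    and cost: "\<And>t. 0 < t \<Longrightarrow> AE \<omega> in M. path_cost c\<^sub>h k\<^sub>1 k\<^sub>2 k\<^sub>5 x\<^sub>0 \<tau> X L t \<omega> =
      ereal (c\<^sub>h * integral {0..t} (\<lambda>s. X s \<omega>) + a * n t \<omega> + \<kappa> + k\<^sub>5 * L t \<omega>)"
  shows "average_cost M c\<^sub>h k\<^sub>1 k\<^sub>2 k\<^sub>5 x\<^sub>0 \<tau> X L =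
    ereal (c\<^sub>h * (((z\<^sup>2 - y\<^sup>2) * \<nu> + \<sigma>\<^sup>2) / (2 * \<mu>)) + a * \<nu> + k\<^sub>5 * \<rho>)"
proof -
  define E where "E t = c\<^sub>h * ((X\<^sub>0\<^sup>2 + (z\<^sup>2 - y\<^sup>2) * expectation (n t) + \<sigma>\<^sup>2 * t - expectation (\<lambda>\<omega>. (X t \<omega>)\<^sup>2)) / (2 * \<mu>))
    + a * expectation (n t) + \<kappa> + k\<^sub>5 * expectation (L t)" for t
  have ext: "ext_expectation M (path_cost c\<^sub>h k\<^sub>1 k\<^sub>2 k\<^sub>5 x\<^sub>0 \<tau> X L t) = ereal (E t)" if t: "0 < t" for t
  proof -
    have t0: "0 \<le> t" using t by simp
    obtain I where I: "integrable M I" "AE \<omega> in M. integral {0..t} (\<lambda>s. X s \<omega>) = I \<omega>"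
      "\<mu> * expectation I = (X\<^sub>0\<^sup>2 + (z\<^sup>2 - y\<^sup>2) * expectation (n t) + \<sigma>\<^sup>2 * t - expectation (\<lambda>\<omega>. (X t \<omega>)\<^sup>2)) / 2"
      using occupation_integral[OF t] by blast
    have EI: "expectation I = (X\<^sub>0\<^sup>2 + (z\<^sup>2 - y\<^sup>2) * expectation (n t) + \<sigma>\<^sup>2 * t - expectation (\<lambda>\<omega>. (X t \<omega>)\<^sup>2)) / (2 * \<mu>)"
      using I(3) mu by (simp add: field_simps)
    have i: "integrable M (\<lambda>\<omega>. c\<^sub>h * I \<omega> + a * n t \<omega> + \<kappa> + k\<^sub>5 * L t \<omega>)"
      using I(1) n_integrable[OF t0] L_integrable[OF t0] by simp
    have "ext_expectation M (path_cost c\<^sub>h k\<^sub>1 k\<^sub>2 k\<^sub>5 x\<^sub>0 \<tau> X L t) = ereal (expectation (\<lambda>\<omega>. c\<^sub>h * I \<omega> + a * n t \<omega> + \<kappa> + k\<^sub>5 * L t \<omega>))"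
      by (rule ext_expectation_eq[OF i]) (use cost[OF t] I(2) in eventually_elim, simp)
    also have "expectation (\<lambda>\<omega>. c\<^sub>h * I \<omega> + a * n t \<omega> + \<kappa> + k\<^sub>5 * L t \<omega>) = E t"
      unfolding E_def EI[symmetric] using I(1) n_integrable[OF t0] L_integrable[OF t0] by (simp add: prob_space)
    finally show ?thesis .
  qed
  have const: "((\<lambda>t. q / t) \<longlongrightarrow> 0) at_top" for q :: real
    by (rule bounded_over_at_top[of _ "\<bar>q\<bar>"]) simp
  have "((\<lambda>t. c\<^sub>h * ((X\<^sub>0\<^sup>2 / t + (z\<^sup>2 - y\<^sup>2) * (expectation (n t) / t) + \<sigma>\<^sup>2 - expectation (\<lambda>\<omega>. (X t \<omega>)\<^sup>2) / t) / (2 * \<mu>))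
    + a * (expectation (n t) / t) + \<kappa> / t + k\<^sub>5 * (expectation (L t) / t)) \<longlongrightarrow>
    c\<^sub>h * ((0 + (z\<^sup>2 - y\<^sup>2) * \<nu> + \<sigma>\<^sup>2 - 0) / (2 * \<mu>)) + a * \<nu> + 0 + k\<^sub>5 * \<rho>) at_top"
    by (intro tendsto_intros n_lim L_lim const expectation_X_square_over_t) (use mu in simp)
  moreover have "\<forall>\<^sub>F t in at_top. c\<^sub>h * ((X\<^sub>0\<^sup>2 / t + (z\<^sup>2 - y\<^sup>2) * (expectation (n t) / t) + \<sigma>\<^sup>2 - expectation (\<lambda>\<omega>. (X t \<omega>)\<^sup>2) / t) / (2 * \<mu>))
    + a * (expectation (n t) / t) + \<kappa> / t + k\<^sub>5 * (expectation (L t) / t) = E t / t"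
    using eventually_gt_at_top[of 0]
    by eventually_elim (use mu in \<open>simp add: E_def field_simps\<close>)
  ultimately have lim: "((\<lambda>t. E t / t) \<longlongrightarrow> c\<^sub>h * ((0 + (z\<^sup>2 - y\<^sup>2) * \<nu> + \<sigma>\<^sup>2 - 0) / (2 * \<mu>)) + a * \<nu> + 0 + k\<^sub>5 * \<rho>) at_top"
    by (rule Lim_transform_eventually)
  have "\<forall>\<^sub>F t in at_top. ereal (E t / t) = ereal (1 / t) * ext_expectation M (path_cost c\<^sub>h k\<^sub>1 k\<^sub>2 k\<^sub>5 x\<^sub>0 \<tau> X L t)"
    using eventually_gt_at_top[of 0] by eventually_elim (simp add: ext)
  then have "((\<lambda>t. ereal (1 / t) * ext_expectation M (path_cost c\<^sub>h k\<^sub>1 k\<^sub>2 k\<^sub>5 x\<^sub>0 \<tau> X L t)) \<longlongrightarrow>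
      ereal (c\<^sub>h * ((0 + (z\<^sup>2 - y\<^sup>2) * \<nu> + \<sigma>\<^sup>2 - 0) / (2 * \<mu>)) + a * \<nu> + 0 + k\<^sub>5 * \<rho>)) at_top"
    using lim by (intro Lim_transform_eventually[OF tendsto_ereal])
  then show ?thesis
    unfolding average_cost_def by (subst lim_imp_Limsup) auto
qed

text \<open>The mean level is bounded, so orders of size \<open>z - y\<close> have to replace the
  drift \<mu>.\<close>

lemma reflectionless_rates:
  assumes L0: "\<And>t. 0 \<le> t \<Longrightarrow> AE \<omega> in M. L t \<omega> = 0"
  shows "((\<lambda>t. expectation (L t) / t) \<longlongrightarrow> 0) at_top"
    "((\<lambda>t. expectation (n t) / t) \<longlongrightarrow> \<mu> / (z - y)) at_top"
proof -
  have EL: "expectation (L t) = 0" if "0 \<le> t" for t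
    using integral_cong_AE[OF L_meas[OF that] _ L0[OF that]] by simp
  show "((\<lambda>t. expectation (L t) / t) \<longlongrightarrow> 0) at_top"
    by (rule bounded_over_at_top[of _ 0]) (simp add: EL)
  have "((\<lambda>t. ((expectation (X t) - X\<^sub>0) / t + \<mu>) / (z - y)) \<longlongrightarrow> (0 + \<mu>) / (z - y)) at_top"
    by (intro tendsto_intros expectation_X_over_t) (use yz in simp)
  moreover have "\<forall>\<^sub>F t in at_top. ((expectation (X t) - X\<^sub>0) / t + \<mu>) / (z - y) = expectation (n t) / t"
    using eventually_gt_at_top[of 0]
  proof eventually_elim
    case (elim t)
    then have "expectation (X t) - X\<^sub>0 + \<mu> * t = (z - y) * expectation (n t)"
      using expectation_X[of t] EL[of t] by simp
    moreover have "(expectation (X t) - X\<^sub>0) / t + \<mu> = (expectation (X t) - X\<^sub>0 + \<mu> * t) / t"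
      using elim by (simp add: field_simps)
    ultimately show ?case using yz by simp
  qed
  ultimately show "((\<lambda>t. expectation (n t) / t) \<longlongrightarrow> \<mu> / (z - y)) at_top"
    by (auto dest: Lim_transform_eventually)
qed

end

context triggered_model
begin

text \<open>Two linear equations for the rates \<nu> of orders and \<rho> of local time: \<mu> =
  \<rho> + (z - y) \<nu> from the mean level, and \<rho> = e \<nu> from the exponential balance,
  whose error \<open>r\<close> stays bounded. Hence \<open>Q / \<mu>\<close> is the mean length of a
  cycle.\<close>

lemma triggered_rates:
  defines "Q \<equiv> (z - y) + \<sigma>\<^sup>2 / (2 * \<mu>) * (exp (2 * \<mu> * y / \<sigma>\<^sup>2) - 1)"
  shows "((\<lambda>t. expectation (n t) / t) \<longlongrightarrow> \<mu> / Q) at_top"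
    "((\<lambda>t. expectation (L t) / t) \<longlongrightarrow> \<sigma>\<^sup>2 / (2 * \<mu>) * (exp (2 * \<mu> * y / \<sigma>\<^sup>2) - 1) * (\<mu> / Q)) at_top"
proof -
  define m where "m = 2 * \<mu> / \<sigma>\<^sup>2"
  define e where "e = (exp (2 * \<mu> * y / \<sigma>\<^sup>2) - 1) / m"
  have m: "0 < m" unfolding m_def using mu sigma by simp
  have my: "m * y = 2 * \<mu> * y / \<sigma>\<^sup>2" unfolding m_def by simp
  have e: "\<sigma>\<^sup>2 / (2 * \<mu>) * (exp (2 * \<mu> * y / \<sigma>\<^sup>2) - 1) = e" unfolding e_def m_def by simp
  have e0: "0 \<le> e" unfolding e_def using m mu yz by simp
  have Q: "Q = (z - y) + e" unfolding Q_def e ..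
  have Q0: "0 < Q" unfolding Q using e0 yz by simp
  define r where "r t = expectation (L t) - e * expectation (n t)" for t
  have "\<bar>r t\<bar> \<le> exp (m * y) / m" if t: "0 < t" for t
  proof -
    have me: "m * e = exp (m * y) - 1" unfolding e_def my using m by simp
    have "m * r t = m * expectation (L t) - (exp (m * y) - 1) * expectation (n t)"
      unfolding me[symmetric] r_def by (simp add: right_diff_distrib)
    then have "\<bar>m * r t\<bar> \<le> exp (m * y)" using local_time_balance[OF t] unfolding m_def by simp
    then show ?thesis using m by (simp add: abs_mult pos_le_divide_eq mult.commute)
  qed
  then have r: "((\<lambda>t. r t / t) \<longlongrightarrow> 0) at_top" by (rule bounded_over_at_top)
  have "((\<lambda>t. ((expectation (X t) - X\<^sub>0) / t + \<mu> - r t / t) / Q) \<longlongrightarrow> (0 + \<mu> - 0) / Q) at_top"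
    by (intro tendsto_intros expectation_X_over_t r) (use Q0 in simp)
  moreover have "\<forall>\<^sub>F t in at_top. ((expectation (X t) - X\<^sub>0) / t + \<mu> - r t / t) / Q = expectation (n t) / t"
    using eventually_gt_at_top[of 0]
  proof eventually_elim
    case (elim t)
    have "expectation (X t) - X\<^sub>0 + \<mu> * t - r t = Q * expectation (n t)"
      using expectation_X[of t] elim unfolding r_def Q by (simp add: algebra_simps)
    moreover have "(expectation (X t) - X\<^sub>0) / t + \<mu> - r t / t = (expectation (X t) - X\<^sub>0 + \<mu> * t - r t) / t"
      using elim by (simp add: field_simps)
    ultimately show ?case using Q0 by simp
  qed
  ultimately show n: "((\<lambda>t. expectation (n t) / t) \<longlongrightarrow> \<mu> / Q) at_top"
    by (auto dest: Lim_transform_eventually)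
  have "((\<lambda>t. r t / t + e * (expectation (n t) / t)) \<longlongrightarrow> 0 + e * (\<mu> / Q)) at_top"
    by (intro tendsto_intros r n)
  moreover have "r t / t + e * (expectation (n t) / t) = expectation (L t) / t" for t
    unfolding r_def by (simp add: diff_divide_distrib)
  ultimately show "((\<lambda>t. expectation (L t) / t) \<longlongrightarrow> \<sigma>\<^sup>2 / (2 * \<mu>) * (exp (2 * \<mu> * y / \<sigma>\<^sup>2) - 1) * (\<mu> / Q)) at_top"
    unfolding e by simp
qed

end


section \<open>The standard and the delayed policy\<close>

text \<open>Makes the presence of an order at time 0 a deterministic fact, so that the starting
  level and the count correction are constants.\<close>

lemma (in standard_path) first_order_zero_iff: "\<tau> 1 = 0 \<longleftrightarrow> x\<^sub>0 \<le> y"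
proof
  assume "x\<^sub>0 \<le> y"
  then have "Inf {ereal t | t. 0 \<le> t \<and> left_level x\<^sub>0 X t \<le> y} \<le> ereal 0"
    by (intro Inf_lower) (auto simp: left_level_def)
  then show "\<tau> 1 = 0" using first_order \<tau>_nonneg[of 1] by (simp add: zero_ereal_def antisym)
next
  assume \<tau>1: "\<tau> 1 = 0"
  then have "\<tau> (Suc 0) = ereal 0" by (simp add: zero_ereal_def)
  from after_order_left_level[OF this yz] obtain \<rho> where \<rho>: "0 < \<rho>"
    "\<And>t. 0 < t \<Longrightarrow> t < 0 + \<rho> \<Longrightarrow> y < left_level x\<^sub>0 X t" by blast
  have "0 \<le> (0 :: real) \<and> left_level x\<^sub>0 X 0 \<le> y"
  proof (rule ereal_Inf_mem[where P = "\<lambda>t. 0 \<le> t \<and> left_level x\<^sub>0 X t \<le> y", OF _ \<rho>(1)])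
    show "Inf {ereal t | t. 0 \<le> t \<and> left_level x\<^sub>0 X t \<le> y} = ereal 0"
      using first_order \<tau>1 by (simp add: zero_ereal_def)
    show "\<not> (0 \<le> t \<and> left_level x\<^sub>0 X t \<le> y)" if "0 < t" "t < 0 + \<rho>" for t
      using \<rho>(2)[OF that] by simp
  qed
  then show "x\<^sub>0 \<le> y" by (simp add: left_level_def)
qed

text \<open>By the Skorokhod formula \<open>L t\<close> is almost surely a countable supremum of
  negative parts of the path without reflection, which consists of \<open>W\<close> and the adapted
  order count. The null sets in the filtration absorb the exceptional set.\<close>

lemma (in brownian) regulated_Fil:
  assumes path: "AE \<omega> in M. regulated_path \<mu> \<sigma> X\<^sub>0 y z (\<lambda>t. W t \<omega>) (\<lambda>t. X t \<omega>) (\<lambda>t. L t \<omega>) (\<lambda>t. n t \<omega>)"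
    and n: "\<And>t. 0 \<le> t \<Longrightarrow> n t \<in> borel_measurable (Fil t)"
    and X: "\<And>t. 0 \<le> t \<Longrightarrow> X t \<in> borel_measurable M" and L: "\<And>t. 0 \<le> t \<Longrightarrow> L t \<in> borel_measurable M"
    and t: "0 \<le> t"
  shows "X t \<in> borel_measurable (Fil t)"
proof -
  define f where "f q \<omega> = - (X\<^sub>0 - \<mu> * q + \<sigma> * W q \<omega> + (z - y) * n q \<omega>)" for q \<omega>
  define R where "R \<omega> = real_of_ereal (SUP q\<in>insert t (\<rat> \<inter> {0..t}). ereal (max 0 (f q \<omega>)))" for \<omega>
  have f: "f q \<in> borel_measurable (Fil t)" if "q \<in> insert t (\<rat> \<inter> {0..t})" for q
  proof -
    have q: "0 \<le> q" "q \<le> t" using that t by auto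
    show ?thesis unfolding f_def using W_Fil[OF q] Fil_mono[OF n[OF q(1)] q(2)] by simp
  qed
  have R: "R \<in> borel_measurable (Fil t)"
    unfolding R_def
    by (intro borel_measurable_real_of_ereal borel_measurable_SUP borel_measurable_ereal borel_measurable_max
        borel_measurable_const f) (auto simp: countable_rat)
  have "AE \<omega> in M. X t \<omega> = X\<^sub>0 - \<mu> * t + \<sigma> * W t \<omega> + R \<omega> + (z - y) * n t \<omega>"
    using path
  proof eventually_elim
    case (elim \<omega>)
    interpret P: regulated_path \<mu> \<sigma> X\<^sub>0 y z "\<lambda>t. W t \<omega>" "\<lambda>t. X t \<omega>" "\<lambda>t. L t \<omega>" "\<lambda>t. n t \<omega>" by (rule elim)
    have "(SUP q\<in>insert t (\<rat> \<inter> {0..t}). ereal (max 0 (f q \<omega>)))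
      = (SUP q\<in>insert t (\<rat> \<inter> {0..t}). ereal (max 0 (L q \<omega> - X q \<omega>)))"
    proof (rule SUP_cong)
      fix q assume "q \<in> insert t (\<rat> \<inter> {0..t})"
      then have "0 \<le> q" using t by auto
      from P.X_eq[OF this] have "f q \<omega> = L q \<omega> - X q \<omega>" unfolding f_def by simp
      then show "ereal (max 0 (f q \<omega>)) = ereal (max 0 (L q \<omega> - X q \<omega>))" by (simp only:)
    qed simp
    then have "R \<omega> = L t \<omega>" unfolding R_def P.skorokhod_formula[OF t, symmetric] by simp
    then show ?case using P.X_eq[OF t] by simp
  qed
  then show ?thesis
    using R W_Fil[OF t order_refl] n[OF t] by (intro Fil_AE_cong[OF X[OF t]]) simp_all
qed

section \<open>Adaptedness in the model and the costs of both policies\<close>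

locale inventory_setting = brownian +
  fixes U LU :: "real \<Rightarrow> 'a \<Rightarrow> real" and \<mu> \<sigma> x\<^sub>0 :: real
  assumes mu: "0 < \<mu>" and sigma: "0 < \<sigma>" and x0: "0 < x\<^sub>0"
    and uncontrolled: "uncontrolled_inventory M \<mu> \<sigma> x\<^sub>0 W U LU"
begin

text \<open>The order count is identically 0, so any admissible pair of levels fits; 0 and 1 are
  taken.\<close>

lemma uncontrolled_path: "AE \<omega> in M. regulated_path \<mu> \<sigma> x\<^sub>0 0 1 (\<lambda>t. W t \<omega>) (\<lambda>t. U t \<omega>) (\<lambda>t. LU t \<omega>) (\<lambda>t. 0)"
proof -
  have "AE \<omega> in M. (\<forall>t\<ge>0. (\<lambda>k. 0) sums (U t \<omega> - (x\<^sub>0 - \<mu> * t + \<sigma> * W t \<omega> + LU t \<omega>))) \<and>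
        (\<forall>t\<ge>0. 0 \<le> U t \<omega>) \<and>
        LU 0 \<omega> = 0 \<and> continuous_on {0..} (\<lambda>t. LU t \<omega>) \<and> mono_on {0..} (\<lambda>t. LU t \<omega>) \<and>
        (\<forall>s t. 0 \<le> s \<and> s \<le> t \<and> (\<forall>u\<in>{s..t}. 0 < U u \<omega>) \<longrightarrow> LU t \<omega> = LU s \<omega>)"
    using uncontrolled unfolding uncontrolled_inventory_def reflected_inventory_def by simp
  then show ?thesis
    using AE_W
  proof eventually_elim
    case (elim \<omega>)
    have U: "U t \<omega> = x\<^sub>0 - \<mu> * t + \<sigma> * W t \<omega> + LU t \<omega>" if "0 \<le> t" for t
    proof -
      have "(\<lambda>k. 0 :: real) sums (U t \<omega> - (x\<^sub>0 - \<mu> * t + \<sigma> * W t \<omega> + LU t \<omega>))" using elim that by blast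
      from sums_unique2[OF this sums_zero] show ?thesis by simp
    qed
    have flat: "LU t \<omega> = LU s \<omega>" if "0 \<le> s" "s \<le> t" "\<And>u. s \<le> u \<Longrightarrow> u \<le> t \<Longrightarrow> 0 < U u \<omega>" for s t
      using elim that by (metis atLeastAtMost_iff)
    show ?case
    proof
      show "0 < \<mu>" "0 < \<sigma>" "(0 :: real) \<le> 0" "(0 :: real) < 1" using mu sigma by simp_all
      show "continuous_on {0..} (\<lambda>t. W t \<omega>)" "W 0 \<omega> = 0" using elim(2) by blast+
      show "LU 0 \<omega> = 0" "continuous_on {0..} (\<lambda>t. LU t \<omega>)" "mono_on {0..} (\<lambda>t. LU t \<omega>)" using elim(1) by blast+
      show "U t \<omega> = x\<^sub>0 - \<mu> * t + \<sigma> * W t \<omega> + LU t \<omega> + (1 - 0) * 0" if "0 \<le> t" for t using U[OF that] by simp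
      show "0 \<le> U t \<omega>" if "0 \<le> t" for t using elim(1) that by blast
      show "LU t \<omega> = LU s \<omega>" if "0 \<le> s" "s \<le> t" "\<And>u. s \<le> u \<Longrightarrow> u \<le> t \<Longrightarrow> 0 < U u \<omega>" for s t
        using that by (rule flat)
      show "mono_on {0..} (\<lambda>t :: real. 0 :: real)" by (rule mono_onI) simp
    qed (auto intro: exI[of _ 1])
  qed
qed

lemma U_Fil: "0 \<le> t \<Longrightarrow> U t \<in> borel_measurable (Fil t)"
  using uncontrolled unfolding uncontrolled_inventory_def reflected_inventory_def
  by (intro regulated_Fil[OF uncontrolled_path]) auto

text \<open>Stopping times refer to the filtration of \<open>U\<close>, martingale transforms to
  that of \<open>W\<close>. Since \<open>U\<close> is adapted to \<open>W\<close>, the former is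
  contained in the latter.\<close>

lemma stopping_time_Fil:
  assumes "stopping_time (augmented_filtration M U) T"
  shows "{\<omega> \<in> space M. T \<omega> \<le> ereal t} \<in> sets (Fil t)"
proof -
  have "sets (augmented_filtration M U (ereal t)) \<subseteq> sets (Fil t)"
  proof (rule sets_augmented_filtration_least)
    show "U s \<in> borel_measurable (Fil t)" if "0 \<le> s" "ereal s \<le> ereal t" for s
      using Fil_mono[OF U_Fil[OF that(1)]] that(2) by simp
  qed (auto simp: null_sets_augmented_filtration)
  moreover have "{\<omega> \<in> space (augmented_filtration M U (ereal t)). T \<omega> \<le> ereal t} \<in> sets (augmented_filtration M U (ereal t))"
    using assms unfolding stopping_time_def pred_def by blast
  ultimately show ?thesis by auto
qed

lemma order_time_Fil:
  assumes "ordering_policy M U \<tau> Y" "0 \<le> t"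
  shows "{\<omega> \<in> space M. \<tau> k \<omega> \<le> ereal t} \<in> sets (Fil t)"
proof (cases "k = 0")
  case True
  then have "{\<omega> \<in> space M. \<tau> k \<omega> \<le> ereal t} = space (Fil t)"
    using assms unfolding ordering_policy_def by auto
  then show ?thesis by (simp only: sets.top)
next
  case False
  then show ?thesis using assms unfolding ordering_policy_def by (intro stopping_time_Fil) auto
qed

lemma order_count_Fil:
  assumes "ordering_policy M U \<tau> Y" "0 \<le> t"
  shows "(\<lambda>\<omega>. (\<Sum>k. if \<tau> (Suc k) \<omega> \<le> ereal t then 1 else 0) - \<nu> :: real) \<in> borel_measurable (Fil t)"
proof -
  have "Measurable.pred (Fil t) (\<lambda>\<omega>. \<tau> (Suc k) \<omega> \<le> ereal t)" for k
    using order_time_Fil[OF assms, of "Suc k"] unfolding pred_def by simp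
  then show ?thesis
    by (intro borel_measurable_diff borel_measurable_suminf borel_measurable_const measurable_If)
      (simp_all add: pred_def)
qed

lemma AE_ordered_path:
  assumes pol: "ordering_policy M U \<tau> Y" and refl: "reflected_inventory M \<mu> \<sigma> x\<^sub>0 W \<tau> Y X L"
    and up_to: "AE \<omega> in M. orders_up_to z x\<^sub>0 \<tau> Y X \<omega>" and yz: "0 \<le> y" "y < z"
  shows "AE \<omega> in M. ordered_path \<mu> \<sigma> x\<^sub>0 y z (\<lambda>t. W t \<omega>) (\<lambda>t. X t \<omega>) (\<lambda>t. L t \<omega>) (\<lambda>k. \<tau> k \<omega>) (\<lambda>k. Y k \<omega>)"
proof -
  have "AE \<omega> in M. (\<forall>t\<ge>0. (\<lambda>k. if \<tau> (Suc k) \<omega> \<le> ereal t then Y (Suc k) \<omega> else 0)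
                  sums (X t \<omega> - (x\<^sub>0 - \<mu> * t + \<sigma> * W t \<omega> + L t \<omega>))) \<and>
        (\<forall>t\<ge>0. 0 \<le> X t \<omega>) \<and>
        L 0 \<omega> = 0 \<and> continuous_on {0..} (\<lambda>t. L t \<omega>) \<and> mono_on {0..} (\<lambda>t. L t \<omega>) \<and>
        (\<forall>s t. 0 \<le> s \<and> s \<le> t \<and> (\<forall>u\<in>{s..t}. 0 < X u \<omega>) \<longrightarrow> L t \<omega> = L s \<omega>)"
    using refl unfolding reflected_inventory_def by simp
  then show ?thesis
    using AE_W up_to AE_space
  proof eventually_elim
    case (elim \<omega>)
    have flat: "L t \<omega> = L s \<omega>" if "0 \<le> s" "s \<le> t" "\<And>u. s \<le> u \<Longrightarrow> u \<le> t \<Longrightarrow> 0 < X u \<omega>" for s t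
      using elim(1) that by (metis atLeastAtMost_iff)
    show ?case
    proof
      show "\<tau> 0 \<omega> = 0" "\<tau> k \<omega> \<le> \<tau> (Suc k) \<omega>" "0 \<le> Y (Suc k) \<omega>" for k
        using pol elim(4) unfolding ordering_policy_def by auto
      show "Y (Suc k) \<omega> = z - left_level x\<^sub>0 (\<lambda>t. X t \<omega>) (real_of_ereal (\<tau> (Suc k) \<omega>))"
        if "\<tau> (Suc k) \<omega> < \<infinity>" for k
        using elim(3) that unfolding orders_up_to_def pre_level_eq_left_level by simp
      show "(\<lambda>k. if \<tau> (Suc k) \<omega> \<le> ereal t then Y (Suc k) \<omega> else 0)
          sums (X t \<omega> - (x\<^sub>0 - \<mu> * t + \<sigma> * W t \<omega> + L t \<omega>))" if "0 \<le> t" for t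
        using elim(1) that by blast
      show "0 \<le> X t \<omega>" if "0 \<le> t" for t using elim(1) that by blast
      show "L t \<omega> = L s \<omega>" if "0 \<le> s" "s \<le> t" "\<And>u. s \<le> u \<Longrightarrow> u \<le> t \<Longrightarrow> 0 < X u \<omega>" for s t
        using that by (rule flat)
      show "continuous_on {0..} (\<lambda>t. W t \<omega>)" "W 0 \<omega> = 0" using elim(2) by blast+
      show "L 0 \<omega> = 0" "continuous_on {0..} (\<lambda>t. L t \<omega>)" "mono_on {0..} (\<lambda>t. L t \<omega>)" using elim(1) by blast+
    qed (rule mu sigma x0 yz)+
  qed
qed

lemma path_cost_eq:
  assumes t: "0 \<le> t" and ord: "strictly_ordered_path \<mu> \<sigma> x\<^sub>0 y z (\<lambda>t. W t \<omega>) (\<lambda>t. X t \<omega>) (\<lambda>t. L t \<omega>) (\<lambda>k. \<tau> k \<omega>) (\<lambda>k. Y k \<omega>)"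
    and N0: "(\<Sum>k. if \<tau> (Suc k) \<omega> \<le> ereal 0 then 1 else 0) = (\<nu> :: real)"
  shows "path_cost c\<^sub>h k\<^sub>1 k\<^sub>2 k\<^sub>5 x\<^sub>0 \<tau> X L t \<omega> = ereal (c\<^sub>h * integral {0..t} (\<lambda>s. X s \<omega>)
      + c1 k\<^sub>1 k\<^sub>2 y z * ((\<Sum>k. if \<tau> (Suc k) \<omega> \<le> ereal t then 1 else 0) - \<nu>) + \<nu> * c1 k\<^sub>1 k\<^sub>2 x\<^sub>0 z + k\<^sub>5 * L t \<omega>)"
proof -
  interpret P: strictly_ordered_path \<mu> \<sigma> x\<^sub>0 y z "\<lambda>t. W t \<omega>" "\<lambda>t. X t \<omega>" "\<lambda>t. L t \<omega>" "\<lambda>k. \<tau> k \<omega>" "\<lambda>k. Y k \<omega>" by (rule ord)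
  have N: "P.N 0 = \<nu>" unfolding P.N_def using N0 .
  have n: "P.n t = (\<Sum>k. if \<tau> (Suc k) \<omega> \<le> ereal t then 1 else 0) - \<nu>" unfolding P.n_def N unfolding P.N_def ..
  show ?thesis
    unfolding path_cost_def pre_level_eq_left_level P.order_cost_eq[OF t] P.regulated.holding_cost_eq n N by simp
qed

lemma standard_cost:
  assumes pol: "standard_policy M \<mu> \<sigma> x\<^sub>0 W U y z \<tau> Y X L" and yz: "0 \<le> y" "y < z"
  shows "average_cost M c\<^sub>h k\<^sub>1 k\<^sub>2 k\<^sub>5 x\<^sub>0 \<tau> X L = ereal (F_std \<mu> \<sigma> c\<^sub>h k\<^sub>1 k\<^sub>2 y z)"
proof -
  have op: "ordering_policy M U \<tau> Y" and refl: "reflected_inventory M \<mu> \<sigma> x\<^sub>0 W \<tau> Y X L"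
    and rule: "AE \<omega> in M. \<tau> 1 \<omega> = Inf {ereal t | t. 0 \<le> t \<and> pre_level x\<^sub>0 X t \<omega> \<le> y} \<and>
        (\<forall>k\<ge>1. \<tau> (Suc k) \<omega> = Inf {ereal t | t. \<tau> k \<omega> < ereal t \<and> pre_level x\<^sub>0 X t \<omega> \<le> y}) \<and>
        orders_up_to z x\<^sub>0 \<tau> Y X \<omega>"
    using pol unfolding standard_policy_def by auto
  have up_to: "AE \<omega> in M. orders_up_to z x\<^sub>0 \<tau> Y X \<omega>" using rule by eventually_elim blast
  have std: "AE \<omega> in M. standard_path \<mu> \<sigma> x\<^sub>0 y z (\<lambda>t. W t \<omega>) (\<lambda>t. X t \<omega>) (\<lambda>t. L t \<omega>) (\<lambda>k. \<tau> k \<omega>) (\<lambda>k. Y k \<omega>)"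
    using AE_ordered_path[OF op refl up_to yz] rule
  proof eventually_elim
    case (elim \<omega>)
    then show ?case
      unfolding standard_path_def standard_path_axioms_def pre_level_eq_left_level by simp
  qed
  \<comment> \<open>An order at time 0 occurs exactly when \<open>x\<^sub>0 \<le> y\<close>; it sets
    the starting level to \<open>z\<close> and is not counted by \<open>n\<close>.\<close>
  define \<nu> :: real where "\<nu> = (if x\<^sub>0 \<le> y then 1 else 0)"
  define X\<^sub>0 where "X\<^sub>0 = (if x\<^sub>0 \<le> y then z else x\<^sub>0)"
  define n where "n t \<omega> = (\<Sum>k. if \<tau> (Suc k) \<omega> \<le> ereal t then 1 else 0) - \<nu>" for t \<omega>
  have facts: "AE \<omega> in M. regulated_path \<mu> \<sigma> X\<^sub>0 y z (\<lambda>t. W t \<omega>) (\<lambda>t. X t \<omega>) (\<lambda>t. L t \<omega>) (\<lambda>t. n t \<omega>) \<and>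
    (\<forall>t\<ge>0. L t \<omega> = 0) \<and>
    (\<forall>t\<ge>0. \<exists>s\<in>{0..t}. X t \<omega> - max X\<^sub>0 z \<le> (\<sigma> * W t \<omega> - \<mu> * t) - (\<sigma> * W s \<omega> - \<mu> * s)) \<and>
    (\<forall>t\<ge>0. path_cost c\<^sub>h k\<^sub>1 k\<^sub>2 k\<^sub>5 x\<^sub>0 \<tau> X L t \<omega> = ereal (c\<^sub>h * integral {0..t} (\<lambda>s. X s \<omega>)
      + c1 k\<^sub>1 k\<^sub>2 y z * n t \<omega> + \<nu> * c1 k\<^sub>1 k\<^sub>2 x\<^sub>0 z + k\<^sub>5 * L t \<omega>))"
    using std
  proof eventually_elim
    case (elim \<omega>)
    interpret P: standard_path \<mu> \<sigma> x\<^sub>0 y z "\<lambda>t. W t \<omega>" "\<lambda>t. X t \<omega>" "\<lambda>t. L t \<omega>" "\<lambda>k. \<tau> k \<omega>" "\<lambda>k. Y k \<omega>" by (rule elim)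
    have init: "P.N 0 = \<nu>" "P.X_init = X\<^sub>0"
      using P.X_init_cases P.first_order_zero_iff unfolding \<nu>_def X\<^sub>0_def by auto
    have n: "P.n = (\<lambda>t. n t \<omega>)" unfolding P.n_def[abs_def] init n_def unfolding P.N_def ..
    have N0: "(\<Sum>k. if \<tau> (Suc k) \<omega> \<le> ereal 0 then 1 else 0) = \<nu>" using init(1) unfolding P.N_def .
    show ?case
      using P.regulated.regulated_path_axioms P.dominated P.L_eq_0
        path_cost_eq[where \<omega> = \<omega> and \<tau> = \<tau> and X = X and L = L and Y = Y, OF _ P.strictly_ordered_path_axioms N0]
      unfolding init n n_def[symmetric] by blast
  qed
  have C0: "0 \<le> max X\<^sub>0 z" using yz by simp
  have path: "AE \<omega> in M. regulated_path \<mu> \<sigma> X\<^sub>0 y z (\<lambda>t. W t \<omega>) (\<lambda>t. X t \<omega>) (\<lambda>t. L t \<omega>) (\<lambda>t. n t \<omega>)"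
    using facts by eventually_elim blast
  have nF: "n t \<in> borel_measurable (Fil t)" if "0 \<le> t" for t
    unfolding n_def using order_count_Fil[OF op that] .
  have meas: "X t \<in> borel_measurable M" "L t \<in> borel_measurable M" if "0 \<le> t" for t
    using refl that unfolding reflected_inventory_def by auto
  interpret I: inventory_model M W \<mu> \<sigma> X\<^sub>0 y z "max X\<^sub>0 z" X L n
  proof
    show "AE \<omega> in M. \<forall>t\<ge>0. \<exists>s\<in>{0..t}. X t \<omega> - max X\<^sub>0 z \<le> (\<sigma> * W t \<omega> - \<mu> * t) - (\<sigma> * W s \<omega> - \<mu> * s)"
      using facts by eventually_elim blast
    show "X t \<in> borel_measurable (Fil t)" if "0 \<le> t" for t
      by (rule regulated_Fil[OF path nF meas that])
    show "n t \<in> borel_measurable M" if "0 \<le> t" for t using Fil_measurable[OF nF[OF that]] .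
  qed (use mu sigma yz C0 path meas in auto)
  have L0: "AE \<omega> in M. L t \<omega> = 0" if "0 \<le> t" for t using facts by eventually_elim (use that in blast)
  have cost: "AE \<omega> in M. path_cost c\<^sub>h k\<^sub>1 k\<^sub>2 k\<^sub>5 x\<^sub>0 \<tau> X L t \<omega> = ereal (c\<^sub>h * integral {0..t} (\<lambda>s. X s \<omega>)
      + c1 k\<^sub>1 k\<^sub>2 y z * n t \<omega> + \<nu> * c1 k\<^sub>1 k\<^sub>2 x\<^sub>0 z + k\<^sub>5 * L t \<omega>)" if "0 < t" for t
    using facts by eventually_elim (use that in simp)
  have "average_cost M c\<^sub>h k\<^sub>1 k\<^sub>2 k\<^sub>5 x\<^sub>0 \<tau> X L =
      ereal (c\<^sub>h * (((z\<^sup>2 - y\<^sup>2) * (\<mu> / (z - y)) + \<sigma>\<^sup>2) / (2 * \<mu>)) + c1 k\<^sub>1 k\<^sub>2 y z * (\<mu> / (z - y)) + k\<^sub>5 * 0)"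
    by (rule I.average_cost_eq[OF I.reflectionless_rates(2)[OF L0] I.reflectionless_rates(1)[OF L0] cost])
  also have "c\<^sub>h * (((z\<^sup>2 - y\<^sup>2) * (\<mu> / (z - y)) + \<sigma>\<^sup>2) / (2 * \<mu>)) + c1 k\<^sub>1 k\<^sub>2 y z * (\<mu> / (z - y)) + k\<^sub>5 * 0
    = F_std \<mu> \<sigma> c\<^sub>h k\<^sub>1 k\<^sub>2 y z"
  proof -
    have zy: "z - y \<noteq> 0" using yz by simp
    have "(z\<^sup>2 - y\<^sup>2) * (\<mu> / (z - y)) = (z + y) * \<mu>"
      using zy by (simp add: power2_eq_square square_diff_square_factored)
    moreover have "c1 k\<^sub>1 k\<^sub>2 y z * (\<mu> / (z - y)) = k\<^sub>1 * \<mu> / (z - y) + k\<^sub>2 * \<mu>"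
      using zy unfolding c1_def by (simp add: distrib_right add_divide_distrib)
    ultimately show ?thesis
      unfolding F_std_eq[OF mu yz(2)] using mu by (simp add: field_simps)
  qed
  finally show ?thesis .
qed

lemma delayed_cost:
  assumes pol: "delayed_policy M \<mu> \<sigma> x\<^sub>0 W U y z \<tau> Y X L" and yz: "0 < y" "y < z"
  shows "average_cost M c\<^sub>h k\<^sub>1 k\<^sub>2 k\<^sub>5 x\<^sub>0 \<tau> X L = ereal (F_delayed \<mu> \<sigma> c\<^sub>h k\<^sub>1 k\<^sub>2 k\<^sub>5 y z)"
proof -
  have op: "ordering_policy M U \<tau> Y" and refl: "reflected_inventory M \<mu> \<sigma> x\<^sub>0 W \<tau> Y X L"
    and rule: "AE \<omega> in M. (\<forall>k. \<tau> (Suc k) \<omega> =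
           Inf {ereal t | t. 0 \<le> t \<and> trigger_time \<tau> X k \<omega> \<le> ereal t \<and> pre_level x\<^sub>0 X t \<omega> = y}) \<and>
        orders_up_to z x\<^sub>0 \<tau> Y X \<omega>"
    using pol unfolding delayed_policy_def by auto
  have up_to: "AE \<omega> in M. orders_up_to z x\<^sub>0 \<tau> Y X \<omega>" using rule by eventually_elim blast
  have trig: "trigger_time \<tau> X k \<omega> = trigger (\<lambda>k. \<tau> k \<omega>) (\<lambda>t. X t \<omega>) k" for k \<omega>
    unfolding trigger_time_def trigger_def ..
  have del: "AE \<omega> in M. delayed_path \<mu> \<sigma> x\<^sub>0 y z (\<lambda>t. W t \<omega>) (\<lambda>t. X t \<omega>) (\<lambda>t. L t \<omega>) (\<lambda>k. \<tau> k \<omega>) (\<lambda>k. Y k \<omega>)"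
    using AE_ordered_path[OF op refl up_to less_imp_le[OF yz(1)] yz(2)] rule
  proof eventually_elim
    case (elim \<omega>)
    then show ?case
      unfolding delayed_path_def delayed_path_axioms_def pre_level_eq_left_level trig using yz by simp
  qed
  define n where "n t \<omega> = (\<Sum>k. if \<tau> (Suc k) \<omega> \<le> ereal t then 1 else 0) - (0 :: real)" for t \<omega>
  \<comment> \<open>The mode of \<open>delayed_path\<close>, written with the sample point: a
    countable combination of events of the past.\<close>
  define Mo :: "real \<Rightarrow> 'a \<Rightarrow> real" where "Mo t \<omega> = (if \<exists>k. \<tau> k \<omega> \<le> ereal t \<and> ereal t < \<tau> (Suc k) \<omega> \<and>
     (\<forall>i. \<exists>q\<in>\<rat> \<inter> {0..t}. \<tau> k \<omega> \<le> ereal q \<and> X q \<omega> < inverse (real (Suc i))) then 1 else 0)" for t \<omega>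
  have facts: "AE \<omega> in M. triggered_path \<mu> \<sigma> x\<^sub>0 y z (\<lambda>t. W t \<omega>) (\<lambda>t. X t \<omega>) (\<lambda>t. L t \<omega>) (\<lambda>t. n t \<omega>) (\<lambda>t. Mo t \<omega>) \<and>
    (\<forall>t\<ge>0. \<exists>s\<in>{0..t}. X t \<omega> - max x\<^sub>0 z \<le> (\<sigma> * W t \<omega> - \<mu> * t) - (\<sigma> * W s \<omega> - \<mu> * s)) \<and>
    (\<forall>t\<ge>0. path_cost c\<^sub>h k\<^sub>1 k\<^sub>2 k\<^sub>5 x\<^sub>0 \<tau> X L t \<omega> = ereal (c\<^sub>h * integral {0..t} (\<lambda>s. X s \<omega>)
      + c1 k\<^sub>1 k\<^sub>2 y z * n t \<omega> + 0 * c1 k\<^sub>1 k\<^sub>2 x\<^sub>0 z + k\<^sub>5 * L t \<omega>))"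
    using del
  proof eventually_elim
    case (elim \<omega>)
    interpret P: delayed_path \<mu> \<sigma> x\<^sub>0 y z "\<lambda>t. W t \<omega>" "\<lambda>t. X t \<omega>" "\<lambda>t. L t \<omega>" "\<lambda>k. \<tau> k \<omega>" "\<lambda>k. Y k \<omega>" by (rule elim)
    have init: "P.N 0 = 0" "P.X_init = x\<^sub>0"
      using P.X_init_cases P.N_0 by auto
    have n: "P.n = (\<lambda>t. n t \<omega>)" unfolding P.n_def[abs_def] init n_def unfolding P.N_def ..
    have Mo: "P.Mo = (\<lambda>t. Mo t \<omega>)" unfolding P.Mo_def[abs_def] Mo_def ..
    have N0: "(\<Sum>k. if \<tau> (Suc k) \<omega> \<le> ereal 0 then 1 else 0) = (0 :: real)" using init(1) unfolding P.N_def .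
    show ?case
      using P.triggered.triggered_path_axioms P.dominated
        path_cost_eq[where \<omega> = \<omega> and \<tau> = \<tau> and X = X and L = L and Y = Y, OF _ P.strictly_ordered_path_axioms N0]
      unfolding init n Mo n_def[symmetric] by blast
  qed
  have tpath: "AE \<omega> in M. triggered_path \<mu> \<sigma> x\<^sub>0 y z (\<lambda>t. W t \<omega>) (\<lambda>t. X t \<omega>) (\<lambda>t. L t \<omega>) (\<lambda>t. n t \<omega>) (\<lambda>t. Mo t \<omega>)"
    using facts by eventually_elim blast
  then have path: "AE \<omega> in M. regulated_path \<mu> \<sigma> x\<^sub>0 y z (\<lambda>t. W t \<omega>) (\<lambda>t. X t \<omega>) (\<lambda>t. L t \<omega>) (\<lambda>t. n t \<omega>)"
    by eventually_elim (rule triggered_path.axioms(1))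
  have nF: "n t \<in> borel_measurable (Fil t)" if "0 \<le> t" for t
    unfolding n_def using order_count_Fil[OF op that] .
  have meas: "X t \<in> borel_measurable M" "L t \<in> borel_measurable M" if "0 \<le> t" for t
    using refl that unfolding reflected_inventory_def by auto
  have XF: "X t \<in> borel_measurable (Fil t)" if "0 \<le> t" for t
    by (rule regulated_Fil[OF path nF meas that])
  have MoF: "Mo t \<in> borel_measurable (Fil t)" if t: "0 \<le> t" for t
  proof -
    have \<tau>p: "Measurable.pred (Fil t) (\<lambda>\<omega>. \<tau> k \<omega> \<le> ereal q)" if "0 \<le> q" "q \<le> t" for k q
    proof -
      have "{\<omega> \<in> space M. \<tau> k \<omega> \<le> ereal q} \<in> sets (Fil t)"
        using order_time_Fil[OF op that(1)] sets_augmented_filtration_mono[of "ereal q" "ereal t"] that(2) by auto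
      then show ?thesis unfolding pred_def by simp
    qed
    have Xp: "Measurable.pred (Fil t) (\<lambda>\<omega>. X q \<omega> < b)" if "0 \<le> q" "q \<le> t" for q b
      using Fil_mono[OF XF[OF that(1)] that(2)] by measurable
    have "Measurable.pred (Fil t) (\<lambda>\<omega>. \<exists>q\<in>\<rat> \<inter> {0..t}. \<tau> k \<omega> \<le> ereal q \<and> X q \<omega> < b)" for k b
    proof -
      have "{\<omega> \<in> space (Fil t). \<tau> k \<omega> \<le> ereal q \<and> X q \<omega> < b} \<in> sets (Fil t)" if "q \<in> \<rat> \<inter> {0..t}" for q
        using pred_intros_logic(3)[OF \<tau>p Xp, of q q k b] that unfolding pred_def by auto
      then have "(\<Union>q\<in>\<rat> \<inter> {0..t}. {\<omega> \<in> space (Fil t). \<tau> k \<omega> \<le> ereal q \<and> X q \<omega> < b}) \<in> sets (Fil t)"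
        by (intro sets.countable_UN'') (auto simp: countable_rat)
      also have "(\<Union>q\<in>\<rat> \<inter> {0..t}. {\<omega> \<in> space (Fil t). \<tau> k \<omega> \<le> ereal q \<and> X q \<omega> < b}) =
          {\<omega> \<in> space (Fil t). \<exists>q\<in>\<rat> \<inter> {0..t}. \<tau> k \<omega> \<le> ereal q \<and> X q \<omega> < b}" by blast
      finally show ?thesis unfolding pred_def .
    qed
    moreover have "Measurable.pred (Fil t) (\<lambda>\<omega>. ereal t < \<tau> (Suc k) \<omega>)" for k
      using pred_intros_logic(2)[OF \<tau>p[OF t order_refl, of "Suc k"]] by (simp add: not_le)
    ultimately have "Measurable.pred (Fil t) (\<lambda>\<omega>. \<exists>k. \<tau> k \<omega> \<le> ereal t \<and> ereal t < \<tau> (Suc k) \<omega> \<and>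
      (\<forall>i. \<exists>q\<in>\<rat> \<inter> {0..t}. \<tau> k \<omega> \<le> ereal q \<and> X q \<omega> < inverse (real (Suc i))))"
      using \<tau>p[OF t order_refl] by (intro pred_intros_countable pred_intros_logic)
    then show ?thesis unfolding Mo_def by (intro measurable_If) (simp_all add: pred_def)
  qed
  have C0: "0 \<le> max x\<^sub>0 z" using x0 by simp
  interpret I: triggered_model M W \<mu> \<sigma> x\<^sub>0 y z "max x\<^sub>0 z" X L n Mo
  proof
    show "AE \<omega> in M. \<forall>t\<ge>0. \<exists>s\<in>{0..t}. X t \<omega> - max x\<^sub>0 z \<le> (\<sigma> * W t \<omega> - \<mu> * t) - (\<sigma> * W s \<omega> - \<mu> * s)"
      using facts by eventually_elim blast
    show "n t \<in> borel_measurable M" if "0 \<le> t" for t using Fil_measurable[OF nF[OF that]] .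
  qed (use mu sigma yz C0 path tpath meas XF MoF in auto)
  have cost: "AE \<omega> in M. path_cost c\<^sub>h k\<^sub>1 k\<^sub>2 k\<^sub>5 x\<^sub>0 \<tau> X L t \<omega> = ereal (c\<^sub>h * integral {0..t} (\<lambda>s. X s \<omega>)
      + c1 k\<^sub>1 k\<^sub>2 y z * n t \<omega> + 0 * c1 k\<^sub>1 k\<^sub>2 x\<^sub>0 z + k\<^sub>5 * L t \<omega>)" if "0 < t" for t
    using facts by eventually_elim (use that in simp)
  define E where "E = exp (2 * \<mu> * y / \<sigma>\<^sup>2) - 1"
  define Q where "Q = (z - y) + \<sigma>\<^sup>2 / (2 * \<mu>) * E"
  have E0: "0 \<le> E" unfolding E_def using mu yz by simp
  have Q: "0 < Q" unfolding Q_def using mu sigma E0 yz by (simp add: add_pos_nonneg)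
  have "average_cost M c\<^sub>h k\<^sub>1 k\<^sub>2 k\<^sub>5 x\<^sub>0 \<tau> X L =
      ereal (c\<^sub>h * (((z\<^sup>2 - y\<^sup>2) * (\<mu> / Q) + \<sigma>\<^sup>2) / (2 * \<mu>)) + c1 k\<^sub>1 k\<^sub>2 y z * (\<mu> / Q)
        + k\<^sub>5 * (\<sigma>\<^sup>2 / (2 * \<mu>) * E * (\<mu> / Q)))"
    unfolding Q_def E_def by (rule I.average_cost_eq[OF I.triggered_rates cost])
  also have "c\<^sub>h * (((z\<^sup>2 - y\<^sup>2) * (\<mu> / Q) + \<sigma>\<^sup>2) / (2 * \<mu>)) + c1 k\<^sub>1 k\<^sub>2 y z * (\<mu> / Q)
        + k\<^sub>5 * (\<sigma>\<^sup>2 / (2 * \<mu>) * E * (\<mu> / Q)) = F_delayed \<mu> \<sigma> c\<^sub>h k\<^sub>1 k\<^sub>2 k\<^sub>5 y z"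
  proof -
    \<comment> \<open>The denominator is the mean cycle length, the reciprocal of the order rate;
      the formula is mean cost per cycle over mean cycle length.\<close>
    have den: "Bdiff (zeta \<mu>) y z + \<sigma>\<^sup>2 / (2 * \<mu>\<^sup>2) * E = Q / \<mu>"
      unfolding Q_def Bdiff_def zeta_def using mu by (simp add: field_simps power2_eq_square)
    define d where "d = z\<^sup>2 - y\<^sup>2"
    define r where "r = \<sigma>\<^sup>2 / (2 * \<mu>) * E"
    define \<nu> where "\<nu> = \<mu> / Q"
    have Q\<nu>: "Q * \<nu> = \<mu>" unfolding \<nu>_def using Q by simp
    \<comment> \<open>The linear part of \<open>g0\<close> and the fourth-power term in \<sigma>
      combine to a multiple of \<open>Q\<close>, which becomes a constant cost rate after
      division.\<close>
    have num: "c1 k\<^sub>1 k\<^sub>2 y z + Bdiff (g0 \<mu> \<sigma> c\<^sub>h) y z + (\<sigma>^4 * c\<^sub>h / (4 * \<mu>^3) + \<sigma>\<^sup>2 * k\<^sub>5 / (2 * \<mu>)) * E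
      = c1 k\<^sub>1 k\<^sub>2 y z + c\<^sub>h / (2 * \<mu>) * d + \<sigma>\<^sup>2 * c\<^sub>h / (2 * \<mu>\<^sup>2) * Q + k\<^sub>5 * r"
      unfolding Q_def Bdiff_def g0_def d_def r_def using mu by (simp add: field_simps eval_nat_numeral)
    have "F_delayed \<mu> \<sigma> c\<^sub>h k\<^sub>1 k\<^sub>2 k\<^sub>5 y z
      = (c1 k\<^sub>1 k\<^sub>2 y z + c\<^sub>h / (2 * \<mu>) * d + \<sigma>\<^sup>2 * c\<^sub>h / (2 * \<mu>\<^sup>2) * Q + k\<^sub>5 * r) * \<nu>"
      unfolding F_delayed_def E_def[symmetric] den num \<nu>_def by simp
    also have "\<dots> = c1 k\<^sub>1 k\<^sub>2 y z * \<nu> + c\<^sub>h / (2 * \<mu>) * d * \<nu> + \<sigma>\<^sup>2 * c\<^sub>h / (2 * \<mu>\<^sup>2) * (Q * \<nu>) + k\<^sub>5 * (r * \<nu>)"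
      by (simp only: distrib_right mult.assoc)
    also have "\<sigma>\<^sup>2 * c\<^sub>h / (2 * \<mu>\<^sup>2) * (Q * \<nu>) = c\<^sub>h * (\<sigma>\<^sup>2 / (2 * \<mu>))"
      unfolding Q\<nu> using mu by (simp add: power2_eq_square)
    finally have "F_delayed \<mu> \<sigma> c\<^sub>h k\<^sub>1 k\<^sub>2 k\<^sub>5 y z =
      c1 k\<^sub>1 k\<^sub>2 y z * \<nu> + c\<^sub>h / (2 * \<mu>) * d * \<nu> + c\<^sub>h * (\<sigma>\<^sup>2 / (2 * \<mu>)) + k\<^sub>5 * (r * \<nu>)" .
    moreover have "c\<^sub>h * ((d * \<nu> + \<sigma>\<^sup>2) / (2 * \<mu>)) = c\<^sub>h / (2 * \<mu>) * d * \<nu> + c\<^sub>h * (\<sigma>\<^sup>2 / (2 * \<mu>))"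
      by (simp add: add_divide_distrib distrib_left)
    ultimately show ?thesis unfolding d_def r_def \<nu>_def by simp
  qed
  finally show ?thesis .
qed

end

theorem mainTheorem5:
  fixes M :: "'a measure"
    and W U LU :: "real \<Rightarrow> 'a \<Rightarrow> real"
    and \<mu> \<sigma> c\<^sub>h k\<^sub>1 k\<^sub>2 k\<^sub>5 x\<^sub>0 :: real
  defines "standard \<equiv> standard_policy M \<mu> \<sigma> x\<^sub>0 W U"
    and "delayed \<equiv> delayed_policy M \<mu> \<sigma> x\<^sub>0 W U"
    and "J \<equiv> average_cost M c\<^sub>h k\<^sub>1 k\<^sub>2 k\<^sub>5 x\<^sub>0"
    and "F \<equiv> F_std \<mu> \<sigma> c\<^sub>h k\<^sub>1 k\<^sub>2"
    and "Ft \<equiv> F_delayed \<mu> \<sigma> c\<^sub>h k\<^sub>1 k\<^sub>2 k\<^sub>5"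
    and "zs \<equiv> sqrt (2 * k\<^sub>1 * \<mu> / c\<^sub>h)"
  assumes "\<mu> > 0" "\<sigma> > 0" "c\<^sub>h > 0" "k\<^sub>1 > 0" "k\<^sub>2 > 0" "x\<^sub>0 > 0"
    and "brownian_motion M W"
    and "uncontrolled_inventory M \<mu> \<sigma> x\<^sub>0 W U LU"
  shows "(\<forall>y z \<tau> Y X L. 0 < y \<and> y < z \<and> delayed y z \<tau> Y X L \<longrightarrow> J \<tau> X L = ereal (Ft y z))
     \<and> (\<forall>y z \<tau> Y X L. 0 \<le> y \<and> y < z \<and> standard y z \<tau> Y X L \<longrightarrow> J \<tau> X L = ereal (F y z))
     \<and> (\<forall>y z. 0 < y \<and> y < z \<longrightarrow>
         (\<forall>\<tau> Y X L \<tau>' Y' X' L'.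
            delayed y z \<tau> Y X L \<and> standard y z \<tau>' Y' X' L' \<longrightarrow>
              (J \<tau> X L < J \<tau>' X' L' \<longleftrightarrow> \<sigma>\<^sup>2 * c\<^sub>h / (2 * \<mu>) + k\<^sub>5 * \<mu> < F y z))
         \<and> (Ft y z < F y z \<longleftrightarrow> \<sigma>\<^sup>2 * c\<^sub>h / (2 * \<mu>) + k\<^sub>5 * \<mu> < F y z))
     \<and> (k\<^sub>5 < k\<^sub>2 + sqrt (2 * k\<^sub>1 * c\<^sub>h / \<mu>) \<longrightarrow>
         (\<forall>y z. 0 < y \<and> y < z \<longrightarrow>
            \<sigma>\<^sup>2 * c\<^sub>h / (2 * \<mu>) + k\<^sub>5 * \<mu> < F y z \<and>
            (\<forall>\<tau> Y X L \<tau>' Y' X' L'.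
               delayed y z \<tau> Y X L \<and> standard y z \<tau>' Y' X' L' \<longrightarrow> J \<tau> X L < J \<tau>' X' L')))
     \<and> (k\<^sub>5 < k\<^sub>2 \<longrightarrow>
         (\<forall>z>0. \<exists>D<0. ((\<lambda>y. Ft y z) has_real_derivative D) (at 0)))
     \<and> (k\<^sub>5 < k\<^sub>2 \<longrightarrow>
         (\<exists>y. 0 < y \<and> y < zs \<and> Ft y zs < F 0 zs \<and>
            (\<forall>\<tau> Y X L \<tau>' Y' X' L'.
               delayed y zs \<tau> Y X L \<and> standard 0 zs \<tau>' Y' X' L' \<longrightarrow> J \<tau> X L < J \<tau>' X' L')))
     \<and> (\<forall>y z. 0 \<le> y \<and> y < z \<longrightarrow>
         F 0 zs \<le> F y z \<and>
         (\<forall>\<tau> Y X L \<tau>' Y' X' L'.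
            standard 0 zs \<tau> Y X L \<and> standard y z \<tau>' Y' X' L' \<longrightarrow> J \<tau> X L \<le> J \<tau>' X' L'))"
proof -
  interpret inventory_setting M W U LU \<mu> \<sigma> x\<^sub>0
    by unfold_locales (use assms in simp_all)
  have zs: "0 < zs" using assms unfolding zs_def by simp
  have delayed_J: "J \<tau> X L = ereal (Ft y z)" if "0 < y" "y < z" "delayed y z \<tau> Y X L" for y z \<tau> Y X L
    using delayed_cost[of y z \<tau> Y X L c\<^sub>h k\<^sub>1 k\<^sub>2 k\<^sub>5] that unfolding J_def Ft_def delayed_def by blast
  have standard_J: "J \<tau> X L = ereal (F y z)" if "0 \<le> y" "y < z" "standard y z \<tau> Y X L" for y z \<tau> Y X L
    using standard_cost[of y z \<tau> Y X L c\<^sub>h k\<^sub>1 k\<^sub>2 k\<^sub>5] that unfolding J_def F_def standard_def by blast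
  have iff: "Ft y z < F y z \<longleftrightarrow> \<sigma>\<^sup>2 * c\<^sub>h / (2 * \<mu>) + k\<^sub>5 * \<mu> < F y z" if "0 < y" "y < z" for y z
    unfolding Ft_def F_def using assms that by (intro F_delayed_less_F_std_iff) simp_all
  have opt: "F 0 zs \<le> F y z" if "0 \<le> y" "y < z" for y z
    unfolding F_def zs_def using assms that by (intro F_std_minimal) simp_all
  have F_opt: "F 0 zs = sqrt (2 * k\<^sub>1 * c\<^sub>h * \<mu>) + k\<^sub>2 * \<mu> + \<sigma>\<^sup>2 * c\<^sub>h / (2 * \<mu>)"
    unfolding F_def zs_def using assms by (intro F_std_at_optimum) simp_all
  have suff: "\<sigma>\<^sup>2 * c\<^sub>h / (2 * \<mu>) + k\<^sub>5 * \<mu> < F y z"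
    if k5: "k\<^sub>5 < k\<^sub>2 + sqrt (2 * k\<^sub>1 * c\<^sub>h / \<mu>)" and yz: "0 < y" "y < z" for y z
  proof -
    \<comment> \<open>Brings the optimal cost to the scale of the condition on
      \<open>k\<^sub>5\<close>: everything is \<mu> times a sum, plus the common idle holding
      rate.\<close>
    have "sqrt (2 * k\<^sub>1 * c\<^sub>h * \<mu>) = sqrt (\<mu>\<^sup>2 * (2 * k\<^sub>1 * c\<^sub>h / \<mu>))"
      using \<open>\<mu> > 0\<close> by (simp add: power2_eq_square ac_simps)
    also have "\<dots> = sqrt (2 * k\<^sub>1 * c\<^sub>h / \<mu>) * \<mu>"
      using \<open>\<mu> > 0\<close> unfolding real_sqrt_mult by simp
    finally have root: "sqrt (2 * k\<^sub>1 * c\<^sub>h * \<mu>) = sqrt (2 * k\<^sub>1 * c\<^sub>h / \<mu>) * \<mu>" .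
    have "k\<^sub>5 * \<mu> < (k\<^sub>2 + sqrt (2 * k\<^sub>1 * c\<^sub>h / \<mu>)) * \<mu>"
      using k5 \<open>\<mu> > 0\<close> by (rule mult_strict_right_mono)
    then have "\<sigma>\<^sup>2 * c\<^sub>h / (2 * \<mu>) + k\<^sub>5 * \<mu> < F 0 zs"
      unfolding F_opt root distrib_right by linarith
    also have "\<dots> \<le> F y z" using opt[of y z] yz by simp
    finally show ?thesis .
  qed
  have deriv: "\<exists>D<0. ((\<lambda>y. Ft y z) has_real_derivative D) (at 0)" if "k\<^sub>5 < k\<^sub>2" "0 < z" for z
  proof (intro exI conjI)
    show "((\<lambda>y. Ft y z) has_real_derivative (k\<^sub>5 - k\<^sub>2) * \<mu> / z) (at 0)"
      unfolding Ft_def using assms that by (intro F_delayed_deriv_zero) simp_all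
    show "(k\<^sub>5 - k\<^sub>2) * \<mu> / z < 0"
      using that \<open>\<mu> > 0\<close> by (intro divide_neg_pos mult_neg_pos) simp_all
  qed
  have improve: "\<exists>y. 0 < y \<and> y < zs \<and> Ft y zs < F 0 zs" if k5: "k\<^sub>5 < k\<^sub>2"
  proof -
    \<comment> \<open>At y = 0 the two cost functions agree, so a negative slope there yields a
      strictly better positive level.\<close>
    obtain D where D: "D < 0" "((\<lambda>y. Ft y zs) has_real_derivative D) (at 0)"
      using deriv[OF k5 zs] by blast
    obtain d where d: "0 < d" "\<And>h. 0 < h \<Longrightarrow> h < d \<Longrightarrow> Ft (0 + h) zs < Ft 0 zs"
      using DERIV_neg_dec_right[OF D(2,1)] by blast
    \<comment> \<open>Halving keeps \<open>h\<close> strictly below both the range of the slope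
      argument and \<open>zs\<close>.\<close>
    define h where "h = min d zs / 2"
    have h: "0 < h" "h < d" "h < zs" unfolding h_def using d(1) zs by (auto simp: min_def)
    have "Ft h zs < Ft 0 zs" using d(2)[OF h(1,2)] by simp
    also have "Ft 0 zs = F 0 zs" unfolding Ft_def F_def by (rule F_delayed_zero)
    finally show ?thesis using h by blast
  qed
  show ?thesis
  proof (intro conjI)
    show "\<forall>y z \<tau> Y X L. 0 < y \<and> y < z \<and> delayed y z \<tau> Y X L \<longrightarrow> J \<tau> X L = ereal (Ft y z)"
      using delayed_J by blast
    show "\<forall>y z \<tau> Y X L. 0 \<le> y \<and> y < z \<and> standard y z \<tau> Y X L \<longrightarrow> J \<tau> X L = ereal (F y z)"
      using standard_J by blast
    have cmp: "J \<tau> X L < J \<tau>' X' L' \<longleftrightarrow> \<sigma>\<^sup>2 * c\<^sub>h / (2 * \<mu>) + k\<^sub>5 * \<mu> < F y z"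
      if "0 < y" "y < z" "delayed y z \<tau> Y X L" "standard y z \<tau>' Y' X' L'" for y z \<tau> Y X L \<tau>' Y' X' L'
      using delayed_J[OF that(1-3)] standard_J[OF less_imp_le[OF that(1)] that(2,4)] iff[OF that(1,2)] by simp
    show "\<forall>y z. 0 < y \<and> y < z \<longrightarrow>
         (\<forall>\<tau> Y X L \<tau>' Y' X' L'.
            delayed y z \<tau> Y X L \<and> standard y z \<tau>' Y' X' L' \<longrightarrow>
              (J \<tau> X L < J \<tau>' X' L' \<longleftrightarrow> \<sigma>\<^sup>2 * c\<^sub>h / (2 * \<mu>) + k\<^sub>5 * \<mu> < F y z))
         \<and> (Ft y z < F y z \<longleftrightarrow> \<sigma>\<^sup>2 * c\<^sub>h / (2 * \<mu>) + k\<^sub>5 * \<mu> < F y z)"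
      using cmp iff by blast
    show "k\<^sub>5 < k\<^sub>2 + sqrt (2 * k\<^sub>1 * c\<^sub>h / \<mu>) \<longrightarrow>
         (\<forall>y z. 0 < y \<and> y < z \<longrightarrow>
            \<sigma>\<^sup>2 * c\<^sub>h / (2 * \<mu>) + k\<^sub>5 * \<mu> < F y z \<and>
            (\<forall>\<tau> Y X L \<tau>' Y' X' L'.
               delayed y z \<tau> Y X L \<and> standard y z \<tau>' Y' X' L' \<longrightarrow> J \<tau> X L < J \<tau>' X' L'))"
      using suff cmp by blast
    show "k\<^sub>5 < k\<^sub>2 \<longrightarrow> (\<forall>z>0. \<exists>D<0. ((\<lambda>y. Ft y z) has_real_derivative D) (at 0))"
      using deriv by blast
    show "k\<^sub>5 < k\<^sub>2 \<longrightarrow>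
         (\<exists>y. 0 < y \<and> y < zs \<and> Ft y zs < F 0 zs \<and>
            (\<forall>\<tau> Y X L \<tau>' Y' X' L'.
               delayed y zs \<tau> Y X L \<and> standard 0 zs \<tau>' Y' X' L' \<longrightarrow> J \<tau> X L < J \<tau>' X' L'))"
    proof
      assume "k\<^sub>5 < k\<^sub>2"
      then obtain y where y: "0 < y" "y < zs" "Ft y zs < F 0 zs" using improve by blast
      have "J \<tau> X L < J \<tau>' X' L'" if "delayed y zs \<tau> Y X L" "standard 0 zs \<tau>' Y' X' L'" for \<tau> Y X L \<tau>' Y' X' L'
        using delayed_J[OF y(1,2) that(1)] standard_J[OF order_refl zs that(2)] y(3) by simp
      then show "\<exists>y. 0 < y \<and> y < zs \<and> Ft y zs < F 0 zs \<and>
            (\<forall>\<tau> Y X L \<tau>' Y' X' L'.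
               delayed y zs \<tau> Y X L \<and> standard 0 zs \<tau>' Y' X' L' \<longrightarrow> J \<tau> X L < J \<tau>' X' L')"
        using y by blast
    qed
    have "J \<tau> X L \<le> J \<tau>' X' L'" if "0 \<le> y" "y < z" "standard 0 zs \<tau> Y X L" "standard y z \<tau>' Y' X' L'"
      for y z \<tau> Y X L \<tau>' Y' X' L'
      using standard_J[OF order_refl zs that(3)] standard_J[OF that(1,2,4)] opt[OF that(1,2)] by simp
    then show "\<forall>y z. 0 \<le> y \<and> y < z \<longrightarrow>
         F 0 zs \<le> F y z \<and>
         (\<forall>\<tau> Y X L \<tau>' Y' X' L'.
            standard 0 zs \<tau> Y X L \<and> standard y z \<tau>' Y' X' L' \<longrightarrow> J \<tau> X L \<le> J \<tau>' X' L')"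
      using opt by blast
  qed
qed

end
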